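(* Let $(S,X)$ be a Markov shift on some alphabet $\mathcal A$, with regular part $X^\#$. Let $\pi:(S,X^\#)\to(T,Y)$ be a Borel semiconjugacy such that: <br/>- $(T,Y)$ is a Borel automorphism; <br/>- $\pi$ is finite-to-one, i.e., $\pi^{-1}(y)$ is finite for every $y\in Y$; <br/>- $\pi$ has the Bowen property with respect to a locally finite relation on $\mathcal A$. <br/>Then there are a Markov shift $(\tilde S,\tilde X)$ and a $1$-Lipschitz map $\phi:\tilde X\to X^\#$ such that $\pi\circ\phi:\tilde X\to Y$ defines an injective semiconjugacy from $(\tilde S,\tilde X)$ to $(T,Y)$ and $\pi\circ\phi(\tilde X^\#)$ carries all invariant measures of $\pi(X^\#)$, i.e. every $T$-invariant ergodic Borel probability measure $\mu$ with $\mu(\pi(X^\#))=1$ satisfies $\mu(\pi\circ\phi(\tilde X^\#))=1$.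
   Context: All measures are ergodic, invariant, Borel probability measures. A Borel automorphism is a Borel isomorphism $T$ of a standard Borel space $Y$ onto itself. A symbolic system $(S,X)$ over a countable (possibly finite) alphabet $\mathcal A$ is a shift-invariant subset $X\subset\mathcal A^{\mathbb Z}$ (not necessarily closed) with the shift $S:(x_n)_{n\in\mathbb Z}\mapsto(x_{n+1})_{n\in\mathbb Z}$ and the distance $d(x,y)=\exp(-\inf\{|n|:x_n\neq y_n\})$. A Markov shift is a symbolic system of the form $X=\{x\in\mathcal A^{\mathbb Z}:\forall n\in\mathbb Z,\ x_n\to x_{n+1}\}$ for some simple directed graph with vertex set $\mathcal A$ (at most one arrow from $a$ to $b$ for any vertices $a,b$). The regular part $X^\#$ of a Markov shift $X$ is the set of $x\in X$ for which there are $u,v\in\mathcal A$ such that $u$ occurs infinitely many times in $(x_n)_{n\le0}$ and $v$ occurs infinitely many times in $(x_n)_{n\ge0}$. A semiconjugacy $\pi:(S,X)\to(T,Y)$ is a map $\pi:X\to Y$ (not necessarily onto) with $\pi\circ S=T\circ\pi$. A map $\phi$ between metric spaces is $1$-Lipschitz if $d(\phi(x),\phi(y))\le d(x,y)$ for all $x,y$; $\phi$ is not required to commute with the shifts. A semiconjugacy $\pi$ defined on a symbolic system $Z\subset\mathcal A^{\mathbb Z}$ has the Bowen property with respect to a reflexive and symmetric relation $\sim$ on $\mathcal A$ if, for all $x,y\in Z$: $\pi(x)=\pi(y)\iff\forall n\in\mathbb Z\ x_n\sim y_n$. The relation $\sim$ is locally finite if $\{b\in\mathcal A:b\sim a\}$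 is finite for each $a\in\mathcal A$. *)

theory Defs
  imports "HOL-Probability.Probability"
begin

definition borel_of :: "'a topology \<Rightarrow> 'a measure" where
  "borel_of X = sigma (topspace X) {U. openin X U}"

text \<open>A standard Borel space is a measurable space whose \<sigma>-algebra is the Borel
  \<sigma>-algebra of some Polish topology. Only \<^term>\<open>space Y\<close> and \<^term>\<open>sets Y\<close> are used:
  the measure carried by \<^term>\<open>Y\<close> is irrelevant.\<close>

definition standard_borel :: "'y measure \<Rightarrow> bool" where
  "standard_borel Y \<longleftrightarrow>
     (\<exists>X. completely_metrizable_space X \<and> second_countable X \<and>
          space Y = topspace X \<and> sets Y = sets (borel_of X))"

definition borel_automorphism :: "'y measure \<Rightarrow> ('y \<Rightarrow> 'y) \<Rightarrow> bool" where
  "borel_automorphism Y T \<longleftrightarrow>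
     standard_borel Y \<and> bij_betw T (space Y) (space Y) \<and>
     T \<in> measurable Y Y \<and> inv_into (space Y) T \<in> measurable Y Y"

definition ergodic_invariant_prob :: "'y measure \<Rightarrow> ('y \<Rightarrow> 'y) \<Rightarrow> 'y measure \<Rightarrow> bool" where
  "ergodic_invariant_prob Y T \<mu> \<longleftrightarrow>
     sets \<mu> = sets Y \<and> prob_space \<mu> \<and> distr \<mu> Y T = \<mu> \<and>
     (\<forall>B\<in>sets Y. T -` B \<inter> space Y = B \<longrightarrow> emeasure \<mu> B = 0 \<or> emeasure \<mu> B = 1)"

definition left_shift :: "(int \<Rightarrow> 'a) \<Rightarrow> (int \<Rightarrow> 'a)" where
  "left_shift x = (\<lambda>n. x (n + 1))"

text \<open>The case \<open>x = y\<close> is the convention \<open>exp (- inf {}) = exp (-\<infinity>) = 0\<close>.\<close>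

definition sdist :: "(int \<Rightarrow> 'a) \<Rightarrow> (int \<Rightarrow> 'a) \<Rightarrow> real" where
  "sdist x y = (if x = y then 0 else exp (- real (Inf {nat \<bar>n\<bar> |n. x n \<noteq> y n})))"

lemma sdist_eq_0_iff: "sdist x y = 0 \<longleftrightarrow> x = y"
  by (simp add: sdist_def)

lemma sdist_commute: "sdist x y = sdist y x"
  by (simp add: sdist_def eq_commute)

lemma sdist_ultra: "sdist x z \<le> max (sdist x y) (sdist y z)"
proof (cases "x = z \<or> x = y \<or> y = z")
  case True
  then show ?thesis by (auto simp: sdist_def le_max_iff_disj)
next
  case False
  define D where "D u v = {nat \<bar>n\<bar> |n. u n \<noteq> v n}" for u v :: "int \<Rightarrow> 'a"
  have ne: "D x z \<noteq> {}"
    using False by (auto simp: D_def fun_eq_iff)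
  have "Inf (D x z) \<in> D x z"
    using ne by (rule Inf_nat_def1)
  then obtain n where n: "Inf (D x z) = nat \<bar>n\<bar>" "x n \<noteq> z n"
    unfolding D_def by blast
  then have "nat \<bar>n\<bar> \<in> D x y \<or> nat \<bar>n\<bar> \<in> D y z"
    unfolding D_def by auto
  then have "Inf (D x y) \<le> Inf (D x z) \<or> Inf (D y z) \<le> Inf (D x z)"
    using n(1) by (auto intro: cInf_lower)
  then show ?thesis
    using False by (auto simp: sdist_def D_def max_def)
qed

lemma Metric_space_sdist: "Metric_space X sdist"
proof
  show "0 \<le> sdist x y" for x y :: "int \<Rightarrow> 'a"
    by (simp add: sdist_def)
  then show "sdist x z \<le> sdist x y + sdist y z" for x y z :: "int \<Rightarrow> 'a"
    using sdist_ultra[of x z y] by (smt (verit))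
qed (auto simp: sdist_commute sdist_eq_0_iff)

definition symbolic_borel :: "(int \<Rightarrow> 'a) set \<Rightarrow> (int \<Rightarrow> 'a) measure" where
  "symbolic_borel X = borel_of (Metric_space.mtopology X sdist)"

definition alphabet_graph :: "'a set \<Rightarrow> ('a \<times> 'a) set \<Rightarrow> bool" where
  "alphabet_graph A E \<longleftrightarrow> countable A \<and> E \<subseteq> A \<times> A"

definition markov_shift :: "'a set \<Rightarrow> ('a \<times> 'a) set \<Rightarrow> (int \<Rightarrow> 'a) set" where
  "markov_shift A E = {x. (\<forall>n. x n \<in> A) \<and> (\<forall>n. (x n, x (n + 1)) \<in> E)}"

definition regular_part :: "'a set \<Rightarrow> ('a \<times> 'a) set \<Rightarrow> (int \<Rightarrow> 'a) set" where
  "regular_part A E =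
     {x \<in> markov_shift A E. \<exists>u\<in>A. \<exists>v\<in>A.
        infinite {n. n \<le> 0 \<and> x n = u} \<and> infinite {n. 0 \<le> n \<and> x n = v}}"

definition semiconjugacy ::
    "('x \<Rightarrow> 'x) \<Rightarrow> 'x set \<Rightarrow> ('y \<Rightarrow> 'y) \<Rightarrow> 'y set \<Rightarrow> ('x \<Rightarrow> 'y) \<Rightarrow> bool" where
  "semiconjugacy S X T Y \<pi> \<longleftrightarrow> \<pi> \<in> X \<rightarrow> Y \<and> (\<forall>x\<in>X. \<pi> (S x) = T (\<pi> x))"

definition bowen_property ::
    "'a set \<Rightarrow> ('a \<times> 'a) set \<Rightarrow> (int \<Rightarrow> 'a) set \<Rightarrow> ((int \<Rightarrow> 'a) \<Rightarrow> 'y) \<Rightarrow> bool" where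
  "bowen_property A R Z \<pi> \<longleftrightarrow>
     R \<subseteq> A \<times> A \<and> refl_on A R \<and> sym R \<and>
     (\<forall>x\<in>Z. \<forall>y\<in>Z. \<pi> x = \<pi> y \<longleftrightarrow> (\<forall>n. (x n, y n) \<in> R))"

definition locally_finite_on :: "'a set \<Rightarrow> ('a \<times> 'a) set \<Rightarrow> bool" where
  "locally_finite_on A R \<longleftrightarrow> (\<forall>a\<in>A. finite {b \<in> A. (b, a) \<in> R})"

definition one_lipschitz_on ::
    "(int \<Rightarrow> 'a) set \<Rightarrow> ((int \<Rightarrow> 'a) \<Rightarrow> (int \<Rightarrow> 'b)) \<Rightarrow> bool" where
  "one_lipschitz_on X \<phi> \<longleftrightarrow> (\<forall>x\<in>X. \<forall>y\<in>X. sdist (\<phi> x) (\<phi> y) \<le> sdist x y)"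

end

theory Submission
  imports Defs
begin

text \<open>By the Bowen property and local finiteness, the fibre of \<open>\<pi>\<close> through a regular point \<open>x\<close> consists of all
  sequences of the Markov shift that are related to \<open>x\<close>. It is compact and finite: a finite bundle of
  strands. If a word is related to a sufficiently long piece of all the strands, then by compactness
  it agrees near the centre with one of them; a marker is a finite bundle of words for which this
  already holds. At an occurrence of a marker the past and the future of the strands can be
  recombined freely, so the pieces of fibres between successive occurrences of a marker are the loops
  of a Markov shift, each of whose points glues together to exactly one fibre. The marker occurs
  nowhere inside its loops, hence a fibre determines its decomposition into loops. To separate the
  codings that belong to different markers, the markers are well-ordered, and the loops of a marker
  must not contain any earlier marker. For an ergodic measure, the first marker that occurs with
  positive probability occurs almost surely infinitely often in the past and in the future, while the
  earlier ones almost surely never occur; so almost every fibre is coded. The image in \<open>Y\<close> of a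
  Borel set that is a union of fibres is Borel by Lusin's separation theorem.\<close>

subsection \<open>Lusin separation\<close>

text \<open>Injectivity is demanded on the whole new shift, not merely on its regular part. Whatever
  path is taken, the fibre it yields must therefore reveal the base marker and the cutting times, so
  the ban on earlier markers has to be a local condition on vertices. Markers carry two radii
  because compactness loses ground: a word related to all the strands on the window is only known to
  follow one of them on the smaller core. Splicing takes place at the centre of an occurrence and
  strands are identified on the core, so the loss does not accumulate along a path. The relation on
  the alphabet need not be transitive; transitivity is available only between whole regular
  sequences. A candidate word is therefore compared with all the strands and not with a single one.
  Borel images in \<open>Y\<close> matter twice: ergodicity applies only to Borel subsets of
  \<open>Y\<close>, and \<open>emeasure\<close> is 0 on sets outside the sigma-algebra. Since \<pi>
  is not injective, the tool is the separation of the image of a union of fibres from the image of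
  its complement.\<close>

definition cylinder :: "nat \<Rightarrow> (nat \<Rightarrow> nat) \<Rightarrow> (nat \<Rightarrow> nat) set" where
  "cylinder k w = {v. \<forall>i<k. v i = w i}"

lemma cylinder_self [simp]: "w \<in> cylinder k w"
  by (simp add: cylinder_def)

lemma cylinder_antimono: "k \<le> l \<Longrightarrow> cylinder l w \<subseteq> cylinder k w"
  by (auto simp: cylinder_def)

lemma open_contains_cylinder:
  assumes "open U" "w \<in> U"
  shows "\<exists>k. cylinder k w \<subseteq> U"
proof -
  have "openin (product_topology (\<lambda>_. euclidean) UNIV) U"
    using assms(1) by (simp add: open_fun_def)
  from product_topology_open_contains_basis[OF this assms(2)]
  obtain X :: "nat \<Rightarrow> nat set" where X: "w \<in> Pi\<^sub>E UNIV X" "finite {i. X i \<noteq> UNIV}" "Pi\<^sub>E UNIV X \<subseteq> U"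
    by (elim exE conjE) simp
  obtain k where k: "\<And>i. X i \<noteq> UNIV \<Longrightarrow> i < k"
    using X(2) unfolding finite_nat_set_iff_bounded by blast
  have "cylinder k w \<subseteq> Pi\<^sub>E UNIV X"
  proof
    fix v assume v: "v \<in> cylinder k w"
    show "v \<in> Pi\<^sub>E UNIV X"
    proof (rule PiE_I)
      fix i :: nat
      show "v i \<in> X i"
        using v k[of i] X(1) by (cases "X i = UNIV") (auto simp: cylinder_def PiE_iff)
    qed simp
  qed
  then show ?thesis using X(3) by blast
qed

lemma continuous_on_nat_cylinder:
  fixes g :: "(nat \<Rightarrow> nat) \<Rightarrow> nat"
  assumes "continuous_on F g" "w \<in> F"
  shows "\<exists>k. \<forall>v\<in>F \<inter> cylinder k w. g v = g w"
proof -
  obtain U where "open U" "U \<inter> F = g -` {g w} \<inter> F"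
    using assms(1) by (meson continuous_on_open_invariant Topological_Spaces.discrete_topology_class.open_discrete)
  then show ?thesis
    using open_contains_cylinder[of U w] assms(2) by blast
qed

lemma closed_cylinder_limit:
  assumes "closed F" "\<And>k. F \<inter> cylinder k w \<noteq> {}"
  shows "w \<in> F"
  using assms open_contains_cylinder[of "- F" w] by (auto simp: closed_def)

text \<open>The domain is a closed subset of Baire space instead of the whole space; this admits the
  empty set and lets sums and fibre products of domains be used directly.\<close>

definition analytic_set :: "'b::topological_space set \<Rightarrow> bool" where
  "analytic_set S \<longleftrightarrow>
     (\<exists>F (r :: (nat \<Rightarrow> nat) \<Rightarrow> 'b). closed F \<and> continuous_on F r \<and> S = r ` F)"

lemma analytic_set_choice:
  assumes "\<And>i. analytic_set (S i)"
  shows "\<exists>F r. (\<forall>i. closed (F i)) \<and> (\<forall>i. continuous_on (F i) (r i)) \<and>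
    (\<forall>i. S i = r i ` (F i :: (nat \<Rightarrow> nat) set))"
proof -
  have "\<forall>i. \<exists>p. closed (fst p) \<and> continuous_on (fst p) (snd p) \<and>
      S i = snd p ` (fst p :: (nat \<Rightarrow> nat) set)"
    using assms unfolding analytic_set_def by simp
  from choice[OF this] obtain p where "\<forall>i. closed (fst (p i)) \<and>
      continuous_on (fst (p i)) (snd (p i)) \<and> S i = snd (p i) ` (fst (p i) :: (nat \<Rightarrow> nat) set)"
    by blast
  then show ?thesis by (intro exI[of _ "\<lambda>i. fst (p i)"] exI[of _ "\<lambda>i. snd (p i)"]) auto
qed

lemma analytic_set_closed: "closed (F :: (nat \<Rightarrow> nat) set) \<Longrightarrow> analytic_set F"
  unfolding analytic_set_def by (rule exI[of _ F], rule exI[of _ "\<lambda>x. x"]) auto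

text \<open>The domain is the disjoint sum of the given domains: coordinate 0 names the summand, the
  tail is the point in it.\<close>

lemma analytic_set_UN:
  assumes "\<And>i::nat. analytic_set (S i)"
  shows "analytic_set (\<Union>i. S i)"
proof -
  from analytic_set_choice[of S, OF assms] obtain F r where "\<forall>i. closed (F i)"
    "\<forall>i. continuous_on (F i) (r i)" "\<forall>i. S i = r i ` (F i :: (nat \<Rightarrow> nat) set)"
    by (elim exE conjE)
  note Fr = this[rule_format]
  define tl where "tl w = (\<lambda>n. w (Suc n))" for w :: "nat \<Rightarrow> nat"
  define G where "G = {w. tl w \<in> F (w 0)}"
  define \<rho> where "\<rho> w = r (w 0) (tl w)" for w
  have tl: "continuous_on A tl" for A
    unfolding tl_def by (intro continuous_on_coordinatewise_then_product)
      (rule continuous_on_subset[OF continuous_on_product_coordinates subset_UNIV])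
  have op: "open {w :: nat \<Rightarrow> nat. w 0 = i}" for i
    using open_vimage[OF Topological_Spaces.discrete_topology_class.open_discrete[of "{i}"] continuous_on_product_coordinates[of "0::nat"]]
    by (simp add: vimage_def)
  have "- G = (\<Union>i. {w. w 0 = i} \<inter> tl -` (- F i))"
    by (auto simp: G_def)
  also have "open \<dots>"
    by (intro open_UN ballI open_Int op open_vimage tl) (use Fr(1) in auto)
  finally have "closed G"
    by (simp add: closed_def)
  moreover have "continuous_on G \<rho>"
    unfolding continuous_on_def
  proof
    fix w assume w: "w \<in> G"
    \<comment> \<open>Coordinate 0 is locally constant, so near \<open>w\<close> the map
      \<open>\<rho>\<close> is a single \<open>r i\<close> applied to the tail.\<close>
    let ?H = "G \<inter> {v. v 0 = w 0}"
    have "continuous_on ?H (\<lambda>v. r (w 0) (tl v))"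
      by (rule continuous_on_compose2[OF Fr(2)[of "w 0"] tl]) (auto simp: G_def)
    then have "continuous_on ?H \<rho>"
      by (rule continuous_on_eq) (auto simp: \<rho>_def)
    then have "(\<rho> \<longlongrightarrow> \<rho> w) (at w within ?H)"
      using w by (simp add: continuous_on_def)
    moreover have "at w within ?H = at w within G"
      by (rule at_within_nhd[OF _ op[of "w 0"]]) auto
    ultimately show "(\<rho> \<longlongrightarrow> \<rho> w) (at w within G)" by simp
  qed
  moreover have "(\<Union>i. S i) = \<rho> ` G"
  proof
    show "\<rho> ` G \<subseteq> (\<Union>i. S i)" using Fr(3) by (auto simp: G_def \<rho>_def)
    show "(\<Union>i. S i) \<subseteq> \<rho> ` G"
    proof
      fix x assume "x \<in> (\<Union>i. S i)"
      then obtain i w where "w \<in> F i" "x = r i w" using Fr(3) by auto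
      then have "case_nat i w \<in> G" "\<rho> (case_nat i w) = x"
        by (auto simp: G_def \<rho>_def tl_def)
      then show "x \<in> \<rho> ` G" by blast
    qed
  qed
  ultimately show ?thesis unfolding analytic_set_def by blast
qed

text \<open>The domain is a fibre product: \<open>w\<close> codes one point for each index through
  \<open>prod_encode\<close>, and only those \<open>w\<close> are kept at which all the maps take
  the same value.\<close>

lemma analytic_set_INT:
  fixes S :: "nat \<Rightarrow> (nat \<Rightarrow> nat) set"
  assumes "\<And>i. analytic_set (S i)"
  shows "analytic_set (\<Inter>i. S i)"
proof -
  from analytic_set_choice[of S, OF assms] obtain F r where "\<forall>i. closed (F i)"
    "\<forall>i. continuous_on (F i) (r i)" "\<forall>i. S i = r i ` (F i :: (nat \<Rightarrow> nat) set)"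
    by (elim exE conjE)
  note Fr = this[rule_format]
  define sec where "sec i w = (\<lambda>n. w (prod_encode (i, n)))" for i and w :: "nat \<Rightarrow> nat"
  have sec: "continuous_on A (sec i)" for A i
    unfolding sec_def by (intro continuous_on_coordinatewise_then_product)
      (rule continuous_on_subset[OF continuous_on_product_coordinates subset_UNIV])
  define G0 where "G0 = (\<Inter>i. sec i -` F i)"
  have G0: "closed G0"
    unfolding G0_def by (intro closed_INT ballI closed_vimage Fr sec)
  define G where "G = (\<Inter>i. {w \<in> G0. r i (sec i w) = r 0 (sec 0 w)})"
  have c: "continuous_on G0 (\<lambda>w. r i (sec i w))" for i
    by (rule continuous_on_compose2[OF Fr(2)[of i] sec]) (auto simp: G0_def)
  have "closed {w \<in> G0. r i (sec i w) = r 0 (sec 0 w)}" for i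
  proof -
    have "closed (G0 \<inter> (\<lambda>w. (r i (sec i w) n, r 0 (sec 0 w) n)) -` {p. fst p = snd p})" for n
      by (intro continuous_closed_preimage continuous_on_Pair G0 closed_Collect_eq
          continuous_on_fst continuous_on_snd continuous_on_id
          continuous_on_product_then_coordinatewise[OF c])
    then have "closed (\<Inter>n. G0 \<inter> (\<lambda>w. (r i (sec i w) n, r 0 (sec 0 w) n)) -` {p. fst p = snd p})"
      by (intro closed_INT ballI)
    then show ?thesis by (rule back_subst[of closed]) auto
  qed
  then have "closed G" unfolding G_def by blast
  moreover have "continuous_on G (\<lambda>w. r 0 (sec 0 w))"
    by (rule continuous_on_subset[OF c]) (auto simp: G_def)
  moreover have "(\<Inter>i. S i) = (\<lambda>w. r 0 (sec 0 w)) ` G"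
  proof
    show "(\<lambda>w. r 0 (sec 0 w)) ` G \<subseteq> (\<Inter>i. S i)"
    proof clarsimp
      fix w i assume w: "w \<in> G"
      then have "r i (sec i w) = r 0 (sec 0 w)" "sec i w \<in> F i"
        by (simp_all add: G_def G0_def)
      then show "r 0 (sec 0 w) \<in> S i" using Fr(3)[of i] by (metis imageI)
    qed
    show "(\<Inter>i. S i) \<subseteq> (\<lambda>w. r 0 (sec 0 w)) ` G"
    proof
      fix x assume "x \<in> (\<Inter>i. S i)"
      then have "\<forall>i. \<exists>v. v \<in> F i \<and> x = r i v" using Fr(3) by auto
      then obtain v where v: "\<And>i. v i \<in> F i" "\<And>i. x = r i (v i)" by metis
      define w where "w = (\<lambda>n. case prod_decode n of (i, m) \<Rightarrow> v i m)"
      have s: "sec i w = v i" for i by (auto simp: sec_def w_def)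
      have "w \<in> G" unfolding G_def G0_def using v s by auto
      then show "x \<in> (\<lambda>w. r 0 (sec 0 w)) ` G" using v(2)[of 0] s by (auto intro!: image_eqI[of _ _ w])
    qed
  qed
  ultimately show ?thesis unfolding analytic_set_def by blast
qed

lemma open_cylinder: "open (cylinder k w)"
proof -
  have "cylinder k w = (\<Inter>i\<in>{..<k}. (\<lambda>v. v i) -` {w i})"
    by (auto simp: cylinder_def)
  also have "open \<dots>"
    by (intro open_INT ballI open_vimage continuous_on_product_coordinates) (simp_all add: Topological_Spaces.discrete_topology_class.open_discrete)
  finally show ?thesis .
qed

text \<open>Membership in \<open>{w. cylinder k w \<subseteq> U}\<close> depends on the first
  \<open>k\<close> coordinates only, so this set is closed, and \<open>U\<close> is the union of
  these sets over \<open>k\<close>.\<close>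

lemma analytic_set_open:
  assumes "open (U :: (nat \<Rightarrow> nat) set)"
  shows "analytic_set U"
proof -
  have "closed {w. cylinder k w \<subseteq> U}" for k
  proof -
    have "- {w. cylinder k w \<subseteq> U} = (\<Union>w\<in>- {w. cylinder k w \<subseteq> U}. cylinder k w)"
      by (fastforce simp: cylinder_def)
    also have "open \<dots>" by (intro open_UN ballI open_cylinder)
    finally show ?thesis by (simp add: closed_def)
  qed
  then have "analytic_set (\<Union>k. {w. cylinder k w \<subseteq> U})"
    by (intro analytic_set_UN analytic_set_closed)
  moreover have "(\<Union>k. {w. cylinder k w \<subseteq> U}) = U"
    using open_contains_cylinder[OF assms] cylinder_self by blast
  ultimately show ?thesis by simp
qed

lemma analytic_set_borel:
  assumes "S \<in> sets (borel :: (nat \<Rightarrow> nat) measure)"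
  shows "analytic_set S"
proof -
  have "S \<in> sigma_sets UNIV {U :: (nat \<Rightarrow> nat) set. open U}"
    using assms by (simp add: borel_def)
  \<comment> \<open>Analytic sets are not closed under complements, so the induction carries the set
    and its complement together.\<close>
  then have "analytic_set S \<and> analytic_set (- S)"
  proof induction
    case (Basic U)
    then show ?case by (auto intro: analytic_set_open analytic_set_closed simp: closed_def)
  next
    case Empty
    then show ?case by (auto intro!: analytic_set_closed)
  next
    case (Compl U)
    then show ?case by (simp add: Compl_eq_Diff_UNIV[symmetric])
  next
    case (Union S)
    then have "analytic_set (\<Union>i. S i)" "analytic_set (\<Inter>i. - S i)"
      by (intro analytic_set_UN analytic_set_INT; simp)+
    then show ?case by simp
  qed
  then show ?thesis ..
qed

definition separable_by :: "'y measure \<Rightarrow> 'y set \<Rightarrow> 'y set \<Rightarrow> bool" where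
  "separable_by M P Q \<longleftrightarrow> (\<exists>C\<in>sets M. P \<subseteq> C \<and> C \<inter> Q = {})"

lemma separable_by_UN:
  assumes "\<And>(i::nat) (j::nat). separable_by M (P i) (Q j)"
  shows "separable_by M (\<Union>i. P i) (\<Union>j. Q j)"
proof -
  define C where "C i j = (SOME C. C \<in> sets M \<and> P i \<subseteq> C \<and> C \<inter> Q j = {})" for i j
  have C: "C i j \<in> sets M" "P i \<subseteq> C i j" "C i j \<inter> Q j = {}" for i j
    using assms[of i j] someI_ex[of "\<lambda>C. C \<in> sets M \<and> P i \<subseteq> C \<and> C \<inter> Q j = {}"]
    unfolding separable_by_def C_def by blast+
  have "(\<Inter>j. C i j) \<in> sets M" for i
    by (rule sets.countable_INT') (use C(1) in auto)
  then have "(\<Union>i. \<Inter>j. C i j) \<in> sets M" by (intro sets.countable_UN'') auto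
  moreover have "(\<Union>i. P i) \<subseteq> (\<Union>i. \<Inter>j. C i j)" using C(2) by blast
  moreover have "(\<Union>i. \<Inter>j. C i j) \<inter> (\<Union>j. Q j) = {}" using C(3) by blast
  ultimately show ?thesis unfolding separable_by_def by blast
qed

text \<open>Lusin's argument: if the two images cannot be separated, then neither can the images of
  suitable smaller and smaller cylinders, which shrink to a pair of points.\<close>

lemma separable_by_images:
  assumes F: "closed F1" "closed F2" and sub: "g1 ` F1 \<subseteq> space M"
    and loc: "\<And>w1 w2. w1 \<in> F1 \<Longrightarrow> w2 \<in> F2 \<Longrightarrow>
      \<exists>k. separable_by M (g1 ` (F1 \<inter> cylinder k w1)) (g2 ` (F2 \<inter> cylinder k w2))"
  shows "separable_by M (g1 ` F1) (g2 ` F2)"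
proof (rule ccontr)
  define bad where "bad k p \<longleftrightarrow>
    \<not> separable_by M (g1 ` (F1 \<inter> cylinder k (fst p))) (g2 ` (F2 \<inter> cylinder k (snd p)))" for k p
  assume "\<not> separable_by M (g1 ` F1) (g2 ` F2)"
  then have bad0: "bad 0 (w1, w2)" for w1 w2
    by (simp add: bad_def cylinder_def)
  have step: "\<exists>q. bad (Suc k) q \<and> fst q \<in> cylinder k (fst p) \<and> snd q \<in> cylinder k (snd p)"
    if "bad k p" for k p
  proof (rule ccontr)
    assume "\<not> ?thesis"
    then have *: "separable_by M (g1 ` (F1 \<inter> cylinder (Suc k) v1)) (g2 ` (F2 \<inter> cylinder (Suc k) v2))"
      if "v1 \<in> cylinder k (fst p)" "v2 \<in> cylinder k (snd p)" for v1 v2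
      using that by (auto simp: bad_def)
    \<comment> \<open>Both cylinders split into countably many children. If every pair of children
      were separable, \<open>separable_by_UN\<close> would separate the parents.\<close>
    have split: "cylinder k w = (\<Union>m. cylinder (Suc k) (w(k := m)))" for w
    proof (intro equalityI subsetI)
      fix v assume v: "v \<in> cylinder k w"
      then have "v \<in> cylinder (Suc k) (w(k := v k))" by (auto simp: cylinder_def less_Suc_eq)
      then show "v \<in> (\<Union>m. cylinder (Suc k) (w(k := m)))" by blast
    next
      fix v assume "v \<in> (\<Union>m. cylinder (Suc k) (w(k := m)))"
      then obtain m where "v \<in> cylinder (Suc k) (w(k := m))" by blast
      then show "v \<in> cylinder k w" unfolding cylinder_def by (auto dest: less_SucI)
    qed
    have "separable_by M (\<Union>m. g1 ` (F1 \<inter> cylinder (Suc k) ((fst p)(k := m))))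
                         (\<Union>m. g2 ` (F2 \<inter> cylinder (Suc k) ((snd p)(k := m))))"
      by (rule separable_by_UN, rule *) (auto simp: cylinder_def)
    then have "\<not> bad k p"
      by (simp only: bad_def split[of "fst p"] split[of "snd p"] Int_UN_distrib image_UN not_not)
    with that show False by simp
  qed
  have "\<exists>p. bad 0 p" using bad0 by blast
  from dependent_nat_choice[of bad "\<lambda>k p q. fst q \<in> cylinder k (fst p) \<and> snd q \<in> cylinder k (snd p)", OF this step]
  have "\<exists>p. \<forall>k. bad k (p k) \<and> fst (p (Suc k)) \<in> cylinder k (fst (p k)) \<and>
      snd (p (Suc k)) \<in> cylinder k (snd (p k))" .
  then obtain p where p: "\<And>k. bad k (p k)"
    and pS: "\<And>k. fst (p (Suc k)) \<in> cylinder k (fst (p k)) \<and> snd (p (Suc k)) \<in> cylinder k (snd (p k))"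
    by metis
  define w1 where "w1 i = fst (p (Suc i)) i" for i
  define w2 where "w2 i = snd (p (Suc i)) i" for i
  have stab: "fst (p (k + d)) \<in> cylinder k (fst (p k)) \<and> snd (p (k + d)) \<in> cylinder k (snd (p k))" for k d
  proof (induction d)
    case (Suc d)
    then show ?case using pS[of "k + d"] by (auto simp: cylinder_def)
  qed simp
  \<comment> \<open>The chosen cylinders are nested, so stage \<open>k\<close> has already settled
    the first \<open>k\<close> coordinates of the limit points \<open>w1\<close> and
    \<open>w2\<close>.\<close>
  have eq: "cylinder k (fst (p k)) = cylinder k w1 \<and> cylinder k (snd (p k)) = cylinder k w2" for k
  proof -
    have "fst (p k) i = w1 i \<and> snd (p k) i = w2 i" if "i < k" for i
      using stab[of "Suc i" "k - Suc i"] that by (auto simp: cylinder_def w1_def w2_def)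
    then show ?thesis by (auto simp: cylinder_def)
  qed
  have bad: "\<not> separable_by M (g1 ` (F1 \<inter> cylinder k w1)) (g2 ` (F2 \<inter> cylinder k w2))" for k
    using p[of k] eq[of k] by (simp add: bad_def)
  have triv: "separable_by M {} Q" for Q
    unfolding separable_by_def by (rule bexI[of _ "{}"]) auto
  have "F1 \<inter> cylinder k w1 \<noteq> {}" for k
    using bad[of k] triv by auto
  then have "w1 \<in> F1" using F(1) by (rule closed_cylinder_limit[rotated])
  have "F2 \<inter> cylinder k w2 \<noteq> {}" for k
  proof
    assume "F2 \<inter> cylinder k w2 = {}"
    then have "separable_by M (g1 ` (F1 \<inter> cylinder k w1)) (g2 ` (F2 \<inter> cylinder k w2))"
      unfolding separable_by_def using sub by (intro bexI[of _ "space M"]) auto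
    with bad show False by blast
  qed
  then have "w2 \<in> F2" using F(2) by (rule closed_cylinder_limit[rotated])
  with \<open>w1 \<in> F1\<close> loc bad show False by blast
qed

text \<open>To apply \<open>separable_by_images\<close> to a merely Borel map \<open>g\<close>, replace its domain by the graph of
  \<open>t \<mapsto> (g t \<in> U m)\<^sub>m\<close>, written into the odd coordinates; on the graph the value of \<open>g\<close> is
  continuous as far as the sets \<open>U m\<close> can tell.\<close>

lemma separable_by_borel_images:
  fixes g :: "(nat \<Rightarrow> nat) \<Rightarrow> 'y" and U :: "nat \<Rightarrow> 'y set"
  assumes U: "\<And>m. U m \<in> sets M"
    and D: "D1 \<in> sets borel" "D2 \<in> sets borel"
    and g: "g ` D1 \<subseteq> space M"
    and meas: "\<And>m. {t \<in> D1. g t \<in> U m} \<in> sets borel" "\<And>m. {t \<in> D2. g t \<in> U m} \<in> sets borel"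
    and sep: "\<And>t1 t2. t1 \<in> D1 \<Longrightarrow> t2 \<in> D2 \<Longrightarrow> \<exists>m. (g t1 \<in> U m) \<noteq> (g t2 \<in> U m)"
  shows "separable_by M (g ` D1) (g ` D2)"
proof -
  define evens where "evens t = (\<lambda>i. t (2 * i))" for t :: "nat \<Rightarrow> nat"
  define \<Gamma> where "\<Gamma> D = {t. evens t \<in> D \<and> (\<forall>m. t (2 * m + 1) = of_bool (g (evens t) \<in> U m))}" for D
  have evens_cont: "continuous_on UNIV evens"
    unfolding evens_def by (intro continuous_on_coordinatewise_then_product continuous_on_product_coordinates)
  have evens: "evens -` S \<in> sets borel" if "S \<in> sets borel" for S
    using measurable_sets[OF borel_measurable_continuous_onI[OF evens_cont] that] by simp
  have cl: "{t :: nat \<Rightarrow> nat. t i = a} \<in> sets borel" for i a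
  proof -
    have "open ((\<lambda>t :: nat \<Rightarrow> nat. t i) -` {a})"
      by (intro open_vimage continuous_on_product_coordinates
          Topological_Spaces.discrete_topology_class.open_discrete)
    then show ?thesis by (simp add: vimage_def)
  qed
  have \<Gamma>: "\<Gamma> D \<in> sets borel" if DD: "D \<in> sets borel" "\<And>m. {t \<in> D. g t \<in> U m} \<in> sets borel" for D
  proof -
    have "\<Gamma> D = (\<Inter>m. (evens -` {t \<in> D. g t \<in> U m} \<inter> {t. t (2 * m + 1) = 1}) \<union>
                  (evens -` (D - {t \<in> D. g t \<in> U m}) \<inter> {t. t (2 * m + 1) = 0}))"
    proof -
      have "(a = of_bool P) = (P \<and> a = 1 \<or> \<not> P \<and> a = 0)" for a :: nat and P by (cases P) auto
      then show ?thesis unfolding \<Gamma>_def by auto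
    qed
    also have "\<dots> \<in> sets borel"
      by (intro sets.countable_INT' image_subsetI sets.Un sets.Int evens cl sets.Diff DD) auto
    finally show ?thesis .
  qed
  have evens_\<Gamma>: "evens ` \<Gamma> D = D" for D
  proof (intro equalityI subsetI)
    fix t assume t: "t \<in> D"
    define u where "u i = (if even i then t (i div 2) else of_bool (g t \<in> U (i div 2)))" for i
    have "evens u = t" by (auto simp: evens_def u_def)
    moreover have "u \<in> \<Gamma> D" using t \<open>evens u = t\<close> by (auto simp: \<Gamma>_def u_def)
    ultimately show "t \<in> evens ` \<Gamma> D" by blast
  qed (auto simp: \<Gamma>_def)
  obtain F1 r1 where 1: "closed F1" "continuous_on F1 r1" "\<Gamma> D1 = r1 ` (F1 :: (nat \<Rightarrow> nat) set)"
    using analytic_set_borel[OF \<Gamma>[OF D(1) meas(1)]] unfolding analytic_set_def by blast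
  obtain F2 r2 where 2: "closed F2" "continuous_on F2 r2" "\<Gamma> D2 = r2 ` (F2 :: (nat \<Rightarrow> nat) set)"
    using analytic_set_borel[OF \<Gamma>[OF D(2) meas(2)]] unfolding analytic_set_def by blast
  define h where "h r w = g (evens (r w))" for r and w :: "nat \<Rightarrow> nat"
  have img: "h r1 ` F1 = g ` D1" "h r2 ` F2 = g ` D2"
    using evens_\<Gamma>[of D1] evens_\<Gamma>[of D2] unfolding 1(3) 2(3) by (auto simp: h_def image_image)
  \<comment> \<open>By continuity the odd coordinate \<open>2 * m + 1\<close> of \<open>r\<close> is
    locally constant, and on the graph it is the truth value of membership in
    \<open>U m\<close>.\<close>
  have loc: "\<exists>k. \<forall>v\<in>F \<inter> cylinder k w. (h r v \<in> U m) = (h r w \<in> U m)"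
    if F: "continuous_on F r" "\<Gamma> D = r ` F" "w \<in> F" for F r D w m
  proof -
    obtain k where k: "\<And>v. v \<in> F \<inter> cylinder k w \<Longrightarrow> r v (2 * m + 1) = r w (2 * m + 1)"
      using continuous_on_nat_cylinder[OF continuous_on_product_then_coordinatewise[OF F(1)] F(3)]
      by blast
    have "r v (2 * m + 1) = of_bool (h r v \<in> U m)" if "v \<in> F" for v
    proof -
      have "r v \<in> \<Gamma> D" using that \<open>\<Gamma> D = r ` F\<close> by simp
      then show ?thesis by (simp add: \<Gamma>_def h_def)
    qed
    with k \<open>w \<in> F\<close> show ?thesis by (intro exI[of _ k]) (metis IntD1 of_bool_eq_iff)
  qed
  have "separable_by M (h r1 ` F1) (h r2 ` F2)"
  proof (rule separable_by_images[OF 1(1) 2(1)])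
    show "h r1 ` F1 \<subseteq> space M" using img g by simp
    fix w1 w2 assume w: "w1 \<in> F1" "w2 \<in> F2"
    then have "evens (r1 w1) \<in> D1" "evens (r2 w2) \<in> D2" using evens_\<Gamma> 1(3) 2(3) by blast+
    then obtain m where m: "(h r1 w1 \<in> U m) \<noteq> (h r2 w2 \<in> U m)" using sep unfolding h_def by blast
    obtain k1 where k1: "\<And>v. v \<in> F1 \<inter> cylinder k1 w1 \<Longrightarrow> (h r1 v \<in> U m) = (h r1 w1 \<in> U m)"
      using loc[OF 1(2,3) w(1)] by blast
    obtain k2 where k2: "\<And>v. v \<in> F2 \<inter> cylinder k2 w2 \<Longrightarrow> (h r2 v \<in> U m) = (h r2 w2 \<in> U m)"
      using loc[OF 2(2,3) w(2)] by blast
    let ?k = "max k1 k2"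
    have k: "\<And>v. v \<in> F1 \<inter> cylinder ?k w1 \<Longrightarrow> (h r1 v \<in> U m) = (h r1 w1 \<in> U m)"
      "\<And>v. v \<in> F2 \<inter> cylinder ?k w2 \<Longrightarrow> (h r2 v \<in> U m) = (h r2 w2 \<in> U m)"
      using cylinder_antimono[of k1 ?k w1] cylinder_antimono[of k2 ?k w2]
      by (auto intro!: k1 k2)
    have "separable_by M (h r1 ` (F1 \<inter> cylinder ?k w1)) (h r2 ` (F2 \<inter> cylinder ?k w2))"
    proof (cases "h r1 w1 \<in> U m")
      case True
      then show ?thesis
        unfolding separable_by_def using k m U[of m] by (intro bexI[of _ "U m"]) auto
    next
      case False
      have "h r1 ` (F1 \<inter> cylinder ?k w1) \<subseteq> space M" using img g by blast
      then show ?thesis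
        unfolding separable_by_def using k m U[of m] False by (intro bexI[of _ "space M - U m"]) auto
    qed
    then show "\<exists>k. separable_by M (h r1 ` (F1 \<inter> cylinder k w1)) (h r2 ` (F2 \<inter> cylinder k w2))" ..
  qed
  then show ?thesis using img by simp
qed

section \<open>Transfer from symbolic and standard Borel spaces to Baire space\<close>

lemma space_borel_of: "space (borel_of X) = topspace X"
  unfolding borel_of_def by (rule space_measure_of) (auto dest: openin_subset)

lemma sets_borel_of: "sets (borel_of X) = sigma_sets (topspace X) {U. openin X U}"
  unfolding borel_of_def by (rule sets_measure_of) (auto dest: openin_subset)

lemma standard_borel_separating_family:
  assumes "standard_borel Y"
  shows "\<exists>U :: nat \<Rightarrow> 'y set. (\<forall>m. U m \<in> sets Y) \<and>
    (\<forall>y\<in>space Y. \<forall>z\<in>space Y. y \<noteq> z \<longrightarrow> (\<exists>m. (y \<in> U m) \<noteq> (z \<in> U m)))"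
proof -
  obtain X where X: "completely_metrizable_space X" "second_countable X"
    "space Y = topspace X" "sets Y = sets (borel_of X)"
    using assms unfolding standard_borel_def by (elim exE conjE)
  obtain B where B: "countable B" "\<And>V. V \<in> B \<Longrightarrow> openin X V"
    "\<And>U x. openin X U \<Longrightarrow> x \<in> U \<Longrightarrow> \<exists>V\<in>B. x \<in> V \<and> V \<subseteq> U"
    using X(2) unfolding second_countable_def by (elim exE conjE) blast
  have haus: "Hausdorff_space X"
    using X(1) completely_metrizable_imp_metrizable_space metrizable_imp_Hausdorff_space by blast
  \<comment> \<open>The empty set is added so that the enumerated family is nonempty even if the
    base is empty.\<close>
  define U where "U = from_nat_into (insert {} B)"
  have UB: "range U = insert {} B"
    unfolding U_def using B(1) by (intro range_from_nat_into) auto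
  have "U m \<in> sets Y" for m
  proof -
    have "U m \<in> insert {} B" using UB by blast
    then have "openin X (U m)" using B(2) by auto
    then show ?thesis unfolding X(4) sets_borel_of by auto
  qed
  moreover have "\<exists>m. (y \<in> U m) \<noteq> (z \<in> U m)" if yz: "y \<in> space Y" "z \<in> space Y" "y \<noteq> z" for y z
  proof -
    obtain P Q where PQ: "openin X P" "openin X Q" "y \<in> P" "z \<in> Q" "disjnt P Q"
      using haus[unfolded Hausdorff_space_def, rule_format, of y z] yz by (auto simp: X(3))
    then obtain V where "V \<in> B" "y \<in> V" "V \<subseteq> P" using B(3) by blast
    moreover have "z \<notin> V" using PQ \<open>V \<subseteq> P\<close> by (auto simp: disjnt_def)
    moreover obtain m where "V = U m" using \<open>V \<in> B\<close> UB by blast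
    ultimately show ?thesis by blast
  qed
  ultimately show ?thesis by blast
qed

lemma space_symbolic_borel: "space (symbolic_borel X) = X"
  unfolding symbolic_borel_def space_borel_of
  by (rule Metric_space.topspace_mtopology[OF Metric_space_sdist])

lemma sets_symbolic_borel:
  "sets (symbolic_borel X) = sigma_sets X {U. openin (Metric_space.mtopology X sdist) U}"
  unfolding symbolic_borel_def sets_borel_of
  by (simp add: Metric_space.topspace_mtopology[OF Metric_space_sdist])

lemma sdist_less_if_agree:
  assumes "\<And>i. \<bar>i\<bar> \<le> int N \<Longrightarrow> x i = y i"
  shows "sdist x y < exp (- real N)"
proof (cases "x = y")
  case False
  then have ne: "{nat \<bar>n\<bar> |n. x n \<noteq> y n} \<noteq> {}" by (auto simp: fun_eq_iff)
  have "N < Inf {nat \<bar>n\<bar> |n. x n \<noteq> y n}"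
    using Inf_nat_def1[OF ne] assms by (force simp: not_le[symmetric])
  then show ?thesis using False by (simp add: sdist_def)
qed (simp add: sdist_def)

lemma sdist_agree:
  assumes "sdist x y \<le> exp (- real N)" "\<bar>i\<bar> < int N"
  shows "x i = y i"
proof (rule ccontr)
  assume ne: "x i \<noteq> y i"
  then have "Inf {nat \<bar>n\<bar> |n. x n \<noteq> y n} \<le> nat \<bar>i\<bar>" by (intro cInf_lower) auto
  moreover have "N \<le> Inf {nat \<bar>n\<bar> |n. x n \<noteq> y n}" using assms(1) ne by (auto simp: sdist_def split: if_splits)
  ultimately show False using assms(2) by linarith
qed

text \<open>Enumerating the alphabet and the integers places sequences in Baire space, the only
  space where Borel sets are shown to be analytic.\<close>

definition enc :: "'a set \<Rightarrow> (int \<Rightarrow> 'a) \<Rightarrow> nat \<Rightarrow> nat" where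
  "enc A x = (\<lambda>i. to_nat_on A (x (int_decode i)))"

lemma enc_eq_iff:
  assumes "countable A" "x \<in> UNIV \<rightarrow> A" "y \<in> UNIV \<rightarrow> A"
  shows "enc A x (int_encode n) = enc A y (int_encode n) \<longleftrightarrow> x n = y n"
  using assms inj_on_to_nat_on[OF assms(1)] by (auto simp: enc_def inj_on_def Pi_iff)

lemma enc_inj_on: "countable A \<Longrightarrow> inj_on (enc A) (UNIV \<rightarrow> A)"
  by (rule inj_onI) (metis enc_eq_iff ext)

text \<open>Relative to the image of \<open>X\<close>, balls of \<open>sdist\<close> contain
  cylinders around the encoded points, so open sets go to relatively open sets. Injectivity of
  \<open>enc\<close> then carries complements along.\<close>

lemma enc_borel:
  assumes A: "countable A" "X \<subseteq> UNIV \<rightarrow> A" and X: "enc A ` X \<in> sets borel"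
    and B: "B \<in> sets (symbolic_borel X)"
  shows "enc A ` B \<in> sets borel"
proof -
  have inj: "inj_on (enc A) X" using enc_inj_on[OF A(1)] A(2) by (rule inj_on_subset)
  have "B \<in> sigma_sets X {U. openin (Metric_space.mtopology X sdist) U}"
    using B unfolding sets_symbolic_borel .
  then have "B \<subseteq> X \<and> enc A ` B \<in> sets borel"
  proof induction
    case (Basic U)
    interpret Metric_space X sdist by (rule Metric_space_sdist)
    have UX: "U \<subseteq> X" using Basic by (metis mem_Collect_eq openin_mtopology)
    define G where "G = \<Union>{cylinder k (enc A x) | k x. x \<in> X \<and> enc A ` X \<inter> cylinder k (enc A x) \<subseteq> enc A ` U}"
    have "open G" unfolding G_def by (intro open_Union) (auto simp: open_cylinder)
    moreover have "enc A ` U = enc A ` X \<inter> G"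
    proof
      show "enc A ` X \<inter> G \<subseteq> enc A ` U" unfolding G_def by blast
      show "enc A ` U \<subseteq> enc A ` X \<inter> G"
      proof
        fix w assume "w \<in> enc A ` U"
        then obtain x where x: "x \<in> U" "w = enc A x" by blast
        then obtain e where e: "e > 0" "mball x e \<subseteq> U"
          using Basic by (auto simp: openin_mtopology)
        obtain N where N: "exp (- real N) < e"
        proof -
          obtain N where "- ln e < real N" using reals_Archimedean2 by blast
          then have "exp (- real N) < exp (ln e)" by (subst exp_less_cancel_iff) simp
          then show ?thesis using that e(1) by simp
        qed
        \<comment> \<open>\<open>k\<close> exceeds the codes of all positions in
          \<open>{- N..N}\<close>; agreement on a cylinder of this length thus puts a point into the
          ball.\<close>
        define k where "k = Suc (Max (int_encode ` {- int N..int N}))"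
        have k: "int_encode i < k" if "\<bar>i\<bar> \<le> int N" for i
          unfolding k_def less_Suc_eq_le using that by (intro Max_ge finite_imageI imageI) auto
        have "enc A ` X \<inter> cylinder k (enc A x) \<subseteq> enc A ` U"
        proof clarify
          fix y assume y: "y \<in> X" "enc A y \<in> cylinder k (enc A x)"
          have "y i = x i" if "\<bar>i\<bar> \<le> int N" for i
            using y k[OF that] enc_eq_iff[OF A(1), of y x i] A(2) x(1) UX
            by (auto simp: cylinder_def)
          then have "sdist x y < e" using sdist_less_if_agree[of N x y] N by fastforce
          then have "y \<in> mball x e" using x(1) y(1) UX by (auto simp: in_mball)
          then show "enc A y \<in> enc A ` U" using e(2) by blast
        qed
        then have "enc A x \<in> G" unfolding G_def using x(1) UX cylinder_self by blast
        then show "w \<in> enc A ` X \<inter> G" using x UX by blast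
      qed
    qed
    ultimately show ?case using X UX by (auto intro: sets.Int)
  next
    case (Compl B)
    have "enc A ` (X - B) = enc A ` X - enc A ` B"
      by (rule inj_on_image_set_diff[OF inj]) (use Compl in auto)
    with Compl X show ?case by auto
  next
    case (Union B)
    then show ?case by (auto simp: image_UN)
  qed auto
  then show ?thesis ..
qed

text \<open>As \<open>B\<close> is a union of fibres, the images of \<open>B\<close> and of
  \<open>X - B\<close> are disjoint. A measurable set that separates them cuts out exactly the image
  of \<open>B\<close> when intersected with the image of \<open>X\<close>.\<close>

lemma saturated_image_measurable:
  fixes Y :: "'y measure"
  assumes Y: "standard_borel Y"
    and A: "countable A" "X \<subseteq> UNIV \<rightarrow> A" "enc A ` X \<in> sets borel"
    and \<pi>: "\<pi> \<in> measurable (symbolic_borel X) Y" "\<pi> ` X \<in> sets Y"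
    and B: "B \<in> sets (symbolic_borel X)"
    and sat: "\<And>x x'. x \<in> B \<Longrightarrow> x' \<in> X \<Longrightarrow> \<pi> x' = \<pi> x \<Longrightarrow> x' \<in> B"
  shows "\<pi> ` B \<in> sets Y"
proof -
  have BX: "B \<subseteq> X" using sets.sets_into_space[OF B] by (simp add: space_symbolic_borel)
  have inj: "inj_on (enc A) X" using enc_inj_on[OF A(1)] A(2) by (rule inj_on_subset)
  have \<pi>Y: "\<pi> x \<in> space Y" if "x \<in> X" for x
    using measurable_space[OF \<pi>(1)] that by (simp add: space_symbolic_borel)
  define g where "g = \<pi> \<circ> inv_into X (enc A)"
  have g: "g (enc A x) = \<pi> x" if "x \<in> X" for x using inj that by (simp add: g_def)
  obtain U :: "nat \<Rightarrow> 'y set" where U: "\<And>m. U m \<in> sets Y"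
    "\<And>y z. y \<in> space Y \<Longrightarrow> z \<in> space Y \<Longrightarrow> y \<noteq> z \<Longrightarrow> \<exists>m. (y \<in> U m) \<noteq> (z \<in> U m)"
    using standard_borel_separating_family[OF Y] by blast
  have C: "X - B \<in> sets (symbolic_borel X)" using sets.compl_sets[OF B] by (simp add: space_symbolic_borel)
  have m: "{t \<in> enc A ` D. g t \<in> U m} \<in> sets borel" if "D \<in> sets (symbolic_borel X)" for D m
  proof -
    have DX: "D \<subseteq> X" using sets.sets_into_space[OF that] by (simp add: space_symbolic_borel)
    have eq: "{t \<in> enc A ` D. g t \<in> U m} = enc A ` (D \<inter> (\<pi> -` U m \<inter> X))"
      using g DX by (auto simp: subset_iff)
    have "\<pi> -` U m \<inter> X \<in> sets (symbolic_borel X)"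
      using measurable_sets[OF \<pi>(1) U(1)[of m]] by (simp add: space_symbolic_borel)
    then show ?thesis unfolding eq by (rule enc_borel[OF A sets.Int[OF that]])
  qed
  have im: "g ` (enc A ` D) = \<pi> ` D" if "D \<subseteq> X" for D
    using g that by (force simp: image_image)
  have "separable_by Y (g ` (enc A ` B)) (g ` (enc A ` (X - B)))"
  proof (rule separable_by_borel_images[OF U(1) enc_borel[OF A B] enc_borel[OF A C]])
    show "g ` enc A ` B \<subseteq> space Y" using im[OF BX] \<pi>Y BX by auto
    fix t1 t2 assume "t1 \<in> enc A ` B" "t2 \<in> enc A ` (X - B)"
    then obtain x1 x2 where x: "x1 \<in> B" "t1 = enc A x1" "x2 \<in> X - B" "t2 = enc A x2" by blast
    then have "g t1 = \<pi> x1" "g t2 = \<pi> x2" "\<pi> x1 \<noteq> \<pi> x2" using g BX sat by auto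
    then show "\<exists>m. (g t1 \<in> U m) \<noteq> (g t2 \<in> U m)" using U(2) \<pi>Y x BX by auto
  qed (use m B C in auto)
  then obtain C where C: "C \<in> sets Y" "\<pi> ` B \<subseteq> C" "C \<inter> \<pi> ` (X - B) = {}"
    unfolding separable_by_def using im[OF BX] im[of "X - B"] by auto
  then have "\<pi> ` B = C \<inter> \<pi> ` X" using BX by blast
  then show ?thesis using C(1) \<pi>(2) by auto
qed

section \<open>Recurrence of symbols; the regular part as a Borel set\<close>

lemma infinite_nonpos_iff:
  "infinite {n :: int. n \<le> 0 \<and> P n} \<longleftrightarrow> (\<forall>N. \<exists>n\<le>N. P n)"
proof
  assume inf: "infinite {n :: int. n \<le> 0 \<and> P n}"
  show "\<forall>N. \<exists>n\<le>N. P n"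
  proof (rule ccontr)
    assume "\<not> ?thesis"
    then obtain N where "\<And>n. n \<le> N \<Longrightarrow> \<not> P n" by blast
    then have "N \<le> n" if "P n" for n using that by (meson linear)
    then have "{n. n \<le> 0 \<and> P n} \<subseteq> {N..0}" by auto
    with inf show False using finite_subset by blast
  qed
next
  assume *: "\<forall>N. \<exists>n\<le>N. P n"
  show "infinite {n :: int. n \<le> 0 \<and> P n}"
  proof
    assume fin: "finite {n :: int. n \<le> 0 \<and> P n}"
    obtain n where n: "n \<le> min 0 (Min (insert 0 {n :: int. n \<le> 0 \<and> P n})) - 1" "P n" using * by blast
    then have "Min (insert 0 {n :: int. n \<le> 0 \<and> P n}) \<le> n"
      using fin by (intro Min_le) auto
    with n show False by linarith
  qed
qed

lemma infinite_nonneg_iff: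
  "infinite {n :: int. 0 \<le> n \<and> P n} \<longleftrightarrow> (\<forall>N. \<exists>n\<ge>N. P n)"
proof -
  have "{n :: int. 0 \<le> n \<and> P n} = uminus ` {n. n \<le> 0 \<and> P (- n)}"
    by (auto simp: image_iff intro!: exI[of _ "- _"])
  then have "infinite {n :: int. 0 \<le> n \<and> P n} \<longleftrightarrow> infinite {n. n \<le> 0 \<and> P (- n)}"
    by (simp add: finite_image_iff)
  also have "\<dots> \<longleftrightarrow> (\<forall>N. \<exists>n\<ge>N. P n)"
    unfolding infinite_nonpos_iff
  proof (intro iffI allI)
    fix N assume "\<forall>N. \<exists>n\<le>N. P (- n)"
    then obtain n where "n \<le> - N" "P (- n)" by blast
    then show "\<exists>n\<ge>N. P n" by (intro exI[of _ "- n"]) auto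
  next
    fix N assume "\<forall>N. \<exists>n\<ge>N. P n"
    then obtain n where "n \<ge> - N" "P n" by blast
    then show "\<exists>n\<le>N. P (- n)" by (intro exI[of _ "- n"]) auto
  qed
  finally show ?thesis .
qed

lemma regular_part_iff:
  "x \<in> regular_part A E \<longleftrightarrow> x \<in> markov_shift A E \<and>
     (\<exists>u. \<forall>N. \<exists>n\<le>N. x n = u) \<and> (\<exists>v. \<forall>N. \<exists>n\<ge>N. x n = v)"
  unfolding regular_part_def markov_shift_def mem_Collect_eq infinite_nonpos_iff infinite_nonneg_iff
  by blast

text \<open>Lusin's theorem needs a Borel domain. The recurring symbols are natural numbers after
  encoding, so regularity uses countable quantifiers only.\<close>

lemma enc_regular_part_borel:
  assumes "alphabet_graph A E"
  shows "enc A ` regular_part A E \<in> sets borel"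
proof -
  have A: "countable A" and E: "E \<subseteq> A \<times> A" using assms by (auto simp: alphabet_graph_def)
  define c where "c = to_nat_on A"
  define d where "d = from_nat_into A"
  have cd: "d (c a) = a" if "a \<in> A" for a using A that by (simp add: c_def d_def)
  have [measurable]: "(\<lambda>w :: nat \<Rightarrow> nat. w i) \<in> measurable borel (count_space UNIV)" for i
  proof (rule measurableI)
    fix S :: "nat set"
    have "open ((\<lambda>w :: nat \<Rightarrow> nat. w i) -` S)"
      by (intro open_vimage continuous_on_product_coordinates
          Topological_Spaces.discrete_topology_class.open_discrete)
    then show "(\<lambda>w :: nat \<Rightarrow> nat. w i) -` S \<inter> space borel \<in> sets borel" by simp
  qed simp
  define Q where "Q w \<longleftrightarrow> (\<forall>i. \<exists>a\<in>c ` A. w i = a) \<and>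
      (\<forall>n :: int. \<exists>a b. (a \<in> A \<and> b \<in> A \<and> (a, b) \<in> E) \<and> w (int_encode n) = c a \<and> w (int_encode (n + 1)) = c b) \<and>
      (\<exists>u. \<forall>N :: int. \<exists>n. n \<le> N \<and> w (int_encode n) = u) \<and>
      (\<exists>u. \<forall>N :: int. \<exists>n. N \<le> n \<and> w (int_encode n) = u)" for w :: "nat \<Rightarrow> nat"
  have "enc A ` regular_part A E = {w. Q w}"
  proof (intro equalityI subsetI)
    fix w assume "w \<in> enc A ` regular_part A E"
    then obtain x where x: "x \<in> regular_part A E" "w = enc A x" by blast
    then have xA: "\<And>n. x n \<in> A" and xE: "\<And>n. (x n, x (n + 1)) \<in> E"
      by (auto simp: regular_part_def markov_shift_def)
    have w: "w (int_encode n) = c (x n)" for n using x by (simp add: enc_def c_def)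
    have wi: "w i = c (x (int_decode i))" for i using x by (simp add: enc_def c_def)
    show "w \<in> {w. Q w}" unfolding mem_Collect_eq Q_def w
    proof (intro conjI allI)
      show "\<exists>a\<in>c ` A. w i = a" for i using wi xA by blast
      show "\<exists>a b. (a \<in> A \<and> b \<in> A \<and> (a, b) \<in> E) \<and> c (x n) = c a \<and> c (x (n + 1)) = c b" for n
        using xA xE by blast
      show "\<exists>u. \<forall>N. \<exists>n\<le>N. c (x n) = u" "\<exists>u. \<forall>N. \<exists>n\<ge>N. c (x n) = u"
        using x(1) unfolding regular_part_iff by metis+
    qed
  next
    fix w assume "w \<in> {w. Q w}"
    then have Q: "Q w" by simp
    define x where "x n = d (w (int_encode n))" for n
    have wc: "\<exists>a\<in>A. w i = c a" for i using Q unfolding Q_def by blast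
    have xA: "x n \<in> A" for n using wc[of "int_encode n"] cd by (auto simp: x_def)
    have cx: "c (x n) = w (int_encode n)" for n using wc[of "int_encode n"] cd by (auto simp: x_def)
    have xE: "(x n, x (n + 1)) \<in> E" for n
    proof -
      obtain a b where "a \<in> A" "b \<in> A" "(a, b) \<in> E" "w (int_encode n) = c a" "w (int_encode (n + 1)) = c b"
        using Q unfolding Q_def by blast
      then show ?thesis using cd by (simp add: x_def)
    qed
    have "\<exists>u. \<forall>N. \<exists>n\<le>N. w (int_encode n) = u" "\<exists>u. \<forall>N. \<exists>n\<ge>N. w (int_encode n) = u"
      using Q unfolding Q_def by blast+
    then have "\<exists>u. \<forall>N. \<exists>n\<le>N. x n = u" "\<exists>u. \<forall>N. \<exists>n\<ge>N. x n = u"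
      unfolding x_def by metis+
    then have "x \<in> regular_part A E"
      using xA xE unfolding regular_part_iff by (simp add: markov_shift_def)
    moreover have "w = enc A x"
    proof
      fix i show "w i = enc A x i" using cx[of "int_decode i"] by (simp add: enc_def c_def)
    qed
    ultimately show "w \<in> enc A ` regular_part A E" by blast
  qed
  moreover have "{w. Q w} \<in> sets borel"
  proof -
    \<comment> \<open>All quantifiers are rewritten as ranging over countable sets, the form that
      the measurability rules accept.\<close>
    have eq: "Q = (\<lambda>w. (\<forall>i. \<exists>a\<in>c ` A. w i = a) \<and>
      (\<forall>n :: int. \<exists>p\<in>E. w (int_encode n) = c (fst p) \<and> w (int_encode (n + 1)) = c (snd p)) \<and>
      (\<exists>u. \<forall>N :: int. \<exists>n\<in>{..N}. w (int_encode n) = u) \<and>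
      (\<exists>u. \<forall>N :: int. \<exists>n\<in>{N..}. w (int_encode n) = u))"
      using E unfolding Q_def by (intro ext) (auto simp: Bex_def; blast)
    have "countable E" using E A by (meson countable_SIGMA countable_subset)
    then have "Measurable.pred borel Q"
      unfolding eq by (intro pred_intros_logic pred_intros_countable pred_intros_countable_bounded) 
        (auto simp: countable_image A)
    then show ?thesis by (simp add: pred_def)
  qed
  ultimately show ?thesis by simp
qed

subsection \<open>Fibres of a Bowen factor\<close>

definition sh :: "int \<Rightarrow> (int \<Rightarrow> 'a) \<Rightarrow> int \<Rightarrow> 'a" where
  "sh n x = (\<lambda>i. x (i + n))"

lemma sh_apply: "sh n x i = x (i + n)"
  by (simp add: sh_def)

lemma sh_0 [simp]: "sh 0 x = x"
  by (simp add: sh_def)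

lemma sh_sh [simp]: "sh m (sh n x) = sh (m + n) x"
  by (simp add: sh_def algebra_simps)

lemma left_shift_eq_sh: "left_shift = sh 1"
  by (simp add: left_shift_def sh_def fun_eq_iff)

lemma sh_restrict: "sh n (restrict x {a..b}) = restrict (sh n x) {a - n..b - n}"
  by (auto simp: sh_def fun_eq_iff restrict_def)

lemma restrict_eq_iff: "restrict x I = restrict y I \<longleftrightarrow> (\<forall>i\<in>I. x i = y i)"
  by (auto simp: restrict_def fun_eq_iff)

text \<open>A diagonal argument for words of growing length: \<open>u N\<close> is controlled only
  on \<open>{- N..N}\<close>, so no single compact product contains all of them.\<close>

lemma koenig_sequences:
  fixes u :: "nat \<Rightarrow> int \<Rightarrow> 'a"
  assumes fin: "\<And>n. finite (B n)"
    and u: "\<And>N n. \<bar>n\<bar> \<le> int N \<Longrightarrow> u N n \<in> B n"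
  shows "\<exists>z. \<forall>N. \<exists>M\<ge>N. \<forall>i. \<bar>i\<bar> \<le> int N \<longrightarrow> z i = u M i"
proof -
  define P where "P N S \<longleftrightarrow> infinite S \<and> (\<forall>M\<in>S. \<forall>M'\<in>S. \<forall>i. \<bar>i\<bar> \<le> int N \<longrightarrow> u M i = u M' i)" for N :: nat and S
  have refine: "\<exists>S'\<subseteq>S. P N S'" if S: "infinite S" for S N
  proof -
    let ?f = "\<lambda>M. restrict (u M) {- int N..int N}"
    \<comment> \<open>Only words with index at least \<open>N\<close> are controlled on all of
      \<open>{- N..N}\<close>; the finitely many others are dropped before the pigeonhole principle
      is applied.\<close>
    have inf: "infinite (S - {..<N})" using S by simp
    have "?f ` (S - {..<N}) \<subseteq> Pi\<^sub>E {- int N..int N} B"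
      using u by (auto simp: PiE_iff)
    then have "finite (?f ` (S - {..<N}))"
      by (rule finite_subset) (intro finite_PiE fin finite_atLeastAtMost_int)
    from pigeonhole_infinite[OF inf this] obtain M0
      where M0: "infinite {M \<in> S - {..<N}. ?f M = ?f M0}" by blast
    define T where "T = {M \<in> S - {..<N}. ?f M = ?f M0}"
    have agree: "u M i = u M' i" if "M \<in> T" "M' \<in> T" "\<bar>i\<bar> \<le> int N" for M M' i
    proof -
      have "?f M i = ?f M' i" using that(1,2) by (simp add: T_def)
      then show ?thesis using that(3) by (simp add: abs_le_iff)
    qed
    have "infinite T" using M0 unfolding T_def .
    then have "P N T" unfolding P_def by (intro conjI ballI allI impI agree)
    moreover have "T \<subseteq> S" unfolding T_def by (rule subset_trans[OF Collect_restrict Diff_subset])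
    ultimately show ?thesis by (intro exI conjI)
  qed
  have "\<exists>S. P 0 S" using refine[of UNIV 0, OF infinite_UNIV_nat] by (elim exE conjE) (rule exI)
  moreover have "\<exists>S'. P (Suc N) S' \<and> S' \<subseteq> S" if "P N S" for S N
  proof -
    have "infinite S" using that unfolding P_def by (rule conjunct1)
    from refine[OF this, of "Suc N"] show ?thesis by (elim exE conjE) (intro exI conjI)
  qed
  ultimately have "\<exists>S. \<forall>N. P N (S N) \<and> S (Suc N) \<subseteq> S N"
    by (rule dependent_nat_choice[of P "\<lambda>_ S S'. S' \<subseteq> S"])
  then obtain S where S: "\<And>N. P N (S N)" "\<And>N. S (Suc N) \<subseteq> S N"
    by blast
  have mono: "S N' \<subseteq> S N" if "N \<le> N'" for N N'
    using lift_Suc_antimono_le[of S] S(2) that by blast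
  define m where "m N = (SOME M. M \<in> S N \<and> M \<ge> N)" for N
  have m: "m N \<in> S N \<and> m N \<ge> N" for N
  proof -
    have "\<exists>M. M \<in> S N \<and> M \<ge> N"
      using S(1)[of N] unfolding P_def infinite_nat_iff_unbounded_le by blast
    then show ?thesis unfolding m_def by (rule someI_ex)
  qed
  \<comment> \<open>Coordinate \<open>i\<close> is read at its own level. The index sets are nested
    and constant at that level, so every later level shows the same value.\<close>
  define z where "z i = u (m (nat \<bar>i\<bar>)) i" for i
  show ?thesis
  proof (intro exI allI)
    fix N
    have "z i = u (m N) i" if "\<bar>i\<bar> \<le> int N" for i
    proof -
      have "m (nat \<bar>i\<bar>) \<in> S (nat \<bar>i\<bar>)" "m N \<in> S (nat \<bar>i\<bar>)"
        using m[of "nat \<bar>i\<bar>"] m[of N] mono[of "nat \<bar>i\<bar>" N] that by (simp_all add: subset_iff nat_le_iff)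
      moreover have "\<bar>i\<bar> \<le> int (nat \<bar>i\<bar>)" by simp
      ultimately show ?thesis using S(1)[of "nat \<bar>i\<bar>"] unfolding P_def z_def by (elim conjE) (drule bspec, assumption, drule bspec, assumption, simp)
    qed
    then show "N \<le> m N \<and> (\<forall>i. \<bar>i\<bar> \<le> int N \<longrightarrow> z i = u (m N) i)" using m by blast
  qed
qed

lemma frequently_finite_past:
  assumes "finite M" "\<forall>N. \<exists>n\<le>N. z n \<in> M"
  shows "\<exists>u\<in>M. \<forall>N :: int. \<exists>n\<le>N. z n = u"
proof (rule ccontr)
  assume "\<not> ?thesis"
  then have "\<forall>u. \<exists>N. u \<in> M \<longrightarrow> (\<forall>n\<le>N. z n \<noteq> u)" by blast
  from choice[OF this] obtain f where f: "\<And>u n. u \<in> M \<Longrightarrow> n \<le> f u \<Longrightarrow> z n \<noteq> u" by blast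
  obtain n where n: "n \<le> Min (f ` M)" "z n \<in> M" using assms(2) by blast
  have "Min (f ` M) \<le> f (z n)" using assms(1) n(2) by (intro Min_le) auto
  with n have "n \<le> f (z n)" by simp
  with f n show False by blast
qed

lemma frequently_finite_future:
  assumes "finite M" "\<forall>N. \<exists>n\<ge>N. z n \<in> M"
  shows "\<exists>u\<in>M. \<forall>N :: int. \<exists>n\<ge>N. z n = u"
proof -
  have "\<forall>N. \<exists>n\<le>N. z (- n) \<in> M"
  proof
    fix N
    obtain n where "n \<ge> - N" "z n \<in> M" using assms(2) by blast
    then show "\<exists>n\<le>N. z (- n) \<in> M" by (intro exI[of _ "- n"]) auto
  qed
  from frequently_finite_past[OF assms(1) this] obtain u
    where u: "u \<in> M" "\<forall>N. \<exists>n\<le>N. z (- n) = u" by blast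
  have "\<exists>n\<ge>N. z n = u" for N
  proof -
    obtain n where "n \<le> - N" "z (- n) = u" using u(2) by blast
    then show ?thesis by (intro exI[of _ "- n"]) auto
  qed
  with u(1) show ?thesis by blast
qed

text \<open>Two one-sided dependent choices, both starting with \<open>v0\<close> at time 0, are
  joined there.\<close>

lemma int_dependent_choice:
  fixes P :: "int \<Rightarrow> 'b \<Rightarrow> bool"
  assumes P0: "P 0 v0"
    and fwd: "\<And>n v. P n v \<Longrightarrow> \<exists>v'. P (n + 1) v' \<and> Q n v v'"
    and bwd: "\<And>n v'. P (n + 1) v' \<Longrightarrow> \<exists>v. P n v \<and> Q n v v'"
  shows "\<exists>f. f 0 = v0 \<and> (\<forall>n. P n (f n)) \<and> (\<forall>n. Q n (f n) (f (n + 1)))"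
proof -
  have fwd': "\<exists>v'. P (int (Suc k)) v' \<and> Q (int k) v v'" if "P (int k) v" for k v
    using fwd[OF that] by (simp add: add.commute)
  have bwd': "\<exists>v. P (- int (Suc k)) v \<and> Q (- int (Suc k)) v v'" if "P (- int k) v'" for k v'
    using bwd[of "- int (Suc k)" v'] that by simp
  have "\<exists>f. \<forall>k. (P (int k) (f k) \<and> (k = 0 \<longrightarrow> f k = v0)) \<and> Q (int k) (f k) (f (Suc k))"
    by (rule dependent_nat_choice[of "\<lambda>k v. P (int k) v \<and> (k = 0 \<longrightarrow> v = v0)"
          "\<lambda>k. Q (int k)"]) (use P0 fwd' in force)+
  then obtain f where f: "\<And>k. P (int k) (f k)" "f 0 = v0" "\<And>k. Q (int k) (f k) (f (Suc k))" by blast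
  have "\<exists>g. \<forall>k. (P (- int k) (g k) \<and> (k = 0 \<longrightarrow> g k = v0)) \<and> Q (- int (Suc k)) (g (Suc k)) (g k)"
    by (rule dependent_nat_choice[of "\<lambda>k v. P (- int k) v \<and> (k = 0 \<longrightarrow> v = v0)"
          "\<lambda>k v v'. Q (- int (Suc k)) v' v"]) (use P0 bwd' in force)+
  then obtain g where g: "\<And>k. P (- int k) (g k)" "g 0 = v0" "\<And>k. Q (- int (Suc k)) (g (Suc k)) (g k)" by blast
  define h where "h n = (if n \<ge> 0 then f (nat n) else g (nat (- n)))" for n
  have "P n (h n)" for n
    using f(1)[of "nat n"] g(1)[of "nat (- n)"] by (auto simp: h_def)
  moreover have "Q n (h n) (h (n + 1))" for n
  proof (cases "n \<ge> 0")
    case True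
    then show ?thesis using f(3)[of "nat n"] by (simp add: h_def nat_add_distrib)
  next
    case False
    define k where "k = nat (- n - 1)"
    have k: "n = - int (Suc k)" "nat (- n) = Suc k" using False by (auto simp: k_def)
    have "h (n + 1) = g k" using k f(2) g(2) by (auto simp: h_def)
    then show ?thesis using g(3)[of k] k by (simp add: h_def)
  qed
  moreover have "h 0 = v0" by (simp add: h_def f(2))
  ultimately show ?thesis by blast
qed

lemma int_constant:
  fixes f :: "int \<Rightarrow> 'b"
  assumes "\<And>n. f (n + 1) = f n"
  shows "f n = f 0"
proof (induction n rule: int_induct[of _ 0])
  case (step2 i)
  then show ?case using assms[of "i - 1"] by simp
qed (use assms in auto)

definition path_on :: "('a \<times> 'a) set \<Rightarrow> int \<Rightarrow> int \<Rightarrow> (int \<Rightarrow> 'a) \<Rightarrow> bool" where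
  "path_on E a b v \<longleftrightarrow> (\<forall>i. a \<le> i \<and> i < b \<longrightarrow> (v i, v (i + 1)) \<in> E)"

definition rel_on :: "('a \<times> 'a) set \<Rightarrow> int \<Rightarrow> int \<Rightarrow> (int \<Rightarrow> 'a) \<Rightarrow> (int \<Rightarrow> 'a) \<Rightarrow> bool" where
  "rel_on R a b u v \<longleftrightarrow> (\<forall>i\<in>{a..b}. (u i, v i) \<in> R)"

text \<open>What is left of \<pi> once \<open>Y\<close> is forgotten. Equality of images is
  transitive, so being related at all times is an equivalence between regular sequences, although
  \<open>R\<close> itself need not be transitive.\<close>

locale bowen_graph =
  fixes A :: "'a set" and E R :: "('a \<times> 'a) set"
  assumes graph: "alphabet_graph A E"
    and R_sub: "R \<subseteq> A \<times> A" and R_refl: "\<And>a. a \<in> A \<Longrightarrow> (a, a) \<in> R" and R_sym: "sym R"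
    and R_fin: "locally_finite_on A R"
    and R_trans: "\<And>x y z. x \<in> regular_part A E \<Longrightarrow> y \<in> regular_part A E \<Longrightarrow> z \<in> regular_part A E \<Longrightarrow>
      \<forall>n. (x n, y n) \<in> R \<Longrightarrow> \<forall>n. (y n, z n) \<in> R \<Longrightarrow> \<forall>n. (x n, z n) \<in> R"
    and fibre_finite: "\<And>x. x \<in> regular_part A E \<Longrightarrow> finite {z \<in> regular_part A E. \<forall>n. (z n, x n) \<in> R}"
begin

abbreviation X :: "(int \<Rightarrow> 'a) set" where "X \<equiv> markov_shift A E"
abbreviation XR :: "(int \<Rightarrow> 'a) set" where "XR \<equiv> regular_part A E"

text \<open>Members are taken from the whole Markov shift because compactness only produces points
  there; \<open>fib_subset\<close> recovers regularity.\<close>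

definition fib :: "(int \<Rightarrow> 'a) \<Rightarrow> (int \<Rightarrow> 'a) set" where
  "fib x = {z \<in> X. \<forall>n. (z n, x n) \<in> R}"

lemma A_countable: "countable A" and E_sub: "E \<subseteq> A \<times> A"
  using graph by (auto simp: alphabet_graph_def)

lemma X_iff: "x \<in> X \<longleftrightarrow> (\<forall>n. (x n, x (n + 1)) \<in> E)"
  using E_sub by (auto simp: markov_shift_def)

lemma XD: "x \<in> X \<Longrightarrow> x n \<in> A" "x \<in> X \<Longrightarrow> (x n, x (n + 1)) \<in> E"
  by (auto simp: markov_shift_def)

lemma XR_X: "x \<in> XR \<Longrightarrow> x \<in> X"
  by (simp add: regular_part_def)

lemma R_symD: "(a, b) \<in> R \<Longrightarrow> (b, a) \<in> R"
  using R_sym by (auto simp: sym_def)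

lemma R_finite: "finite {b. (b, a) \<in> R}"
proof (cases "a \<in> A")
  case True
  have "{b. (b, a) \<in> R} = {b \<in> A. (b, a) \<in> R}" using R_sub by blast
  then show ?thesis using R_fin True by (simp add: locally_finite_on_def)
next
  case False
  then have "{b. (b, a) \<in> R} = {}" using R_sub by blast
  then show ?thesis by simp
qed

lemma X_sh: "sh n x \<in> X \<longleftrightarrow> x \<in> X"
proof
  assume "sh n x \<in> X"
  then have "(sh n x (i - n), sh n x (i - n + 1)) \<in> E" for i by (simp add: X_iff)
  then show "x \<in> X" unfolding X_iff by (simp add: sh_apply)
next
  assume "x \<in> X"
  then have "(x (i + n), x (i + n + 1)) \<in> E" for i by (simp add: X_iff)
  then show "sh n x \<in> X" unfolding X_iff by (simp add: sh_apply algebra_simps)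
qed

lemma XR_sh_imp: "x \<in> XR \<Longrightarrow> sh n x \<in> XR"
proof -
  assume "x \<in> XR"
  then obtain u v where x: "x \<in> X" "\<And>N. \<exists>m\<le>N. x m = u" "\<And>N. \<exists>m\<ge>N. x m = v"
    unfolding regular_part_iff by blast
  have "\<exists>m\<le>N. sh n x m = u" for N
  proof -
    obtain m where "m \<le> N + n" "x m = u" using x(2) by blast
    then show ?thesis by (intro exI[of _ "m - n"]) (simp add: sh_apply)
  qed
  moreover have "\<exists>m\<ge>N. sh n x m = v" for N
  proof -
    obtain m where "m \<ge> N + n" "x m = v" using x(3) by blast
    then show ?thesis by (intro exI[of _ "m - n"]) (simp add: sh_apply)
  qed
  ultimately show ?thesis using x(1) unfolding regular_part_iff X_sh by blast
qed

lemma XR_sh: "sh n x \<in> XR \<longleftrightarrow> x \<in> XR"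
  using XR_sh_imp[of x n] XR_sh_imp[of "sh n x" "- n"] by auto

text \<open>Whenever a recurring symbol of \<open>x\<close> appears, \<open>z\<close> shows one of
  its finitely many related symbols, and one of these recurs.\<close>

lemma fib_subset: "x \<in> XR \<Longrightarrow> fib x \<subseteq> XR"
proof
  fix z assume x: "x \<in> XR" and z: "z \<in> fib x"
  obtain u v where uv: "\<And>N. \<exists>n\<le>N. x n = u" "\<And>N. \<exists>n\<ge>N. x n = v"
    using x unfolding regular_part_iff by blast
  have zR: "(z n, x n) \<in> R" for n using z by (simp add: fib_def)
  have "\<forall>N. \<exists>n\<le>N. z n \<in> {b. (b, u) \<in> R}" "\<forall>N. \<exists>n\<ge>N. z n \<in> {b. (b, v) \<in> R}"
    using uv zR unfolding mem_Collect_eq by (metis (no_types))+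
  from frequently_finite_past[OF R_finite this(1)] frequently_finite_future[OF R_finite this(2)]
  show "z \<in> XR" using z unfolding regular_part_iff fib_def by blast
qed

lemma fib_eq: "fib x = {z \<in> XR. \<forall>n. (z n, x n) \<in> R}" if "x \<in> XR"
  using fib_subset[OF that] XR_X by (auto simp: fib_def)

lemma finite_fib: "x \<in> XR \<Longrightarrow> finite (fib x)"
  by (simp add: fib_eq fibre_finite)

lemma fib_self: "x \<in> XR \<Longrightarrow> x \<in> fib x"
  by (simp add: fib_def XR_X R_refl XD)

lemma fib_R: "x \<in> XR \<Longrightarrow> u \<in> fib x \<Longrightarrow> v \<in> fib x \<Longrightarrow> (u n, v n) \<in> R"
  by (rule R_trans[of u x v, rule_format]) (auto simp: fib_eq R_symD)

lemma fib_maximal: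
  assumes x: "x \<in> XR" and u: "u \<in> fib x" and z: "z \<in> X" "\<And>n. (z n, u n) \<in> R"
  shows "z \<in> fib x"
proof -
  have uXR: "u \<in> XR" using fib_subset[OF x] u by blast
  have zXR: "z \<in> XR" using fib_subset[OF uXR] z by (auto simp: fib_def)
  have "\<forall>n. (z n, x n) \<in> R" using u z(2) by (intro R_trans[OF zXR uXR x]) (auto simp: fib_def)
  then show ?thesis using z(1) by (simp add: fib_def)
qed

lemma fib_cong:
  assumes x: "x \<in> XR" and z: "z \<in> fib x"
  shows "fib z = fib x"
proof (intro equalityI subsetI)
  fix v assume "v \<in> fib z"
  then show "v \<in> fib x" by (intro fib_maximal[OF x z]) (simp_all add: fib_def)
next
  fix v assume v: "v \<in> fib x"
  then show "v \<in> fib z" using fib_R[OF x v z] by (simp add: fib_def)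
qed

lemma fib_sh: "fib (sh n x) = sh n ` fib x"
proof (intro equalityI subsetI)
  fix z assume z: "z \<in> fib (sh n x)"
  have "(sh (- n) z i, x i) \<in> R" for i
  proof -
    have "(z (i - n), sh n x (i - n)) \<in> R" using z by (simp add: fib_def)
    then show ?thesis by (simp add: sh_apply)
  qed
  then have "sh (- n) z \<in> fib x" using z by (simp add: fib_def X_sh)
  then have "sh n (sh (- n) z) \<in> sh n ` fib x" by (rule imageI)
  then show "z \<in> sh n ` fib x" by simp
next
  fix z assume "z \<in> sh n ` fib x"
  then show "z \<in> fib (sh n x)" by (auto simp: fib_def X_sh sh_apply)
qed

text \<open>Local finiteness leaves finitely many candidates at each coordinate, so longer and
  longer words related to \<open>x\<close> subconverge to a point of its fibre.\<close>

lemma fib_compactness: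
  assumes u: "\<And>N :: nat. path_on E (- int N) (int N) (u N) \<and> rel_on R (- int N) (int N) (u N) x"
  shows "\<exists>z\<in>fib x. \<forall>N. \<exists>M\<ge>N. \<forall>i. \<bar>i\<bar> \<le> int N \<longrightarrow> z i = u M i"
proof -
  have "\<exists>z. \<forall>N. \<exists>M\<ge>N. \<forall>i. \<bar>i\<bar> \<le> int N \<longrightarrow> z i = u M i"
  proof (rule koenig_sequences)
    show "finite {b. (b, x n) \<in> R}" for n by (rule R_finite)
    fix N n assume "\<bar>n\<bar> \<le> int N"
    then show "u N n \<in> {b. (b, x n) \<in> R}" using u[of N] by (simp add: rel_on_def abs_le_iff)
  qed
  then obtain z where z: "\<forall>N. \<exists>M\<ge>N. \<forall>i. \<bar>i\<bar> \<le> int N \<longrightarrow> z i = u M i" by (elim exE)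
  have "(z n, z (n + 1)) \<in> E \<and> (z n, x n) \<in> R" for n
  proof -
    \<comment> \<open>The extra 1 places both ends of the edge from \<open>n\<close> to
      \<open>n + 1\<close> inside the window of agreement.\<close>
    define N where "N = nat (\<bar>n\<bar> + 1)"
    obtain M where M: "M \<ge> N" "\<forall>i. \<bar>i\<bar> \<le> int N \<longrightarrow> z i = u M i" using z by blast
    have N: "\<bar>n\<bar> \<le> int N" "\<bar>n + 1\<bar> \<le> int N" "\<bar>n\<bar> < int M" using M(1) by (auto simp: N_def)
    then have z: "z n = u M n" "z (n + 1) = u M (n + 1)" using M(2) by blast+
    have n: "- int M \<le> n" "n < int M" using N(3) by auto
    then have "(u M n, u M (n + 1)) \<in> E" using u[of M] unfolding path_on_def by blast
    moreover have "(u M n, x n) \<in> R"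
      using u[of M] n unfolding rel_on_def by (meson atLeastAtMost_iff less_imp_le)
    ultimately show ?thesis unfolding z by blast
  qed
  then have "z \<in> fib x" by (simp add: fib_def X_iff)
  with z show ?thesis by blast
qed

lemma path_on_X: "x \<in> X \<Longrightarrow> path_on E a b x"
  by (simp add: path_on_def XD)

end

subsection \<open>Markers and the coding graph\<close>

text \<open>A marker is a set of words on \<open>{- window..window}\<close> that are already distinct on
  \<open>{- core..core}\<close>. A vertex records that its base marker last occurred \<open>elapsed\<close> steps ago and will occur
  next in \<open>ahead\<close> steps, together with the pieces of all the strands on the interval \<open>placement\<close>, relative to the
  present time, that is spanned by these two occurrences.\<close>

datatype 'a marker = Marker (core: int) (window: int) (words: "(int \<Rightarrow> 'a) set")

datatype 'a vertex = Vertex (base: "'a marker") (elapsed: int) (ahead: int) (pieces: "(int \<Rightarrow> 'a) set")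

text \<open>For a finite nonempty set of words, equal cardinalities make \<open>V\<close> finite and
  the restriction injective, so each word is carried by exactly one strand. \<open>at_vertex\<close>
  uses the same encoding for pieces.\<close>

definition occ :: "'a marker \<Rightarrow> int \<Rightarrow> (int \<Rightarrow> 'a) set \<Rightarrow> bool" where
  "occ w j V \<longleftrightarrow> card V = card (words w) \<and> (\<lambda>v. restrict (sh j v) {- window w..window w}) ` V = words w"

definition placement :: "'a vertex \<Rightarrow> int set" where
  "placement \<alpha> = {- elapsed \<alpha> - window (base \<alpha>)..ahead \<alpha> + window (base \<alpha>)}"

definition at_vertex :: "'a vertex \<Rightarrow> int \<Rightarrow> (int \<Rightarrow> 'a) set \<Rightarrow> bool" where
  "at_vertex \<alpha> n F \<longleftrightarrow> card F = card (pieces \<alpha>) \<and> (\<lambda>z. restrict (sh n z) (placement \<alpha>)) ` F = pieces \<alpha>"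

text \<open>A vertex is a loop with a position in it. Inside the loop the successor is forced. At
  its end any loop of the same marker may start, with no condition relating the two sets of pieces:
  for valid vertices both show all the words of the marker at the junction, which is all that gluing
  needs.\<close>

definition vedge :: "'a vertex \<Rightarrow> 'a vertex \<Rightarrow> bool" where
  "vedge \<alpha> \<beta> \<longleftrightarrow> base \<beta> = base \<alpha> \<and>
     (ahead \<alpha> > 1 \<longrightarrow> elapsed \<beta> = elapsed \<alpha> + 1 \<and> ahead \<beta> = ahead \<alpha> - 1 \<and> pieces \<beta> = sh 1 ` pieces \<alpha>) \<and>
     (ahead \<alpha> = 1 \<longrightarrow> elapsed \<beta> = 0)"

definition strands :: "(int \<Rightarrow> 'a vertex) \<Rightarrow> (int \<Rightarrow> 'a) set" where
  "strands x = {z. \<forall>n. restrict (sh n z) (placement (x n)) \<in> pieces (x n)}"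

definition follows :: "'a vertex \<Rightarrow> 'a vertex \<Rightarrow> (int \<Rightarrow> 'a) \<Rightarrow> (int \<Rightarrow> 'a) \<Rightarrow> bool" where
  "follows \<alpha> \<beta> u v \<longleftrightarrow> (\<forall>i. i \<in> placement \<beta> \<and> i + 1 \<in> placement \<alpha> \<longrightarrow> v i = u (i + 1))"

text \<open>Passage between fibres and finite pieces: an occurrence is visible in the pieces as soon
  as its window fits into the interval they cover.\<close>

lemma occ_bundle:
  fixes w :: "'a marker"
  assumes V: "(\<lambda>z. restrict (sh n z) I) ` F = V" "card F = card V"
    and j: "{j - window w..j + window w} \<subseteq> I"
  shows "occ w j V \<longleftrightarrow> occ w (n + j) F"
proof -
  have "restrict (sh j (restrict (sh n z) I)) {- window w..window w} = restrict (sh (n + j) z) {- window w..window w}"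
    for z :: "int \<Rightarrow> 'a"
  proof (rule restrict_ext)
    fix i assume "i \<in> {- window w..window w}"
    then have "i + j \<in> {j - window w..j + window w}" by auto
    then have "i + j \<in> I" using j by blast
    then show "sh j (restrict (sh n z) I) i = sh (n + j) z i" by (simp add: sh_apply algebra_simps)
  qed
  then have "(\<lambda>v. restrict (sh j v) {- window w..window w}) ` V =
      (\<lambda>z. restrict (sh (n + j) z) {- window w..window w}) ` F"
    unfolding V(1)[symmetric] image_image by simp
  then show ?thesis unfolding occ_def V(2) by simp
qed

lemma occ_sh: "occ w j (sh n ` F) \<longleftrightarrow> occ w (j + n) F"
proof -
  have "inj (sh n :: (int \<Rightarrow> 'a) \<Rightarrow> _)" by (rule inj_on_inverseI[of _ "sh (- n)"]) simp
  then have "card (sh n ` F) = card F" by (intro card_image) (rule inj_on_subset[OF _ subset_UNIV])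
  then show ?thesis unfolding occ_def image_image by simp
qed

lemma at_vertex_sh: "at_vertex \<alpha> j (sh n ` F) \<longleftrightarrow> at_vertex \<alpha> (j + n) F"
proof -
  have "inj (sh n :: (int \<Rightarrow> 'a) \<Rightarrow> _)" by (rule inj_on_inverseI[of _ "sh (- n)"]) simp
  then have "card (sh n ` F) = card F" by (intro card_image) (rule inj_on_subset[OF _ subset_UNIV])
  then show ?thesis unfolding at_vertex_def image_image by simp
qed

context bowen_graph
begin

text \<open>Stated without reference to a fibre, so a marker is finite data over a countable
  alphabet. Separation on the core identifies strands; the final clause lets a merely related word
  be spliced into a strand.\<close>

definition tame :: "'a marker \<Rightarrow> bool" where
  "tame w \<longleftrightarrow> 0 \<le> core w \<and> core w \<le> window w \<and> finite (words w) \<and> words w \<noteq> {} \<and>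
     words w \<subseteq> {- window w..window w} \<rightarrow>\<^sub>E A \<and>
     (\<forall>u\<in>words w. \<forall>v\<in>words w. (\<forall>i\<in>{- core w..core w}. u i = v i) \<longrightarrow> u = v) \<and>
     (\<forall>v. path_on E (- window w) (window w) v \<and> (\<forall>u\<in>words w. rel_on R (- window w) (window w) v u) \<longrightarrow>
        (\<exists>u\<in>words w. \<forall>i\<in>{- core w..core w}. v i = u i))"

definition code :: "'a marker \<Rightarrow> nat" where
  "code = to_nat_on (Collect tame)"

text \<open>Markers are well-ordered with the window size first, so that an occurrence of a prior marker
  fits into the interval known to a vertex.\<close>

definition prior :: "'a marker \<Rightarrow> 'a marker \<Rightarrow> bool" where
  "prior w' w \<longleftrightarrow> window w' < window w \<or> window w' = window w \<and> code w' < code w"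

text \<open>The last clause ensures that a sequence related to all the strands is itself one of them.\<close>

definition valid :: "'a vertex \<Rightarrow> bool" where
  "valid \<alpha> \<longleftrightarrow> tame (base \<alpha>) \<and> 0 \<le> elapsed \<alpha> \<and> 1 \<le> ahead \<alpha> \<and> pieces \<alpha> \<subseteq> placement \<alpha> \<rightarrow>\<^sub>E A \<and>
     (\<forall>v\<in>pieces \<alpha>. path_on E (- elapsed \<alpha> - window (base \<alpha>)) (ahead \<alpha> + window (base \<alpha>)) v) \<and>
     (\<forall>u\<in>pieces \<alpha>. \<forall>v\<in>pieces \<alpha>. rel_on R (- elapsed \<alpha> - window (base \<alpha>)) (ahead \<alpha> + window (base \<alpha>)) u v) \<and>
     occ (base \<alpha>) (- elapsed \<alpha>) (pieces \<alpha>) \<and> occ (base \<alpha>) (ahead \<alpha>) (pieces \<alpha>) \<and>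
     (\<forall>j. - elapsed \<alpha> < j \<and> j < ahead \<alpha> \<longrightarrow> \<not> occ (base \<alpha>) j (pieces \<alpha>)) \<and>
     (\<forall>w. tame w \<and> prior w (base \<alpha>) \<longrightarrow> \<not> occ w 0 (pieces \<alpha>)) \<and>
     (\<forall>v. path_on E (- elapsed \<alpha> - window (base \<alpha>)) (ahead \<alpha> + window (base \<alpha>)) v \<and>
        (\<forall>u\<in>pieces \<alpha>. rel_on R (- elapsed \<alpha> - window (base \<alpha>)) (ahead \<alpha> + window (base \<alpha>)) v u) \<longrightarrow>
        (\<exists>u\<in>pieces \<alpha>. \<forall>i\<in>{- elapsed \<alpha> - core (base \<alpha>)..ahead \<alpha> + core (base \<alpha>)}. v i = u i))"

definition vpath :: "(int \<Rightarrow> 'a vertex) \<Rightarrow> bool" where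
  "vpath x \<longleftrightarrow> (\<forall>n. valid (x n)) \<and> (\<forall>n. vedge (x n) (x (n + 1)))"

lemma tame_bounds: "tame w \<Longrightarrow> 0 \<le> core w \<and> core w \<le> window w"
  by (simp add: tame_def)

lemma tame_words: "tame w \<Longrightarrow> finite (words w) \<and> words w \<noteq> {}"
  by (simp add: tame_def)

lemma tame_sep: "tame w \<Longrightarrow> u \<in> words w \<Longrightarrow> v \<in> words w \<Longrightarrow> (\<And>i. i \<in> {- core w..core w} \<Longrightarrow> u i = v i) \<Longrightarrow> u = v"
  by (simp add: tame_def)

lemma tame_guard:
  assumes "tame w" "path_on E (- window w) (window w) v" "\<And>u. u \<in> words w \<Longrightarrow> rel_on R (- window w) (window w) v u"
  shows "\<exists>u\<in>words w. \<forall>i\<in>{- core w..core w}. v i = u i"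
proof -
  have "\<forall>v. path_on E (- window w) (window w) v \<and> (\<forall>u\<in>words w. rel_on R (- window w) (window w) v u) \<longrightarrow>
        (\<exists>u\<in>words w. \<forall>i\<in>{- core w..core w}. v i = u i)"
    using assms(1) unfolding tame_def by (elim conjE)
  from spec[OF this, of v] show ?thesis by (rule mp) (intro conjI ballI assms(2,3))
qed

lemma valid_tame: "valid \<alpha> \<Longrightarrow> tame (base \<alpha>)"
  and valid_elapsed: "valid \<alpha> \<Longrightarrow> 0 \<le> elapsed \<alpha>"
  and valid_ahead: "valid \<alpha> \<Longrightarrow> 1 \<le> ahead \<alpha>"
  and valid_pieces: "valid \<alpha> \<Longrightarrow> pieces \<alpha> \<subseteq> placement \<alpha> \<rightarrow>\<^sub>E A"
  and valid_occ_elapsed: "valid \<alpha> \<Longrightarrow> occ (base \<alpha>) (- elapsed \<alpha>) (pieces \<alpha>)"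
  and valid_occ_ahead: "valid \<alpha> \<Longrightarrow> occ (base \<alpha>) (ahead \<alpha>) (pieces \<alpha>)"
  by (simp_all add: valid_def)

lemma valid_path: "valid \<alpha> \<Longrightarrow> v \<in> pieces \<alpha> \<Longrightarrow> path_on E (- elapsed \<alpha> - window (base \<alpha>)) (ahead \<alpha> + window (base \<alpha>)) v"
  and valid_rel: "valid \<alpha> \<Longrightarrow> u \<in> pieces \<alpha> \<Longrightarrow> v \<in> pieces \<alpha> \<Longrightarrow> i \<in> placement \<alpha> \<Longrightarrow> (u i, v i) \<in> R"
  and valid_not_occ: "valid \<alpha> \<Longrightarrow> - elapsed \<alpha> < j \<Longrightarrow> j < ahead \<alpha> \<Longrightarrow> \<not> occ (base \<alpha>) j (pieces \<alpha>)"
  and valid_not_prior: "valid \<alpha> \<Longrightarrow> tame w \<Longrightarrow> prior w (base \<alpha>) \<Longrightarrow> \<not> occ w 0 (pieces \<alpha>)"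
  by (simp_all add: valid_def placement_def rel_on_def)

lemma valid_exact:
  assumes "valid \<alpha>" "path_on E (- elapsed \<alpha> - window (base \<alpha>)) (ahead \<alpha> + window (base \<alpha>)) v"
    "\<And>u i. u \<in> pieces \<alpha> \<Longrightarrow> i \<in> placement \<alpha> \<Longrightarrow> (v i, u i) \<in> R"
  shows "\<exists>u\<in>pieces \<alpha>. \<forall>i\<in>{- elapsed \<alpha> - core (base \<alpha>)..ahead \<alpha> + core (base \<alpha>)}. v i = u i"
proof -
  have r: "\<forall>u\<in>pieces \<alpha>. rel_on R (- elapsed \<alpha> - window (base \<alpha>)) (ahead \<alpha> + window (base \<alpha>)) v u"
    using assms(3) by (simp add: rel_on_def placement_def)
  have "\<forall>v. path_on E (- elapsed \<alpha> - window (base \<alpha>)) (ahead \<alpha> + window (base \<alpha>)) v \<and>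
        (\<forall>u\<in>pieces \<alpha>. rel_on R (- elapsed \<alpha> - window (base \<alpha>)) (ahead \<alpha> + window (base \<alpha>)) v u) \<longrightarrow>
        (\<exists>u\<in>pieces \<alpha>. \<forall>i\<in>{- elapsed \<alpha> - core (base \<alpha>)..ahead \<alpha> + core (base \<alpha>)}. v i = u i)"
    using assms(1) unfolding valid_def by (elim conjE)
  from spec[OF this, of v] show ?thesis by (rule mp) (intro conjI assms(2) r)
qed

lemma valid_bounds:
  "valid \<alpha> \<Longrightarrow> 0 \<le> core (base \<alpha>) \<and> core (base \<alpha>) \<le> window (base \<alpha>) \<and> 0 \<le> elapsed \<alpha> \<and> 1 \<le> ahead \<alpha>"
  using tame_bounds[of "base \<alpha>"] valid_tame[of \<alpha>] valid_elapsed[of \<alpha>] valid_ahead[of \<alpha>] by blast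

lemma valid_window: "valid \<alpha> \<Longrightarrow> i \<in> {- window (base \<alpha>)..window (base \<alpha>)} \<Longrightarrow> i \<in> placement \<alpha>"
  using valid_elapsed[of \<alpha>] valid_ahead[of \<alpha>] by (auto simp: placement_def)

lemma valid_0_placement: "valid \<alpha> \<Longrightarrow> 0 \<in> placement \<alpha>"
  using valid_window[of \<alpha> 0] valid_bounds[of \<alpha>] by auto

lemma occ_finite: "tame w \<Longrightarrow> occ w j V \<Longrightarrow> finite V \<and> V \<noteq> {}"
  using tame_words[of w] by (metis card_gt_0_iff occ_def)

lemma valid_pieces_finite: "valid \<alpha> \<Longrightarrow> finite (pieces \<alpha>) \<and> pieces \<alpha> \<noteq> {}"
  using occ_finite valid_tame valid_occ_elapsed by blast

text \<open>Agreement on the core makes the two words equal, and the cardinality clause of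
  \<open>occ\<close> makes the passage from strands to words injective.\<close>

lemma occ_sep:
  assumes w: "tame w" and o: "occ w j V" and uv: "u \<in> V" "v \<in> V"
    and eq: "\<And>i. i \<in> {j - core w..j + core w} \<Longrightarrow> u i = v i"
  shows "u = v"
proof -
  let ?f = "\<lambda>v. restrict (sh j v) {- window w..window w}"
  have f: "?f ` V = words w" "card V = card (words w)" using o by (auto simp: occ_def)
  have inj: "inj_on ?f V"
    using f occ_finite[OF w o] by (intro eq_card_imp_inj_on) auto
  have "?f u = ?f v"
  proof (rule tame_sep[OF w])
    show "?f u \<in> words w" "?f v \<in> words w" using f uv by blast+
    fix i assume i: "i \<in> {- core w..core w}"
    then have "u (i + j) = v (i + j)" by (intro eq) auto
    then show "?f u i = ?f v i" using i tame_bounds[OF w] by (simp add: sh_apply)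
  qed
  then show ?thesis using inj uv by (simp add: inj_on_def)
qed

section \<open>Following and gluing pieces along a path\<close>

lemma vedge_base: "vedge \<alpha> \<beta> \<Longrightarrow> base \<beta> = base \<alpha>"
  by (simp add: vedge_def)

lemma vedge_long: "vedge \<alpha> \<beta> \<Longrightarrow> ahead \<alpha> > 1 \<Longrightarrow>
    elapsed \<beta> = elapsed \<alpha> + 1 \<and> ahead \<beta> = ahead \<alpha> - 1 \<and> pieces \<beta> = sh 1 ` pieces \<alpha>"
  by (simp add: vedge_def)

lemma vedge_short: "vedge \<alpha> \<beta> \<Longrightarrow> ahead \<alpha> = 1 \<Longrightarrow> elapsed \<beta> = 0"
  by (simp add: vedge_def)

lemma vedge_cases:
  assumes "valid \<alpha>" "vedge \<alpha> \<beta>"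
  obtains "ahead \<alpha> > 1" "elapsed \<beta> = elapsed \<alpha> + 1" "ahead \<beta> = ahead \<alpha> - 1" "pieces \<beta> = sh 1 ` pieces \<alpha>" "base \<beta> = base \<alpha>"
  | "ahead \<alpha> = 1" "elapsed \<beta> = 0" "base \<beta> = base \<alpha>"
  using assms valid_ahead[of \<alpha>] vedge_long[of \<alpha> \<beta>] vedge_short[of \<alpha> \<beta>] vedge_base[of \<alpha> \<beta>]
  by (cases "ahead \<alpha> > 1") auto

lemma placement_next:
  assumes "valid \<alpha>" "valid \<beta>" "vedge \<alpha> \<beta>" "i \<in> placement \<alpha>" "i > 0"
  shows "i - 1 \<in> placement \<beta>"
  using assms(1,3)
proof (cases rule: vedge_cases)
  case 1
  then show ?thesis using assms(4) by (auto simp: placement_def)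
next
  case 2
  then show ?thesis using assms(4,5) valid_ahead[OF assms(2)] tame_bounds[OF valid_tame[OF assms(2)]]
    by (auto simp: placement_def)
qed

lemma placement_prev:
  assumes "valid \<alpha>" "valid \<beta>" "vedge \<alpha> \<beta>" "i \<in> placement \<beta>" "i < 0"
  shows "i + 1 \<in> placement \<alpha>"
  using assms(1,3)
proof (cases rule: vedge_cases)
  case 1
  then show ?thesis using assms(4) by (auto simp: placement_def)
next
  case 2
  then show ?thesis using assms(4,5) valid_elapsed[OF assms(1)] tame_bounds[OF valid_tame[OF assms(2)]]
    by (auto simp: placement_def)
qed

text \<open>At a junction the two loops share only the window of the common occurrence, so
  compatibility there concerns one word of the marker.\<close>

lemma follows_short_overlap:
  assumes "valid \<alpha>" "ahead \<alpha> = 1" "elapsed \<beta> = 0" "base \<beta> = base \<alpha>" "i \<in> placement \<beta>" "i + 1 \<in> placement \<alpha>"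
  shows "i \<in> {- window (base \<alpha>)..window (base \<alpha>)}"
  using assms by (auto simp: placement_def)

text \<open>Within a loop the follower is the shifted piece. Across a junction \<open>u\<close>
  shows a word of the marker, and some piece of the next loop shows the same word at its initial
  occurrence.\<close>

lemma follows_next:
  assumes v: "valid \<alpha>" "valid \<beta>" "vedge \<alpha> \<beta>" and u: "u \<in> pieces \<alpha>"
  shows "\<exists>v\<in>pieces \<beta>. follows \<alpha> \<beta> u v"
  using v(1,3)
proof (cases rule: vedge_cases)
  case 1
  then have "sh 1 u \<in> pieces \<beta>" using u by simp
  then show ?thesis by (intro bexI[of _ "sh 1 u"]) (simp_all add: follows_def sh_apply)
next
  case 2
  let ?s = "window (base \<alpha>)"
  have "restrict (sh 1 u) {- ?s..?s} \<in> words (base \<alpha>)"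
    using valid_occ_ahead[OF v(1)] u 2(1) unfolding occ_def by auto
  also have "words (base \<alpha>) = (\<lambda>v. restrict (sh 0 v) {- ?s..?s}) ` pieces \<beta>"
    using valid_occ_elapsed[OF v(2)] 2 unfolding occ_def by simp
  finally obtain v where v': "restrict (sh 1 u) {- ?s..?s} = restrict (sh 0 v) {- ?s..?s}" "v \<in> pieces \<beta>"
    by (rule imageE)
  have "follows \<alpha> \<beta> u v" unfolding follows_def
  proof (intro allI impI, elim conjE)
    fix i assume "i \<in> placement \<beta>" "i + 1 \<in> placement \<alpha>"
    then have "i \<in> {- ?s..?s}" using follows_short_overlap[OF v(1) 2] by blast
    then have "sh 1 u i = sh 0 v i" using v'(1) unfolding restrict_eq_iff by blast
    then show "v i = u (i + 1)" by (simp add: sh_apply)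
  qed
  with v' show ?thesis by blast
qed

lemma follows_prev:
  assumes v: "valid \<alpha>" "valid \<beta>" "vedge \<alpha> \<beta>" and u: "v \<in> pieces \<beta>"
  shows "\<exists>u\<in>pieces \<alpha>. follows \<alpha> \<beta> u v"
  using v(1,3)
proof (cases rule: vedge_cases)
  case 1
  then obtain u where "u \<in> pieces \<alpha>" "v = sh 1 u" using u by auto
  then show ?thesis by (intro bexI[of _ u]) (simp_all add: follows_def sh_apply)
next
  case 2
  let ?s = "window (base \<alpha>)"
  have "restrict (sh 0 v) {- ?s..?s} \<in> words (base \<alpha>)"
    using valid_occ_elapsed[OF v(2)] u 2 unfolding occ_def by auto
  also have "words (base \<alpha>) = (\<lambda>v. restrict (sh 1 v) {- ?s..?s}) ` pieces \<alpha>"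
    using valid_occ_ahead[OF v(1)] 2 unfolding occ_def by simp
  finally obtain u where u': "restrict (sh 0 v) {- ?s..?s} = restrict (sh 1 u) {- ?s..?s}" "u \<in> pieces \<alpha>"
    by (rule imageE)
  have "follows \<alpha> \<beta> u v" unfolding follows_def
  proof (intro allI impI, elim conjE)
    fix i assume "i \<in> placement \<beta>" "i + 1 \<in> placement \<alpha>"
    then have "i \<in> {- ?s..?s}" using follows_short_overlap[OF v(1) 2] by blast
    then have "sh 0 v i = sh 1 u i" using u'(1) unfolding restrict_eq_iff by blast
    then show "v i = u (i + 1)" by (simp add: sh_apply)
  qed
  with u' show ?thesis by blast
qed

text \<open>The overlap of the two placements contains the core of the occurrence at
  \<open>- elapsed \<beta>\<close>, where distinct pieces already differ. For predecessors the
  occurrence at \<open>ahead \<alpha>\<close> plays this part.\<close>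

lemma follows_next_unique:
  assumes v: "valid \<alpha>" "valid \<beta>" "vedge \<alpha> \<beta>"
    and c: "follows \<alpha> \<beta> u v1" "follows \<alpha> \<beta> u v2" "v1 \<in> pieces \<beta>" "v2 \<in> pieces \<beta>"
  shows "v1 = v2"
proof (rule occ_sep[OF valid_tame[OF v(2)] valid_occ_elapsed[OF v(2)] c(3,4)])
  fix i assume i: "i \<in> {- elapsed \<beta> - core (base \<beta>)..- elapsed \<beta> + core (base \<beta>)}"
  have b: "0 \<le> core (base \<beta>)" "core (base \<beta>) \<le> window (base \<beta>)" "1 \<le> ahead \<beta>" "0 \<le> elapsed \<beta>" "0 \<le> elapsed \<alpha>"
    using tame_bounds[OF valid_tame[OF v(2)]] valid_ahead[OF v(2)] valid_elapsed[OF v(2)] valid_elapsed[OF v(1)] by auto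
  have "i \<in> placement \<beta>" using i b by (auto simp: placement_def)
  moreover have "i + 1 \<in> placement \<alpha>" using v(1,3)
    by (cases rule: vedge_cases) (use i b in \<open>auto simp: placement_def\<close>)
  ultimately show "v1 i = v2 i" using c(1,2) unfolding follows_def by simp
qed

lemma follows_prev_unique:
  assumes v: "valid \<alpha>" "valid \<beta>" "vedge \<alpha> \<beta>"
    and c: "follows \<alpha> \<beta> u1 v" "follows \<alpha> \<beta> u2 v" "u1 \<in> pieces \<alpha>" "u2 \<in> pieces \<alpha>"
  shows "u1 = u2"
proof (rule occ_sep[OF valid_tame[OF v(1)] valid_occ_ahead[OF v(1)] c(3,4)])
  fix i assume i: "i \<in> {ahead \<alpha> - core (base \<alpha>)..ahead \<alpha> + core (base \<alpha>)}"
  have b: "0 \<le> core (base \<alpha>)" "core (base \<alpha>) \<le> window (base \<alpha>)" "1 \<le> ahead \<alpha>" "0 \<le> elapsed \<alpha>" "1 \<le> ahead \<beta>"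
    using tame_bounds[OF valid_tame[OF v(1)]] valid_ahead[OF v(1)] valid_elapsed[OF v(1)] valid_ahead[OF v(2)] by auto
  have "i \<in> placement \<alpha>" using i b by (auto simp: placement_def)
  then have "(i - 1) + 1 \<in> placement \<alpha>" by simp
  moreover have "i - 1 \<in> placement \<beta>" using v(1,3)
    by (cases rule: vedge_cases) (use i b in \<open>auto simp: placement_def\<close>)
  ultimately have "u1 (i - 1 + 1) = v (i - 1)" "u2 (i - 1 + 1) = v (i - 1)"
    using c(1,2) unfolding follows_def by metis+
  then show "u1 i = u2 i" by simp
qed

lemma follows_restrict: "follows \<alpha> \<beta> (restrict (sh n z) (placement \<alpha>)) (restrict (sh (n + 1) z) (placement \<beta>))"
  by (simp add: follows_def sh_apply algebra_simps)

lemma vpathD: "vpath x \<Longrightarrow> valid (x n)" "vpath x \<Longrightarrow> vedge (x n) (x (n + 1))"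
  by (simp_all add: vpath_def)

lemma vpath_base: "vpath x \<Longrightarrow> base (x n) = base (x 0)"
  by (rule int_constant[of "\<lambda>n. base (x n)"]) (simp add: vpathD(2) vedge_base)

text \<open>The glued sequence takes the present symbol of each piece. Compatibility along edges
  moves position \<open>j\<close> of \<open>v n\<close>, one step at a time, to the present of
  \<open>v (n + j)\<close>.\<close>

lemma follows_chain_glue:
  assumes x: "vpath x" and v: "\<And>n. v n \<in> pieces (x n)" "\<And>n. follows (x n) (x (n + 1)) (v n) (v (n + 1))"
  shows "restrict (sh n (\<lambda>n. v n 0)) (placement (x n)) = v n"
proof -
  have glue: "v (n + j) 0 = v n j" if "j \<in> placement (x n)" for n j
    using that
  proof (induction "nat \<bar>j\<bar>" arbitrary: n j)
    case (Suc k)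
    show ?case
    proof (cases "j > 0")
      case True
      have j: "j - 1 \<in> placement (x (n + 1))" using placement_next vpathD[OF x] Suc.prems True by blast
      have "k = nat \<bar>j - 1\<bar>" using Suc.hyps(2) True by simp
      from Suc.hyps(1)[OF this j] have "v (n + j) 0 = v (n + 1) (j - 1)" by simp
      also have "\<dots> = v n (j - 1 + 1)" using v(2)[of n] j Suc.prems by (simp add: follows_def)
      finally show ?thesis by simp
    next
      case False
      then have j0: "j < 0" using Suc.hyps(2) by (cases "j = 0") auto
      have e: "n - 1 + 1 = n" by simp
      have j: "j + 1 \<in> placement (x (n - 1))"
        using placement_prev[OF vpathD(1)[OF x] vpathD(1)[OF x], of "n - 1" "n - 1 + 1"] vpathD(2)[OF x, of "n - 1"] Suc.prems j0
        unfolding e by blast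
      have "k = nat \<bar>j + 1\<bar>" using Suc.hyps(2) j0 by simp
      from Suc.hyps(1)[OF this j] have "v (n + j) 0 = v (n - 1) (j + 1)" by simp
      also have "\<dots> = v n j" using v(2)[of "n - 1"] j Suc.prems unfolding e by (simp add: follows_def)
      finally show ?thesis .
    qed
  qed simp
  have ext: "v n \<in> extensional (placement (x n))" using valid_pieces[OF vpathD(1)[OF x, of n]] v(1)[of n] by (auto simp: PiE_def)
  show ?thesis
  proof (rule extensionalityI[OF restrict_extensional ext])
    fix i assume "i \<in> placement (x n)"
    then show "restrict (sh n (\<lambda>n. v n 0)) (placement (x n)) i = v n i"
      using glue[of i n] by (simp add: sh_apply add.commute)
  qed
qed

lemma strand_through_0:
  assumes x: "vpath x" and v0: "v0 \<in> pieces (x 0)"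
  shows "\<exists>z\<in>strands x. restrict z (placement (x 0)) = v0"
proof -
  have "\<exists>v. v 0 = v0 \<and> (\<forall>n. v n \<in> pieces (x n)) \<and> (\<forall>n. follows (x n) (x (n + 1)) (v n) (v (n + 1)))"
  proof (rule int_dependent_choice)
    show "v0 \<in> pieces (x 0)" by (rule v0)
    fix n :: int and u assume "u \<in> pieces (x n)"
    then show "\<exists>v'. v' \<in> pieces (x (n + 1)) \<and> follows (x n) (x (n + 1)) u v'"
      using follows_next[OF vpathD(1)[OF x] vpathD(1)[OF x] vpathD(2)[OF x]] by blast
  next
    fix n :: int and u assume "u \<in> pieces (x (n + 1))"
    then show "\<exists>v. v \<in> pieces (x n) \<and> follows (x n) (x (n + 1)) v u"
      using follows_prev[OF vpathD(1)[OF x] vpathD(1)[OF x] vpathD(2)[OF x]] by blast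
  qed
  then obtain v where v: "v 0 = v0" "\<forall>n. v n \<in> pieces (x n)"
    "\<forall>n. follows (x n) (x (n + 1)) (v n) (v (n + 1))" by (elim exE conjE)
  define z where "z = (\<lambda>n. v n 0)"
  have z: "restrict (sh n z) (placement (x n)) = v n" for n
    unfolding z_def by (rule follows_chain_glue[OF x v(2,3)[rule_format]])
  have "z \<in> strands x" using z v(2) by (simp add: strands_def)
  moreover have "restrict z (placement (x 0)) = v0" using z[of 0] v(1) by simp
  ultimately show ?thesis by blast
qed

lemma vpath_sh: "vpath x \<Longrightarrow> vpath (\<lambda>m. x (m + n))"
  unfolding vpath_def by (metis add.assoc add.commute)

lemma strands_sh: "strands (\<lambda>m. x (m + n)) = sh n ` strands x"
proof (intro equalityI subsetI)
  fix z assume z: "z \<in> strands (\<lambda>m. x (m + n))"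
  have "restrict (sh m (sh (- n) z)) (placement (x m)) \<in> pieces (x m)" for m
  proof -
    have "restrict (sh (m - n) z) (placement (x (m - n + n))) \<in> pieces (x (m - n + n))"
      using z unfolding strands_def by blast
    then show ?thesis by simp
  qed
  then have "sh (- n) z \<in> strands x" by (simp add: strands_def)
  then have "sh n (sh (- n) z) \<in> sh n ` strands x" by (rule imageI)
  then show "z \<in> sh n ` strands x" by simp
next
  fix z assume "z \<in> sh n ` strands x"
  then show "z \<in> strands (\<lambda>m. x (m + n))" by (auto simp: strands_def)
qed

lemma strand_through:
  assumes x: "vpath x" and v: "v \<in> pieces (x n)"
  shows "\<exists>z\<in>strands x. restrict (sh n z) (placement (x n)) = v"
proof -
  obtain z' where "z' \<in> strands (\<lambda>m. x (m + n))" "restrict z' (placement (x n)) = v"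
    using strand_through_0[OF vpath_sh[OF x, of n]] v by auto
  then show ?thesis unfolding strands_sh by blast
qed

text \<open>A piece determines its neighbours, so equality at time 0 spreads as far as the two paths
  agree. Only vertices up to distance \<open>N\<close> enter, which is the origin of the Lipschitz
  constant 1.\<close>

lemma strands_agree:
  assumes x: "vpath x" "vpath y" and z: "z \<in> strands x" "z' \<in> strands y"
    and eq: "\<And>i. \<bar>i\<bar> \<le> int N \<Longrightarrow> x i = y i"
    and z0: "restrict z (placement (x 0)) = restrict z' (placement (x 0))"
    and i: "\<bar>i\<bar> \<le> int N"
  shows "restrict (sh i z) (placement (x i)) = restrict (sh i z') (placement (x i))"
  using i
proof (induction "nat \<bar>i\<bar>" arbitrary: i)
  case 0
  then show ?case using z0 by simp
next
  case (Suc k)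
  have bz: "restrict (sh m z) (placement (x m)) \<in> pieces (x m)" for m using z(1) by (simp add: strands_def)
  have bz': "restrict (sh m z') (placement (x m)) \<in> pieces (x m)" if "\<bar>m\<bar> \<le> int N" for m
    using z(2) eq[OF that] by (simp add: strands_def)
  show ?case
  proof (cases "i > 0")
    case True
    have IH: "restrict (sh (i - 1) z) (placement (x (i - 1))) = restrict (sh (i - 1) z') (placement (x (i - 1)))"
      using Suc.hyps(2) Suc.prems True by (intro Suc.hyps(1)) auto
    have e: "i - 1 + 1 = i" by simp
    \<comment> \<open>\<open>folded IH\<close> rewrites the piece of \<open>z'\<close> at time
      \<open>i - 1\<close> as that of \<open>z\<close>, so both candidates at time \<open>i\<close>
      follow the same piece.\<close>
    show ?thesis
      using follows_next_unique[OF vpathD(1)[OF x(1)] vpathD(1)[OF x(1)] vpathD(2)[OF x(1)],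
          of "i - 1" "restrict (sh (i - 1) z) (placement (x (i - 1)))" _ "restrict (sh (i - 1 + 1) z') (placement (x (i - 1 + 1)))",
          OF follows_restrict follows_restrict[of "x (i - 1)" _ "i - 1" z', folded IH]]
        bz[of i] bz'[OF Suc.prems]
      unfolding e by blast
  next
    case False
    then have i0: "i < 0" using Suc.hyps(2) by (cases "i = 0") auto
    have IH: "restrict (sh (i + 1) z) (placement (x (i + 1))) = restrict (sh (i + 1) z') (placement (x (i + 1)))"
      using Suc.hyps(2) Suc.prems i0 by (intro Suc.hyps(1)) auto
    show ?thesis
      using follows_prev_unique[OF vpathD(1)[OF x(1)] vpathD(1)[OF x(1)] vpathD(2)[OF x(1)],
          of i "restrict (sh i z) (placement (x i))" "restrict (sh (i + 1) z) (placement (x (i + 1)))" "restrict (sh i z') (placement (x i))",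
          OF follows_restrict follows_restrict[of "x i" "x (i + 1)" i z', folded IH]]
        bz[of i] bz'[OF Suc.prems]
      by blast
  qed
qed

lemma strands_agree_at:
  assumes x: "vpath x" "vpath y" and z: "z \<in> strands x" "z' \<in> strands y"
    and eq: "\<And>i. \<bar>i\<bar> \<le> int N \<Longrightarrow> x i = y i"
    and z0: "restrict z (placement (x 0)) = restrict z' (placement (x 0))"
    and i: "\<bar>i\<bar> \<le> int N"
  shows "z i = z' i"
proof -
  have "restrict (sh i z) (placement (x i)) 0 = restrict (sh i z') (placement (x i)) 0"
    using strands_agree[OF x z eq z0 i] by simp
  then show ?thesis using valid_0_placement[OF vpathD(1)[OF x(1)]] by (simp add: sh_apply)
qed

lemma strands_unique:
  assumes x: "vpath x" and z: "z \<in> strands x" "z' \<in> strands x"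
    and z0: "restrict (sh n z) (placement (x n)) = restrict (sh n z') (placement (x n))"
  shows "z = z'"
proof -
  have "sh n z = sh n z'"
  proof
    fix i
    show "sh n z i = sh n z' i"
    proof (rule strands_agree_at[OF vpath_sh[OF x, of n] vpath_sh[OF x, of n], where N = "nat \<bar>i\<bar>"])
      show "sh n z \<in> strands (\<lambda>m. x (m + n))" "sh n z' \<in> strands (\<lambda>m. x (m + n))"
        using z by (simp_all add: strands_sh)
    qed (use z0 in auto)
  qed
  then have "sh (- n) (sh n z) = sh (- n) (sh n z')" by simp
  then show ?thesis by simp
qed

end

lemma last_before:
  fixes P :: "int \<Rightarrow> bool"
  assumes "\<forall>N. \<exists>n\<le>N. P n"
  shows "\<exists>p\<ge>0. P (n - p) \<and> (\<forall>j. 0 \<le> j \<and> j < p \<longrightarrow> \<not> P (n - j))"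
proof -
  obtain m where m: "m \<le> n" "P m" using assms by blast
  define k where "k = (LEAST k. P (n - int k))"
  have "P (n - int (nat (n - m)))" using m by simp
  then have k: "P (n - int k)" unfolding k_def by (rule LeastI)
  have "\<not> P (n - j)" if "0 \<le> j" "j < int k" for j
    using not_less_Least[of "nat j" "\<lambda>k. P (n - int k)"] that unfolding k_def[symmetric] by auto
  with k show ?thesis by (intro exI[of _ "int k"]) auto
qed

text \<open>The count starts at 1 here but at 0 in \<open>last_before\<close>: a present occurrence
  opens a new loop, so loops are half-open and each time lies in exactly one of them.\<close>

lemma first_after:
  fixes P :: "int \<Rightarrow> bool"
  assumes "\<forall>N. \<exists>n\<ge>N. P n"
  shows "\<exists>q\<ge>1. P (n + q) \<and> (\<forall>j. 1 \<le> j \<and> j < q \<longrightarrow> \<not> P (n + j))"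
proof -
  obtain m where m: "m \<ge> n + 1" "P m" using assms by blast
  define k where "k = (LEAST k. P (n + 1 + int k))"
  have "P (n + 1 + int (nat (m - n - 1)))" using m by simp
  then have k: "P (n + 1 + int k)" unfolding k_def by (rule LeastI)
  have "\<not> P (n + j)" if "1 \<le> j" "j < int k + 1" for j
    using not_less_Least[of "nat (j - 1)" "\<lambda>k. P (n + 1 + int k)"] that unfolding k_def[symmetric] by auto
  with k show ?thesis by (intro exI[of _ "int k + 1"]) (auto simp: algebra_simps)
qed

text \<open>For \<open>sdist\<close>, not increasing the distance amounts to this: coordinates up to
  distance \<open>N\<close> depend only on coordinates up to distance \<open>N\<close>. It is
  applied at the first disagreement of \<open>f\<close> and \<open>g\<close>.\<close>

lemma sdist_le_if_agree:
  assumes "\<And>N i. (\<And>i. \<bar>i\<bar> \<le> int N \<Longrightarrow> x i = y i) \<Longrightarrow> \<bar>i\<bar> \<le> int N \<Longrightarrow> f i = g i"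
  shows "sdist f g \<le> sdist x y"
proof (cases "f = g")
  case True
  then show ?thesis by (simp add: sdist_def)
next
  case False
  then have "{nat \<bar>n\<bar> |n. f n \<noteq> g n} \<noteq> {}" by (auto simp: fun_eq_iff)
  from Inf_nat_def1[OF this] obtain n
    where n: "Inf {nat \<bar>n\<bar> |n. f n \<noteq> g n} = nat \<bar>n\<bar>" "f n \<noteq> g n" by auto
  have "\<exists>i. \<bar>i\<bar> \<le> int (nat \<bar>n\<bar>) \<and> x i \<noteq> y i"
  proof (rule ccontr)
    assume "\<not> ?thesis"
    then have "f n = g n" by (intro assms[of "nat \<bar>n\<bar>"]) auto
    with n show False by simp
  qed
  then obtain i where i: "\<bar>i\<bar> \<le> int (nat \<bar>n\<bar>)" "x i \<noteq> y i" by blast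
  then have "Inf {nat \<bar>n\<bar> |n. x n \<noteq> y n} \<le> nat \<bar>i\<bar>" by (intro cInf_lower) auto
  also have "\<dots> \<le> Inf {nat \<bar>n\<bar> |n. f n \<noteq> g n}" using n(1) i(1) by (simp add: nat_le_iff)
  finally have "Inf {nat \<bar>n\<bar> |n. x n \<noteq> y n} \<le> Inf {nat \<bar>n\<bar> |n. f n \<noteq> g n}" .
  moreover have "x \<noteq> y" using i by auto
  ultimately show ?thesis using False by (simp add: sdist_def)
qed

context bowen_graph
begin

section \<open>The strands of a path form exactly one fibre\<close>

lemma strand_pieces: "z \<in> strands x \<Longrightarrow> restrict (sh n z) (placement (x n)) \<in> pieces (x n)"
  by (simp add: strands_def)

lemma strand_R:
  assumes "vpath x" "z \<in> strands x" "z' \<in> strands x"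
  shows "(z n, z' n) \<in> R"
  using valid_rel[OF vpathD(1)[OF assms(1), of n] strand_pieces[OF assms(2)] strand_pieces[OF assms(3)]
      valid_0_placement[OF vpathD(1)[OF assms(1)]]] valid_0_placement[OF vpathD(1)[OF assms(1), of n]]
  by (simp add: sh_apply)

lemma strand_X:
  assumes x: "vpath x" and z: "z \<in> strands x"
  shows "z \<in> X"
  unfolding X_iff
proof
  fix n
  have v: "valid (x n)" by (rule vpathD(1)[OF x])
  have "(restrict (sh n z) (placement (x n)) 0, restrict (sh n z) (placement (x n)) (0 + 1)) \<in> E"
    using valid_bounds[OF v]
    by (intro valid_path[OF v strand_pieces[OF z], unfolded path_on_def, rule_format]) auto
  moreover have "0 \<in> placement (x n)" "1 \<in> placement (x n)" using valid_bounds[OF v] by (auto simp: placement_def)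
  ultimately show "(z n, z (n + 1)) \<in> E" by (simp add: sh_apply add.commute)
qed

text \<open>Loops are finite, so every path, recurrent or not, meets its marker arbitrarily early
  and late; there a strand shows the central symbol of one of finitely many words.\<close>

lemma strand_XR:
  assumes x: "vpath x" and z: "z \<in> strands x"
  shows "z \<in> XR"
proof -
  define M where "M = (\<lambda>u :: int \<Rightarrow> 'a. u 0) ` words (base (x 0))"
  have M: "finite M" unfolding M_def using tame_words[OF valid_tame[OF vpathD(1)[OF x, of 0]]] by simp
  have in_M: "z (n + j) \<in> M" if o: "occ (base (x n)) j (pieces (x n))" and j: "j \<in> placement (x n)" for n j
  proof -
    let ?s = "window (base (x n))"
    have "restrict (sh j (restrict (sh n z) (placement (x n)))) {- ?s..?s} \<in> words (base (x n))"
      using o strand_pieces[OF z, of n] unfolding occ_def by blast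
    moreover have "restrict (sh j (restrict (sh n z) (placement (x n)))) {- ?s..?s} 0 = z (n + j)"
      using valid_bounds[OF vpathD(1)[OF x, of n]] j by (simp add: sh_apply add.commute)
    ultimately show ?thesis unfolding M_def vpath_base[OF x, of n] by (metis imageI)
  qed
  have "\<forall>N. \<exists>n\<le>N. z n \<in> M"
  proof
    fix N
    have "z (N + - elapsed (x N)) \<in> M"
      by (rule in_M[OF valid_occ_elapsed[OF vpathD(1)[OF x]]])
        (use valid_bounds[OF vpathD(1)[OF x, of N]] in \<open>auto simp: placement_def\<close>)
    then show "\<exists>n\<le>N. z n \<in> M"
      using valid_elapsed[OF vpathD(1)[OF x, of N]] by (intro exI[of _ "N + - elapsed (x N)"]) simp
  qed
  moreover have "\<forall>N. \<exists>n\<ge>N. z n \<in> M"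
  proof
    fix N
    have "z (N + ahead (x N)) \<in> M"
      by (rule in_M[OF valid_occ_ahead[OF vpathD(1)[OF x]]])
        (use valid_bounds[OF vpathD(1)[OF x, of N]] in \<open>auto simp: placement_def\<close>)
    then show "\<exists>n\<ge>N. z n \<in> M"
      using valid_ahead[OF vpathD(1)[OF x, of N]] by (intro exI[of _ "N + ahead (x N)"]) simp
  qed
  ultimately show ?thesis
    using frequently_finite_past[OF M] frequently_finite_future[OF M] strand_X[OF x z]
    unfolding regular_part_iff by blast
qed

text \<open>The pieces are known to agree with \<open>g\<close> only as far as the cores at both
  ends, not on their whole placements. The overlap still contains the core of an occurrence, where
  separation of words upgrades this to agreement on the overlap.\<close>

lemma bundle_shadow_follows:
  assumes v: "valid \<alpha>" "valid \<beta>" "vedge \<alpha> \<beta>"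
    and u: "u \<in> pieces \<alpha>" "\<And>i. i \<in> {- elapsed \<alpha> - core (base \<alpha>)..ahead \<alpha> + core (base \<alpha>)} \<Longrightarrow> u i = g i"
    and u': "u' \<in> pieces \<beta>" "\<And>i. i \<in> {- elapsed \<beta> - core (base \<beta>)..ahead \<beta> + core (base \<beta>)} \<Longrightarrow> u' i = g (i + 1)"
  shows "follows \<alpha> \<beta> u u'"
  using v(1,3)
proof (cases rule: vedge_cases)
  case 1
  have "u' = sh 1 u"
  proof (rule occ_sep[OF valid_tame[OF v(2)] valid_occ_elapsed[OF v(2)] u'(1)])
    show "sh 1 u \<in> pieces \<beta>" using 1 u(1) by simp
    fix i assume i: "i \<in> {- elapsed \<beta> - core (base \<beta>)..- elapsed \<beta> + core (base \<beta>)}"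
    have "u' i = g (i + 1)" using i valid_bounds[OF v(2)] by (intro u'(2)) auto
    moreover have "u (i + 1) = g (i + 1)" using i 1 valid_bounds[OF v(1)] by (intro u(2)) auto
    ultimately show "u' i = sh 1 u i" by (simp add: sh_apply)
  qed
  then show ?thesis by (simp add: follows_def sh_apply)
next
  case 2
  let ?I = "{- window (base \<alpha>)..window (base \<alpha>)}"
  have "restrict (sh 1 u) ?I = restrict (sh 0 u') ?I"
  proof (rule tame_sep[OF valid_tame[OF v(1)]])
    have "occ (base \<alpha>) 1 (pieces \<alpha>)" "occ (base \<alpha>) 0 (pieces \<beta>)"
      using valid_occ_ahead[OF v(1)] valid_occ_elapsed[OF v(2)] 2 by simp_all
    then have im: "(\<lambda>v. restrict (sh 1 v) ?I) ` pieces \<alpha> = words (base \<alpha>)"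
      "(\<lambda>v. restrict (sh 0 v) ?I) ` pieces \<beta> = words (base \<alpha>)"
      by (simp_all only: occ_def)
    show "restrict (sh 1 u) ?I \<in> words (base \<alpha>)" "restrict (sh 0 u') ?I \<in> words (base \<alpha>)"
      using imageI[OF u(1), of "\<lambda>v. restrict (sh 1 v) ?I"] imageI[OF u'(1), of "\<lambda>v. restrict (sh 0 v) ?I"]
      unfolding im by simp_all
    fix i assume i: "i \<in> {- core (base \<alpha>)..core (base \<alpha>)}"
    have "u' i = g (i + 1)" using i 2 valid_bounds[OF v(2)] by (intro u'(2)) auto
    moreover have "u (i + 1) = g (i + 1)" using i 2 valid_bounds[OF v(1)] by (intro u(2)) auto
    ultimately show "restrict (sh 1 u) ?I i = restrict (sh 0 u') ?I i"
      using i valid_bounds[OF v(1)] by (simp add: sh_apply)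
  qed
  then have eq: "\<And>i. i \<in> ?I \<Longrightarrow> u (i + 1) = u' i"
    unfolding restrict_eq_iff sh_apply by simp
  show ?thesis unfolding follows_def
  proof (intro allI impI, elim conjE)
    fix i assume "i \<in> placement \<beta>" "i + 1 \<in> placement \<alpha>"
    then have "i \<in> ?I" by (rule follows_short_overlap[OF v(1) 2])
    from eq[OF this] show "u' i = u (i + 1)" by simp
  qed
qed

text \<open>A member \<open>g\<close> of the fibre is related to every strand, hence to every piece,
  as each piece extends to a strand. Validity then supplies pieces that \<open>g\<close> follows at
  all times, and these glue to \<open>g\<close> itself.\<close>

lemma fib_strand:
  assumes x: "vpath x" and z0: "z0 \<in> strands x"
  shows "fib z0 = strands x"
proof (intro equalityI subsetI)
  fix z assume "z \<in> strands x"
  then show "z \<in> fib z0" using strand_R[OF x _ z0] strand_X[OF x] by (simp add: fib_def)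
next
  fix g assume g: "g \<in> fib z0"
  have z0R: "z0 \<in> XR" by (rule strand_XR[OF x z0])
  have gX: "g \<in> X" using g by (simp add: fib_def)
  have gR: "(g n, z n) \<in> R" if "z \<in> strands x" for z n
  proof (rule fib_R[OF z0R g])
    show "z \<in> fib z0" using strand_R[OF x that z0] strand_X[OF x that] by (simp add: fib_def)
  qed
  have "\<exists>u\<in>pieces (x n). \<forall>i\<in>{- elapsed (x n) - core (base (x n))..ahead (x n) + core (base (x n))}. sh n g i = u i" for n
  proof (rule valid_exact[OF vpathD(1)[OF x]])
    show "path_on E (- elapsed (x n) - window (base (x n))) (ahead (x n) + window (base (x n))) (sh n g)"
      by (rule path_on_X) (simp add: X_sh gX)
    fix u i assume u: "u \<in> pieces (x n)" and i: "i \<in> placement (x n)"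
    obtain z where z: "z \<in> strands x" "restrict (sh n z) (placement (x n)) = u"
      using strand_through[OF x u] by blast
    show "(sh n g i, u i) \<in> R" using gR[OF z(1), of "i + n"] i z(2) by (auto simp: sh_apply)
  qed
  then have "\<forall>n. \<exists>u. u \<in> pieces (x n) \<and>
      (\<forall>i\<in>{- elapsed (x n) - core (base (x n))..ahead (x n) + core (base (x n))}. sh n g i = u i)" by blast
  from choice[OF this] obtain u where u: "\<And>n. u n \<in> pieces (x n)"
    "\<And>n i. i \<in> {- elapsed (x n) - core (base (x n))..ahead (x n) + core (base (x n))} \<Longrightarrow> sh n g i = u n i" by blast
  have "follows (x n) (x (n + 1)) (u n) (u (n + 1))" for n
  proof (rule bundle_shadow_follows[OF vpathD(1)[OF x] vpathD(1)[OF x] vpathD(2)[OF x] u(1) _ u(1)])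
    fix i assume "i \<in> {- elapsed (x n) - core (base (x n))..ahead (x n) + core (base (x n))}"
    from u(2)[OF this] show "u n i = sh n g i" by simp
  next
    fix i assume "i \<in> {- elapsed (x (n + 1)) - core (base (x (n + 1)))..ahead (x (n + 1)) + core (base (x (n + 1)))}"
    from u(2)[OF this] show "u (n + 1) i = sh n g (i + 1)" by (simp add: sh_apply algebra_simps)
  qed
  from follows_chain_glue[OF x u(1) this]
  have glue: "restrict (sh n (\<lambda>n. u n 0)) (placement (x n)) = u n" for n .
  have "(\<lambda>n. u n 0) \<in> strands x" unfolding strands_def using glue u(1) by simp
  moreover have "(\<lambda>n. u n 0) = g"
  proof
    fix n
    have "0 \<in> {- elapsed (x n) - core (base (x n))..ahead (x n) + core (base (x n))}"
      using valid_bounds[OF vpathD(1)[OF x, of n]] by auto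
    from u(2)[OF this] show "u n 0 = g n" by (simp add: sh_apply)
  qed
  ultimately show "g \<in> strands x" by simp
qed

lemma at_vertex_strands:
  assumes x: "vpath x"
  shows "at_vertex (x n) n (strands x)"
proof -
  let ?f = "\<lambda>z. restrict (sh n z) (placement (x n))"
  have im: "?f ` strands x = pieces (x n)"
    using strand_pieces[of _ x n] strand_through[OF x, of _ n] by (auto simp: image_iff)
  moreover have "inj_on ?f (strands x)"
    using strands_unique[OF x] by (rule inj_onI)
  ultimately show ?thesis unfolding at_vertex_def using card_image by metis
qed

lemma occ_at_vertex:
  assumes "at_vertex \<alpha> n F" "{j - window w..j + window w} \<subseteq> placement \<alpha>"
  shows "occ w j (pieces \<alpha>) \<longleftrightarrow> occ w (n + j) F"
  using assms unfolding at_vertex_def by (intro occ_bundle[of n "placement \<alpha>"]) auto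

text \<open>\<open>elapsed\<close> and \<open>ahead\<close> are read off from \<open>F\<close> as
  the distances to the nearest occurrences of the base marker; the interval and the pieces are then
  determined.\<close>

lemma at_vertex_unique:
  assumes v: "valid \<alpha>" "valid \<beta>" "base \<alpha> = base \<beta>" and F: "at_vertex \<alpha> n F" "at_vertex \<beta> n F"
  shows "\<alpha> = \<beta>"
proof -
  have o: "occ (base \<gamma>) (n - elapsed \<gamma>) F \<and> occ (base \<gamma>) (n + ahead \<gamma>) F \<and>
      (\<forall>j. - elapsed \<gamma> < j \<and> j < ahead \<gamma> \<longrightarrow> \<not> occ (base \<gamma>) (n + j) F)"
    if g: "valid \<gamma>" "at_vertex \<gamma> n F" for \<gamma>
  proof -
    have t: "occ (base \<gamma>) j (pieces \<gamma>) \<longleftrightarrow> occ (base \<gamma>) (n + j) F" if "- elapsed \<gamma> \<le> j" "j \<le> ahead \<gamma>" for j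
      using that by (intro occ_at_vertex[OF g(2)]) (auto simp: placement_def)
    show ?thesis
      using t[of "- elapsed \<gamma>"] t[of "ahead \<gamma>"] t valid_occ_elapsed[OF g(1)] valid_occ_ahead[OF g(1)]
        valid_not_occ[OF g(1)] valid_bounds[OF g(1)] by auto
  qed
  have le: "elapsed \<gamma> \<le> elapsed \<delta> \<and> ahead \<gamma> \<le> ahead \<delta>"
    if g: "valid \<gamma>" "at_vertex \<gamma> n F" and d: "valid \<delta>" "at_vertex \<delta> n F" and m: "base \<gamma> = base \<delta>" for \<gamma> \<delta>
  proof -
    have og: "\<not> occ (base \<delta>) (n + j) F" if "- elapsed \<gamma> < j" "j < ahead \<gamma>" for j
      using o[OF g] that m by simp
    have od: "occ (base \<delta>) (n + - elapsed \<delta>) F" "occ (base \<delta>) (n + ahead \<delta>) F" using o[OF d] by simp_all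
    have "\<not> elapsed \<delta> < elapsed \<gamma>"
      using og[of "- elapsed \<delta>"] od(1) valid_bounds[OF g(1)] valid_bounds[OF d(1)] by auto
    moreover have "\<not> ahead \<delta> < ahead \<gamma>"
      using og[of "ahead \<delta>"] od(2) valid_bounds[OF g(1)] valid_bounds[OF d(1)] by auto
    ultimately show ?thesis by simp
  qed
  have "elapsed \<alpha> = elapsed \<beta>" "ahead \<alpha> = ahead \<beta>"
    using le[OF v(1) F(1) v(2) F(2) v(3)] le[OF v(2) F(2) v(1) F(1) v(3)[symmetric]] by auto
  moreover from this have "placement \<alpha> = placement \<beta>" using v(3) by (simp add: placement_def)
  then have "pieces \<alpha> = pieces \<beta>" using F unfolding at_vertex_def by simp
  ultimately show ?thesis using v(3) by (simp add: vertex.expand)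
qed

section \<open>From fibres back to paths\<close>

lemma guard_at:
  assumes w: "tame w" and o: "occ w m F"
    and y: "path_on E (m - window w) (m + window w) y"
    and rel: "\<And>z t. z \<in> F \<Longrightarrow> t \<in> {m - window w..m + window w} \<Longrightarrow> (y t, z t) \<in> R"
  shows "\<exists>z\<in>F. \<forall>t\<in>{m - core w..m + core w}. y t = z t"
proof -
  let ?f = "\<lambda>v. restrict (sh m v) {- window w..window w}"
  have f: "?f ` F = words w" using o by (simp add: occ_def)
  have "\<exists>u\<in>words w. \<forall>i\<in>{- core w..core w}. sh m y i = u i"
  proof (rule tame_guard[OF w])
    show "path_on E (- window w) (window w) (sh m y)"
      unfolding path_on_def
    proof (intro allI impI)
      fix i assume i: "- window w \<le> i \<and> i < window w"
      have "(y (i + m), y (i + m + 1)) \<in> E"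
        using y[unfolded path_on_def, rule_format, of "i + m"] i by auto
      then show "(sh m y i, sh m y (i + 1)) \<in> E" by (simp add: sh_apply algebra_simps)
    qed
    fix u assume "u \<in> words w"
    then have "u \<in> ?f ` F" using f by simp
    then obtain z where z: "u = ?f z" "z \<in> F" by (rule imageE)
    show "rel_on R (- window w) (window w) (sh m y) u"
      unfolding rel_on_def z(1) using rel[OF z(2)] by (auto simp: sh_apply)
  qed
  then obtain u where u: "u \<in> words w" "\<forall>i\<in>{- core w..core w}. sh m y i = u i" by (rule bexE)
  have "u \<in> ?f ` F" using u(1) f by simp
  then obtain z where z: "u = ?f z" "z \<in> F" by (rule imageE)
  have "y t = z t" if "t \<in> {m - core w..m + core w}" for t
  proof -
    have "t - m \<in> {- core w..core w}" using that by auto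
    then have "sh m y (t - m) = ?f z (t - m)" "t - m \<in> {- window w..window w}"
      using u(2) tame_bounds[OF w] unfolding z(1) by auto
    then show ?thesis by (simp add: sh_apply)
  qed
  with z(2) show ?thesis by blast
qed

text \<open>The demanding clause of \<open>valid\<close> is the last: a related word must be
  completed to a point of the fibre. The guards at both end occurrences supply strands that it meets
  there, and these provide the missing past and future.\<close>

lemma fibre_vertex:
  assumes x0: "x0 \<in> XR" and w: "tame w" and pq: "0 \<le> p" "1 \<le> q"
    and op: "occ w (n - p) (fib x0)" and oq: "occ w (n + q) (fib x0)"
    and no: "\<And>j. - p < j \<Longrightarrow> j < q \<Longrightarrow> \<not> occ w (n + j) (fib x0)"
    and prior: "\<And>w'. tame w' \<Longrightarrow> prior w' w \<Longrightarrow> \<not> occ w' n (fib x0)"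
    and \<alpha>: "\<alpha> = Vertex w p q ((\<lambda>z. restrict (sh n z) {- p - window w..q + window w}) ` fib x0)"
  shows "valid \<alpha> \<and> at_vertex \<alpha> n (fib x0)"
proof -
  let ?F = "fib x0" and ?I = "{- p - window w..q + window w}"
  let ?f = "\<lambda>z. restrict (sh n z) ?I"
  have b: "0 \<le> core w" "core w \<le> window w" using tame_bounds[OF w] by auto
  have placement: "placement \<alpha> = ?I" by (simp add: placement_def \<alpha>)
  have finF: "finite ?F" by (rule finite_fib[OF x0])
  have inj: "inj_on ?f ?F"
  proof (rule inj_onI)
    fix u v assume uv: "u \<in> ?F" "v \<in> ?F" "?f u = ?f v"
    show "u = v"
    proof (rule occ_sep[OF w op uv(1,2)])
      fix i assume "i \<in> {n - p - core w..n - p + core w}"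
      then have "i - n \<in> ?I" using b pq by auto
      then have "sh n u (i - n) = sh n v (i - n)" using uv(3) unfolding restrict_eq_iff by blast
      then show "u i = v i" by (simp add: sh_apply)
    qed
  qed
  have at: "at_vertex \<alpha> n ?F"
    unfolding at_vertex_def placement using card_image[OF inj] by (simp add: \<alpha>)
  have occ: "occ w' j (pieces \<alpha>) \<longleftrightarrow> occ w' (n + j) ?F" if "{j - window w'..j + window w'} \<subseteq> ?I" for w' j
    by (rule occ_at_vertex[OF at]) (unfold placement, rule that)
  have exact: "\<exists>u\<in>pieces \<alpha>. \<forall>i\<in>{- p - core w..q + core w}. v i = u i"
    if v: "path_on E (- p - window w) (q + window w) v" "\<forall>u\<in>pieces \<alpha>. rel_on R (- p - window w) (q + window w) v u" for v
  proof -
    define y where "y = sh (- n) v"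
    have yE: "(y t, y (t + 1)) \<in> E" if "n - p - window w \<le> t" "t < n + q + window w" for t
      using v(1)[unfolded path_on_def, rule_format, of "t - n"] that by (auto simp: y_def sh_apply algebra_simps)
    have yR: "(y t, z t) \<in> R" if "z \<in> ?F" "n - p - window w \<le> t" "t \<le> n + q + window w" for z t
    proof -
      have "?f z \<in> pieces \<alpha>" using that(1) by (simp add: \<alpha>)
      then have "(v (t - n), ?f z (t - n)) \<in> R" using v(2) that(2,3) unfolding rel_on_def by auto
      then show ?thesis using that by (simp add: y_def sh_apply)
    qed
    have "\<exists>z\<in>?F. \<forall>t\<in>{n - p - core w..n - p + core w}. y t = z t"
      by (rule guard_at[OF w op]) (use yE yR pq in \<open>auto simp: path_on_def\<close>)
    then obtain z1 where z1: "z1 \<in> ?F" "\<And>t. t \<in> {n - p - core w..n - p + core w} \<Longrightarrow> y t = z1 t" by blast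
    have "\<exists>z\<in>?F. \<forall>t\<in>{n + q - core w..n + q + core w}. y t = z t"
      by (rule guard_at[OF w oq]) (use yE yR pq in \<open>auto simp: path_on_def\<close>)
    then obtain z2 where z2: "z2 \<in> ?F" "\<And>t. t \<in> {n + q - core w..n + q + core w} \<Longrightarrow> y t = z2 t" by blast
    \<comment> \<open>The switches are at the centres of the end occurrences, where \<open>y\<close>
      meets \<open>z1\<close> and \<open>z2\<close>. Agreement on the cores also keeps
      \<open>g\<close> equal to \<open>y\<close> up to distance \<open>core w\<close> beyond the
      switches.\<close>
    define g where "g t = (if t < n - p then z1 t else if t \<le> n + q then y t else z2 t)" for t
    have zX: "z1 \<in> X" "z2 \<in> X" using z1(1) z2(1) by (auto simp: fib_def)
    have "g \<in> X" unfolding X_iff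
    proof
      fix t
      have s: "y (n - p) = z1 (n - p)" "y (n + q) = z2 (n + q)" using z1(2) z2(2) b by auto
      consider "t + 1 < n - p" | "t + 1 = n - p" | "n - p \<le> t" "t < n + q" | "t = n + q" | "n + q < t" by linarith
      then show "(g t, g (t + 1)) \<in> E"
      proof cases
        case 1
        then show ?thesis using XD(2)[OF zX(1), of t] by (simp add: g_def)
      next
        case 2
        then have "g t = z1 t" "g (t + 1) = z1 (t + 1)" using s pq by (auto simp: g_def)
        then show ?thesis using XD(2)[OF zX(1), of t] by simp
      next
        case 3
        then show ?thesis using yE[of t] b by (simp add: g_def)
      next
        case 4
        then have "g t = z2 t" "g (t + 1) = z2 (t + 1)" using s pq by (auto simp: g_def)
        then show ?thesis using XD(2)[OF zX(2), of t] by simp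
      next
        case 5
        then show ?thesis using XD(2)[OF zX(2), of t] pq by (simp add: g_def)
      qed
    qed
    moreover have "(g t, x0 t) \<in> R" for t
      using fib_R[OF x0 z1(1) fib_self[OF x0], of t] fib_R[OF x0 z2(1) fib_self[OF x0], of t]
        yR[OF fib_self[OF x0], of t] b by (auto simp: g_def)
    ultimately have gF: "g \<in> ?F" by (simp add: fib_def)
    have "v i = ?f g i" if i: "i \<in> {- p - core w..q + core w}" for i
    proof -
      have "y (i + n) = g (i + n)"
        using z1(2)[of "i + n"] z2(2)[of "i + n"] i by (auto simp: g_def)
      moreover have "i \<in> ?I" using i b by auto
      ultimately show ?thesis by (simp add: y_def sh_apply)
    qed
    moreover have "?f g \<in> pieces \<alpha>" using gF by (simp add: \<alpha>)
    ultimately show ?thesis by blast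
  qed
  have "valid \<alpha>" unfolding valid_def
  proof (intro conjI)
    show "tame (base \<alpha>)" "0 \<le> elapsed \<alpha>" "1 \<le> ahead \<alpha>" using w pq by (simp_all add: \<alpha>)
    show "pieces \<alpha> \<subseteq> placement \<alpha> \<rightarrow>\<^sub>E A" unfolding placement
      by (auto simp: \<alpha> fib_def sh_apply XD(1))
    show "\<forall>v\<in>pieces \<alpha>. path_on E (- elapsed \<alpha> - window (base \<alpha>)) (ahead \<alpha> + window (base \<alpha>)) v"
    proof
      fix v assume "v \<in> pieces \<alpha>"
      then obtain z where z: "z \<in> ?F" "v = ?f z" by (auto simp: \<alpha>)
      then have "sh n z \<in> X" by (simp add: fib_def X_sh)
      then show "path_on E (- elapsed \<alpha> - window (base \<alpha>)) (ahead \<alpha> + window (base \<alpha>)) v"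
        unfolding z(2) path_on_def using XD(2)[of "sh n z"] by (auto simp: \<alpha>)
    qed
    show "\<forall>u\<in>pieces \<alpha>. \<forall>v\<in>pieces \<alpha>. rel_on R (- elapsed \<alpha> - window (base \<alpha>)) (ahead \<alpha> + window (base \<alpha>)) u v"
      using fib_R[OF x0] by (auto simp: \<alpha> rel_on_def sh_apply)
    show "occ (base \<alpha>) (- elapsed \<alpha>) (pieces \<alpha>)"
      using occ[of "- p" w] op pq by (simp add: \<alpha>)
    show "occ (base \<alpha>) (ahead \<alpha>) (pieces \<alpha>)"
      using occ[of q w] oq pq by (simp add: \<alpha>)
    show "\<forall>j. - elapsed \<alpha> < j \<and> j < ahead \<alpha> \<longrightarrow> \<not> occ (base \<alpha>) j (pieces \<alpha>)"
    proof (intro allI impI)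
      fix j assume "- elapsed \<alpha> < j \<and> j < ahead \<alpha>"
      then have j: "- p < j" "j < q" by (simp_all add: \<alpha>)
      then show "\<not> occ (base \<alpha>) j (pieces \<alpha>)" using occ[of j w] no[OF j] by (simp add: \<alpha>)
    qed
    show "\<forall>w'. tame w' \<and> prior w' (base \<alpha>) \<longrightarrow> \<not> occ w' 0 (pieces \<alpha>)"
    proof (intro allI impI)
      fix w' assume w': "tame w' \<and> prior w' (base \<alpha>)"
      then have "prior w' w" by (simp add: \<alpha>)
      then have "window w' \<le> window w" by (auto simp: prior_def)
      then show "\<not> occ w' 0 (pieces \<alpha>)"
        using occ[of 0 w'] prior[of w'] w' pq \<open>prior w' w\<close> by simp
    qed
    show "\<forall>v. path_on E (- elapsed \<alpha> - window (base \<alpha>)) (ahead \<alpha> + window (base \<alpha>)) v \<and>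
        (\<forall>u\<in>pieces \<alpha>. rel_on R (- elapsed \<alpha> - window (base \<alpha>)) (ahead \<alpha> + window (base \<alpha>)) v u) \<longrightarrow>
        (\<exists>u\<in>pieces \<alpha>. \<forall>i\<in>{- elapsed \<alpha> - core (base \<alpha>)..ahead \<alpha> + core (base \<alpha>)}. v i = u i)"
      using exact by (simp add: \<alpha>)
  qed
  with at show ?thesis by simp
qed

text \<open>The vertices are read off the fibre separately at each time; they form a path because
  the last and the next occurrence change only when an occurrence is passed.\<close>

lemma fibre_path:
  assumes x0: "x0 \<in> XR" and w: "tame w"
    and past: "\<forall>N. \<exists>n\<le>N. occ w n (fib x0)" and future: "\<forall>N. \<exists>n\<ge>N. occ w n (fib x0)"
    and prior: "\<And>w' n. tame w' \<Longrightarrow> prior w' w \<Longrightarrow> \<not> occ w' n (fib x0)"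
  shows "\<exists>x. vpath x \<and> (\<forall>n. base (x n) = w \<and> at_vertex (x n) n (fib x0)) \<and> strands x = fib x0"
proof -
  let ?F = "fib x0"
  have "\<forall>n. \<exists>p. p \<ge> 0 \<and> occ w (n - p) ?F \<and> (\<forall>j. 0 \<le> j \<and> j < p \<longrightarrow> \<not> occ w (n - j) ?F)"
    using last_before[OF past] by (intro allI)
  from choice[OF this] obtain p where p': "\<forall>n. p n \<ge> 0 \<and> occ w (n - p n) ?F \<and>
    (\<forall>j. 0 \<le> j \<and> j < p n \<longrightarrow> \<not> occ w (n - j) ?F)" by (rule exE)
  then have p: "\<And>n. 0 \<le> p n" "\<And>n. occ w (n - p n) ?F"
    "\<And>n j. 0 \<le> j \<Longrightarrow> j < p n \<Longrightarrow> \<not> occ w (n - j) ?F" by simp_all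
  have "\<forall>n. \<exists>q. q \<ge> 1 \<and> occ w (n + q) ?F \<and> (\<forall>j. 1 \<le> j \<and> j < q \<longrightarrow> \<not> occ w (n + j) ?F)"
    using first_after[OF future] by (intro allI)
  from choice[OF this] obtain q where q': "\<forall>n. q n \<ge> 1 \<and> occ w (n + q n) ?F \<and>
    (\<forall>j. 1 \<le> j \<and> j < q n \<longrightarrow> \<not> occ w (n + j) ?F)" by (rule exE)
  then have q: "\<And>n. 1 \<le> q n" "\<And>n. occ w (n + q n) ?F"
    "\<And>n j. 1 \<le> j \<Longrightarrow> j < q n \<Longrightarrow> \<not> occ w (n + j) ?F" by simp_all
  define x where "x n = Vertex w (p n) (q n) ((\<lambda>z. restrict (sh n z) {- p n - window w..q n + window w}) ` ?F)" for n
  have no: "\<not> occ w (n + j) ?F" if "- p n < j" "j < q n" for n j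
    using p(3)[of "- j" n] q(3)[of j n] that by (cases "j \<le> 0") auto
  have v: "valid (x n) \<and> at_vertex (x n) n ?F" for n
    by (rule fibre_vertex[OF x0 w p(1) q(1) p(2) q(2) no prior x_def])
  have edge: "vedge (x n) (x (n + 1))" for n
    unfolding vedge_def
  proof (intro conjI impI)
    show "base (x (n + 1)) = base (x n)" by (simp add: x_def)
    assume "1 < ahead (x n)"
    then have q1: "1 < q n" by (simp add: x_def)
    have n1: "\<not> occ w (n + 1) ?F" using q(3)[of 1 n] q1 by simp
    have pn: "p (n + 1) = p n + 1"
    proof (rule antisym)
      show "p (n + 1) \<le> p n + 1"
        using p(2)[of n] p(3)[of "p n + 1" "n + 1"] p(1)[of n] by (auto simp: not_less[symmetric])
      show "p n + 1 \<le> p (n + 1)"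
      proof (rule ccontr)
        assume "\<not> p n + 1 \<le> p (n + 1)"
        moreover have "p (n + 1) \<noteq> 0" using p(2)[of "n + 1"] n1 by auto
        ultimately have "\<not> occ w (n - (p (n + 1) - 1)) ?F" using p(1)[of "n + 1"] by (intro p(3)) auto
        then show False using p(2)[of "n + 1"] by (simp add: algebra_simps)
      qed
    qed
    have qn: "q (n + 1) = q n - 1"
    proof (rule antisym)
      show "q (n + 1) \<le> q n - 1"
        using q(2)[of n] q(3)[of "q n - 1" "n + 1"] q1 by (auto simp: not_less[symmetric])
      show "q n - 1 \<le> q (n + 1)"
      proof (rule ccontr)
        assume "\<not> q n - 1 \<le> q (n + 1)"
        then have "\<not> occ w (n + (q (n + 1) + 1)) ?F" using q(1)[of "n + 1"] by (intro q(3)) auto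
        then show False using q(2)[of "n + 1"] by (simp add: algebra_simps)
      qed
    qed
    show "elapsed (x (n + 1)) = elapsed (x n) + 1" "ahead (x (n + 1)) = ahead (x n) - 1" using pn qn by (simp_all add: x_def)
    show "pieces (x (n + 1)) = sh 1 ` pieces (x n)"
    proof -
      have "{- (p n + 1) - window w..q n - 1 + window w} = {- p n - window w - 1..q n + window w - 1}"
        "n + 1 = 1 + n" by auto
      then show ?thesis unfolding x_def vertex.sel image_image pn qn sh_restrict sh_sh by (simp only:)
    qed
  next
    assume "ahead (x n) = 1"
    then have "occ w (n + 1) ?F" using q(2)[of n] by (simp add: x_def)
    then have "\<not> 0 < p (n + 1)" using p(3)[of 0 "n + 1"] by auto
    then show "elapsed (x (n + 1)) = 0" using p(1)[of "n + 1"] by (simp add: x_def)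
  qed
  have vp: "vpath x" using v edge by (simp add: vpath_def)
  \<comment> \<open>One strand is enough: \<open>fib_strand\<close> then identifies the whole fibre
    with the strands.\<close>
  have "x0 \<in> strands x"
    unfolding strands_def mem_Collect_eq
  proof
    fix n show "restrict (sh n x0) (placement (x n)) \<in> pieces (x n)"
      using v[of n] fib_self[OF x0] unfolding at_vertex_def by blast
  qed
  then have "strands x = ?F" using fib_strand[OF vp] by simp
  moreover have "base (x n) = w" for n by (simp add: x_def)
  ultimately show ?thesis using vp v by blast
qed

end

lemma path_on_mono: "path_on E a b v \<Longrightarrow> a \<le> a' \<Longrightarrow> b' \<le> b \<Longrightarrow> path_on E a' b' v"
  by (auto simp: path_on_def)

lemma rel_on_mono: "rel_on R a b u v \<Longrightarrow> a \<le> a' \<Longrightarrow> b' \<le> b \<Longrightarrow> rel_on R a' b' u v"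
  by (auto simp: rel_on_def)

context bowen_graph
begin

section \<open>Existence, countability and ordering of markers\<close>

lemma fib_separation:
  assumes x0: "x0 \<in> XR"
  shows "\<exists>r :: nat. \<forall>u\<in>fib x0. \<forall>v\<in>fib x0. (\<forall>i\<in>{- int r..int r}. u i = v i) \<longrightarrow> u = v"
proof -
  let ?F = "fib x0"
  have fin: "finite ?F" by (rule finite_fib[OF x0])
  \<comment> \<open>One coordinate of difference is chosen for each pair; there are finitely many
    pairs, so a common bound exists.\<close>
  define d where "d p = (SOME i. fst p i \<noteq> snd p i)" for p :: "(int \<Rightarrow> 'a) \<times> (int \<Rightarrow> 'a)"
  have "finite ((\<lambda>p. nat \<bar>d p\<bar>) ` (?F \<times> ?F))" using fin by simp
  then obtain r where r: "\<And>p. p \<in> ?F \<times> ?F \<Longrightarrow> nat \<bar>d p\<bar> \<le> r"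
    unfolding finite_nat_set_iff_bounded_le by blast
  have "u = v" if uv: "u \<in> ?F" "v \<in> ?F" "\<forall>i\<in>{- int r..int r}. u i = v i" for u v
  proof (rule ccontr)
    assume "u \<noteq> v"
    then have "\<exists>i. fst (u, v) i \<noteq> snd (u, v) i" by (auto simp: fun_eq_iff)
    then have "fst (u, v) (d (u, v)) \<noteq> snd (u, v) (d (u, v))" unfolding d_def by (rule someI_ex)
    then have "u (d (u, v)) \<noteq> v (d (u, v))" by simp
    moreover have "d (u, v) \<in> {- int r..int r}" using r[of "(u, v)"] uv by auto
    ultimately show False using uv(3) by blast
  qed
  then show ?thesis by (intro exI[of _ r] ballI impI)
qed

text \<open>The core radius \<open>r\<close> separates the strands. If no window radius
  \<open>s\<close> worked, the counterexamples would subconverge to a member of the fibre that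
  differs from all members of the fibre on \<open>{- r..r}\<close>.\<close>

lemma exists_marker:
  assumes x0: "x0 \<in> XR"
  shows "\<exists>w. tame w \<and> occ w 0 (fib x0)"
proof -
  let ?F = "fib x0"
  have fin: "finite ?F" by (rule finite_fib[OF x0])
  obtain r :: nat where "\<forall>u\<in>?F. \<forall>v\<in>?F. (\<forall>i\<in>{- int r..int r}. u i = v i) \<longrightarrow> u = v"
    using fib_separation[OF x0] by (rule exE)
  note sep = this[rule_format]
  have "\<exists>s\<ge>r. \<forall>v. path_on E (- int s) (int s) v \<and> (\<forall>z\<in>?F. rel_on R (- int s) (int s) v z) \<longrightarrow>
      (\<exists>z\<in>?F. \<forall>i\<in>{- int r..int r}. v i = z i)"
  proof (rule ccontr)
    assume "\<not> ?thesis"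
    then have "\<forall>s. \<exists>v. s \<ge> r \<longrightarrow> (path_on E (- int s) (int s) v \<and> (\<forall>z\<in>?F. rel_on R (- int s) (int s) v z) \<and>
      \<not> (\<exists>z\<in>?F. \<forall>i\<in>{- int r..int r}. v i = z i))" by blast
    from choice[OF this] obtain v where v: "\<forall>s. s \<ge> r \<longrightarrow>
        (path_on E (- int s) (int s) (v s) \<and> (\<forall>z\<in>?F. rel_on R (- int s) (int s) (v s) z) \<and>
      \<not> (\<exists>z\<in>?F. \<forall>i\<in>{- int r..int r}. v s i = z i))" by (rule exE)
    \<comment> \<open>Counterexamples exist only from radius \<open>r\<close> on; the maximum
      supplies one for every \<open>N\<close>, as compactness requires.\<close>
    define u where "u N = v (max N r)" for N
    have u: "path_on E (- int N) (int N) (u N) \<and> rel_on R (- int N) (int N) (u N) x0" for N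
    proof -
      have "path_on E (- int (max N r)) (int (max N r)) (u N) \<and>
          rel_on R (- int (max N r)) (int (max N r)) (u N) x0"
        using v[rule_format, of "max N r"] fib_self[OF x0] unfolding u_def by simp
      moreover have "- int (max N r) \<le> - int N" "int N \<le> int (max N r)" by simp_all
      ultimately show ?thesis by (meson path_on_mono rel_on_mono)
    qed
    obtain z where z: "z \<in> ?F" "\<forall>N. \<exists>M\<ge>N. \<forall>i. \<bar>i\<bar> \<le> int N \<longrightarrow> z i = u M i"
      using fib_compactness[OF u] by (rule bexE)
    obtain M where M: "M \<ge> r" "\<forall>i. \<bar>i\<bar> \<le> int r \<longrightarrow> z i = u M i" using z(2) by blast
    have "u M = v M" using M(1) by (simp add: u_def max_def)
    then have "\<forall>i\<in>{- int r..int r}. v M i = z i" using M(2) by (auto simp: abs_le_iff)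
    then show False using v[rule_format, OF M(1)] z(1) by blast
  qed
  then obtain s where s: "s \<ge> r" "\<And>v. path_on E (- int s) (int s) v \<Longrightarrow>
      (\<And>z. z \<in> ?F \<Longrightarrow> rel_on R (- int s) (int s) v z) \<Longrightarrow>
      \<exists>z\<in>?F. \<forall>i\<in>{- int r..int r}. v i = z i" by blast
  let ?f = "\<lambda>z. restrict z {- int s..int s}"
  define w where "w = Marker (int r) (int s) (?f ` ?F)"
  have sub: "{- int r..int r} \<subseteq> {- int s..int s}" using s(1) by auto
  have agree: "u i = v i" if "?f u = ?f v" "i \<in> {- int r..int r}" for u v :: "int \<Rightarrow> 'a" and i
    using that sub unfolding restrict_eq_iff by blast
  have inj: "inj_on ?f ?F"
    by (rule inj_onI, rule sep) (auto intro: agree)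
  have "tame w" unfolding tame_def
  proof (intro conjI)
    show "0 \<le> core w" "core w \<le> window w" "finite (words w)" "words w \<noteq> {}"
      using s(1) fin fib_self[OF x0] by (auto simp: w_def)
    show "words w \<subseteq> {- window w..window w} \<rightarrow>\<^sub>E A" by (auto simp: w_def fib_def XD(1))
    show "\<forall>u\<in>words w. \<forall>v\<in>words w. (\<forall>i\<in>{- core w..core w}. u i = v i) \<longrightarrow> u = v"
    proof (intro ballI impI)
      fix u v assume u: "u \<in> words w" and v: "v \<in> words w" and eq: "\<forall>i\<in>{- core w..core w}. u i = v i"
      obtain u' where u': "u' \<in> ?F" "u = ?f u'" using u by (auto simp: w_def)
      obtain v' where v': "v' \<in> ?F" "v = ?f v'" using v by (auto simp: w_def)
      have "u' = v'"
      proof (rule sep[OF u'(1) v'(1)])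
        fix i assume i: "i \<in> {- int r..int r}"
        then have "?f u' i = ?f v' i" using eq unfolding u'(2) v'(2) w_def marker.sel by blast
        then show "u' i = v' i" using i sub by (simp add: subset_iff)
      qed
      then show "u = v" using u' v' by simp
    qed
    show "\<forall>v. path_on E (- window w) (window w) v \<and> (\<forall>u\<in>words w. rel_on R (- window w) (window w) v u) \<longrightarrow>
        (\<exists>u\<in>words w. \<forall>i\<in>{- core w..core w}. v i = u i)"
    proof (intro allI impI, elim conjE)
      fix v assume p: "path_on E (- window w) (window w) v" and "\<forall>u\<in>words w. rel_on R (- window w) (window w) v u"
      then have "\<exists>z\<in>?F. \<forall>i\<in>{- int r..int r}. v i = z i"
        by (intro s(2)) (auto simp: w_def rel_on_def)
      then obtain z where z: "z \<in> ?F" "\<forall>i\<in>{- int r..int r}. v i = z i" by (rule bexE)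
      have "?f z \<in> words w" using z(1) by (simp add: w_def)
      moreover have "\<forall>i\<in>{- core w..core w}. v i = ?f z i" using z(2) sub by (simp add: w_def subset_iff)
      ultimately show "\<exists>u\<in>words w. \<forall>i\<in>{- core w..core w}. v i = u i" by (rule bexI[of _ "?f z", rotated])
    qed
  qed
  moreover have "occ w 0 ?F" unfolding occ_def using card_image[OF inj] by (simp add: w_def)
  ultimately show ?thesis by blast
qed

text \<open>Words and pieces are extensional, hence determined by finitely many letters of a
  countable alphabet.\<close>

lemma countable_finite_words: "countable {V. finite V \<and> V \<subseteq> (\<Union>a. \<Union>b. {a..b :: int} \<rightarrow>\<^sub>E A)}"
  by (intro countable_Collect_finite_subset countable_UN countable_PiE countableI_type finite_atLeastAtMost_int
      A_countable)

lemma countable_tame: "countable (Collect tame)"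
proof (rule countable_subset)
  let ?W = "{V. finite V \<and> V \<subseteq> (\<Union>a. \<Union>b. {a..b :: int} \<rightarrow>\<^sub>E A)}"
  show "Collect tame \<subseteq> (\<lambda>(r, s, W). Marker r s W) ` (UNIV \<times> UNIV \<times> ?W)"
  proof
    fix w assume "w \<in> Collect tame"
    then have "finite (words w)" "words w \<subseteq> {- window w..window w} \<rightarrow>\<^sub>E A" by (auto simp: tame_def)
    then have "words w \<in> ?W" by blast
    then show "w \<in> (\<lambda>(r, s, W). Marker r s W) ` (UNIV \<times> UNIV \<times> ?W)"
      by (intro image_eqI[of _ _ "(core w, window w, words w)"]) auto
  qed
  show "countable ((\<lambda>(r, s, W). Marker r s W) ` (UNIV \<times> UNIV \<times> ?W))"
    by (intro countable_image countable_SIGMA countableI_type countable_finite_words)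
qed

lemma countable_valid: "countable (Collect valid)"
proof (rule countable_subset)
  let ?W = "{V. finite V \<and> V \<subseteq> (\<Union>a. \<Union>b. {a..b :: int} \<rightarrow>\<^sub>E A)}"
  let ?S = "Collect tame \<times> UNIV \<times> UNIV \<times> ?W"
  show "Collect valid \<subseteq> (\<lambda>(w, p, q, V). Vertex w p q V) ` ?S"
  proof
    fix \<alpha> assume "\<alpha> \<in> Collect valid"
    then have v: "valid \<alpha>" by simp
    then have "finite (pieces \<alpha>)" "pieces \<alpha> \<subseteq> {- elapsed \<alpha> - window (base \<alpha>)..ahead \<alpha> + window (base \<alpha>)} \<rightarrow>\<^sub>E A"
      using valid_pieces_finite valid_pieces[OF v] by (auto simp: placement_def)
    then have "pieces \<alpha> \<in> ?W" by blast
    then show "\<alpha> \<in> (\<lambda>(w, p, q, V). Vertex w p q V) ` ?S"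
      using valid_tame[OF v] by (intro image_eqI[of _ _ "(base \<alpha>, elapsed \<alpha>, ahead \<alpha>, pieces \<alpha>)"]) auto
  qed
  show "countable ((\<lambda>(w, p, q, V). Vertex w p q V) ` ?S)"
    by (intro countable_image countable_SIGMA countableI_type countable_finite_words countable_tame)
qed

lemma prior_cases:
  assumes "tame w" "tame w'"
  obtains "prior w w'" | "prior w' w" | "w = w'"
proof -
  have "w = w'" if "code w = code w'"
    using that assms inj_on_to_nat_on[OF countable_tame] by (auto simp: code_def inj_on_def)
  then show ?thesis using that unfolding prior_def by (meson linorder_neqE)
qed

lemma exists_prior_minimal:
  assumes w: "tame w" "P w"
  shows "\<exists>w. tame w \<and> P w \<and> (\<forall>w'. tame w' \<and> prior w' w \<longrightarrow> \<not> P w')"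
proof -
  \<comment> \<open>Windows of tame markers are nonnegative, so \<open>nat\<close> preserves the
    order on them.\<close>
  define f where "f w = (nat (window w), code w)" for w :: "'a marker"
  have wf: "wf (inv_image (less_than <*lex*> less_than) f)" by (intro wf_inv_image wf_lex_prod wf_less_than)
  obtain m where m: "m \<in> {w. tame w \<and> P w}"
    "\<And>w'. (w', m) \<in> inv_image (less_than <*lex*> less_than) f \<Longrightarrow> w' \<notin> {w. tame w \<and> P w}"
    using wfE_min[OF wf, of w "{w. tame w \<and> P w}"] w by blast
  have "\<not> P w'" if w': "tame w'" "prior w' m" for w'
  proof -
    have "0 \<le> window w'" using tame_bounds[OF w'(1)] by linarith
    then have "(w', m) \<in> inv_image (less_than <*lex*> less_than) f"
      using w'(2) by (auto simp: f_def prior_def)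
    then show ?thesis using m(2) w' by blast
  qed
  then show ?thesis using m(1) by blast
qed

lemma at_vertex_occ:
  assumes v: "valid \<alpha>" and F: "at_vertex \<alpha> n F"
  shows "occ (base \<alpha>) (n - elapsed \<alpha>) F"
proof -
  have "occ (base \<alpha>) (- elapsed \<alpha>) (pieces \<alpha>) \<longleftrightarrow> occ (base \<alpha>) (n + - elapsed \<alpha>) F"
    by (rule occ_at_vertex[OF F]) (use valid_bounds[OF v] in \<open>auto simp: placement_def\<close>)
  then show ?thesis using valid_occ_elapsed[OF v] by simp
qed

text \<open>Validity bans prior markers only at the present time of a vertex, but along a path every
  time is the present of some vertex. The window fits because prior markers have no larger
  window.\<close>

lemma at_vertex_not_prior:
  assumes v: "valid \<alpha>" and F: "at_vertex \<alpha> n F" and w: "tame w" "prior w (base \<alpha>)"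
  shows "\<not> occ w n F"
proof -
  have "window w \<le> window (base \<alpha>)" using w(2) by (auto simp: prior_def)
  then have "occ w 0 (pieces \<alpha>) \<longleftrightarrow> occ w (n + 0) F"
    by (intro occ_at_vertex[OF F]) (use valid_bounds[OF v] in \<open>auto simp: placement_def\<close>)
  then show ?thesis using valid_not_prior[OF v w] by simp
qed

text \<open>If one base were prior to the other, its occurrence in the common fibre would violate
  the ban at the vertex of the other path at that time. With equal bases
  \<open>at_vertex_unique\<close> recovers each vertex.\<close>

lemma vpath_unique:
  assumes x: "vpath x" "vpath y" and eq: "strands x = strands y"
  shows "x = y"
proof -
  have not_prior: "\<not> prior (base (a 0)) (base (b 0))" if ab: "vpath a" "vpath b" "strands a = strands b" for a b
  proof
    assume pr: "prior (base (a 0)) (base (b 0))"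
    let ?m = "0 - elapsed (a 0)"
    have "occ (base (a 0)) ?m (strands b)"
      using at_vertex_occ[OF vpathD(1)[OF ab(1)] at_vertex_strands[OF ab(1)]] unfolding ab(3) .
    moreover have "\<not> occ (base (a 0)) ?m (strands b)"
      by (rule at_vertex_not_prior[OF vpathD(1)[OF ab(2)] at_vertex_strands[OF ab(2)]
            valid_tame[OF vpathD(1)[OF ab(1)]]]) (use pr vpath_base[OF ab(2), of ?m] in simp)
    ultimately show False by blast
  qed
  have base: "base (x 0) = base (y 0)"
    using prior_cases[OF valid_tame[OF vpathD(1)[OF x(1), of 0]] valid_tame[OF vpathD(1)[OF x(2), of 0]]]
      not_prior[OF x eq] not_prior[OF x(2,1) eq[symmetric]] by blast
  show ?thesis
  proof
    fix n
    have "base (x n) = base (y n)" using base vpath_base[OF x(1), of n] vpath_base[OF x(2), of n] by simp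
    then show "x n = y n"
      using at_vertex_strands[OF x(1), of n] at_vertex_strands[OF x(2), of n] eq vpathD(1)[OF x(1), of n]
        vpathD(1)[OF x(2), of n] by (intro at_vertex_unique[of "x n" "y n" n "strands x"]) simp_all
  qed
qed

text \<open>The strand to follow is selected at time \<open>0\<close>, which makes the map 1-Lipschitz but prevents it
  from commuting with the shift.\<close>

definition strand :: "(int \<Rightarrow> 'a vertex) \<Rightarrow> int \<Rightarrow> 'a" where
  "strand x = (SOME z. z \<in> strands x \<and> restrict z (placement (x 0)) = (SOME v. v \<in> pieces (x 0)))"

lemma strand:
  assumes x: "vpath x"
  shows "strand x \<in> strands x" "restrict (strand x) (placement (x 0)) = (SOME v. v \<in> pieces (x 0))"
proof -
  have "(SOME v. v \<in> pieces (x 0)) \<in> pieces (x 0)"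
    using valid_pieces_finite[OF vpathD(1)[OF x, of 0]] by (simp add: some_in_eq)
  from strand_through_0[OF x this]
  have "\<exists>z. z \<in> strands x \<and> restrict z (placement (x 0)) = (SOME v. v \<in> pieces (x 0))" by blast
  from someI_ex[OF this] show "strand x \<in> strands x" "restrict (strand x) (placement (x 0)) = (SOME v. v \<in> pieces (x 0))"
    unfolding strand_def by simp_all
qed

text \<open>The initial piece depends on the vertex at time 0 alone, so paths that agree near 0
  start their strands from the same piece.\<close>

lemma strand_lipschitz:
  assumes x: "vpath x" "vpath y"
  shows "sdist (strand x) (strand y) \<le> sdist x y"
proof (rule sdist_le_if_agree)
  fix N :: nat and i :: int
  assume eq: "\<And>i. \<bar>i\<bar> \<le> int N \<Longrightarrow> x i = y i" and i: "\<bar>i\<bar> \<le> int N"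
  have "x 0 = y 0" by (rule eq) simp
  then show "strand x i = strand y i"
    using strand(2)[OF x(1)] strand(2)[OF x(2)]
    by (intro strands_agree_at[OF x strand(1)[OF x(1)] strand(1)[OF x(2)] eq _ i]) simp_all
qed

definition coding_vertices :: "'a vertex set" where
  "coding_vertices = Collect valid"

definition coding_edges :: "('a vertex \<times> 'a vertex) set" where
  "coding_edges = {(\<alpha>, \<beta>). valid \<alpha> \<and> valid \<beta> \<and> vedge \<alpha> \<beta>}"

lemma coding_graph: "alphabet_graph coding_vertices coding_edges"
  using countable_valid by (auto simp: alphabet_graph_def coding_vertices_def coding_edges_def)

lemma coding_shift: "markov_shift coding_vertices coding_edges = Collect vpath"
  by (auto simp: markov_shift_def coding_vertices_def coding_edges_def vpath_def)

text \<open>Describes the fibres of regular paths without mentioning paths: countably many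
  occurrence conditions on the fibre, and therefore a Borel condition.\<close>

definition coded_by :: "'a vertex \<Rightarrow> 'a vertex \<Rightarrow> (int \<Rightarrow> 'a) set \<Rightarrow> bool" where
  "coded_by \<alpha> \<beta> F \<longleftrightarrow> (\<forall>N. \<exists>n\<le>N. at_vertex \<alpha> n F) \<and> (\<forall>N. \<exists>n\<ge>N. at_vertex \<beta> n F) \<and>
     (\<forall>w. tame w \<and> prior w (base \<alpha>) \<longrightarrow> (\<forall>n. \<not> occ w n F))"

text \<open>Conversely, recurrence of the two vertices makes the marker recur on both sides, so
  \<open>fibre_path\<close> yields a path, and by \<open>at_vertex_unique\<close> it visits these
  vertices at the times when the fibre shows them.\<close>

lemma fib_coded_iff:
  assumes x0: "x0 \<in> XR"
  shows "(\<exists>x\<in>regular_part coding_vertices coding_edges. strands x = fib x0) \<longleftrightarrow>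
    (\<exists>\<alpha> \<beta>. valid \<alpha> \<and> valid \<beta> \<and> base \<beta> = base \<alpha> \<and> coded_by \<alpha> \<beta> (fib x0))"
proof
  assume "\<exists>x\<in>regular_part coding_vertices coding_edges. strands x = fib x0"
  then obtain x where x: "x \<in> regular_part coding_vertices coding_edges" "strands x = fib x0" by blast
  then obtain \<alpha> \<beta> where vp: "vpath x" and rec: "\<And>N. \<exists>n\<le>N. x n = \<alpha>" "\<And>N. \<exists>n\<ge>N. x n = \<beta>"
    unfolding regular_part_iff coding_shift by blast
  obtain a b where ab: "x a = \<alpha>" "x b = \<beta>" using rec[of 0] by blast
  have at: "at_vertex (x n) n (fib x0)" for n using at_vertex_strands[OF vp] x(2) by simp
  have base: "base (x n) = base \<alpha>" for n using vpath_base[OF vp, of n] vpath_base[OF vp, of a] ab by simp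
  have "coded_by \<alpha> \<beta> (fib x0)" unfolding coded_by_def
  proof (intro conjI allI impI, goal_cases)
    case (1 N)
    then show ?case using rec(1)[of N] at by metis
  next
    case (2 N)
    then show ?case using rec(2)[of N] at by metis
  next
    case (3 w n)
    then show ?case using at_vertex_not_prior[OF vpathD(1)[OF vp] at, of w n] base by simp
  qed
  moreover have "valid \<alpha>" "valid \<beta>" "base \<beta> = base \<alpha>"
    using vpathD(1)[OF vp, of a] vpathD(1)[OF vp, of b] base[of b] ab by auto
  ultimately show "\<exists>\<alpha> \<beta>. valid \<alpha> \<and> valid \<beta> \<and> base \<beta> = base \<alpha> \<and> coded_by \<alpha> \<beta> (fib x0)" by blast
next
  assume "\<exists>\<alpha> \<beta>. valid \<alpha> \<and> valid \<beta> \<and> base \<beta> = base \<alpha> \<and> coded_by \<alpha> \<beta> (fib x0)"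
  then obtain \<alpha> \<beta> where v: "valid \<alpha>" "valid \<beta>" "base \<beta> = base \<alpha>" and c: "coded_by \<alpha> \<beta> (fib x0)" by blast
  have past: "\<exists>n\<le>N. occ (base \<alpha>) n (fib x0)" for N
  proof -
    obtain n where n: "n \<le> N" "at_vertex \<alpha> n (fib x0)" using c unfolding coded_by_def by blast
    show ?thesis using at_vertex_occ[OF v(1) n(2)] n(1) valid_elapsed[OF v(1)]
      by (intro exI[of _ "n - elapsed \<alpha>"]) simp
  qed
  have future: "\<exists>n\<ge>N. occ (base \<alpha>) n (fib x0)" for N
  proof -
    \<comment> \<open>The occurrence to be used lies \<open>elapsed \<beta>\<close> before
      \<open>n\<close>, hence the reserve.\<close>
    obtain n where n: "n \<ge> N + elapsed \<beta>" "at_vertex \<beta> n (fib x0)" using c unfolding coded_by_def by blast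
    show ?thesis using at_vertex_occ[OF v(2) n(2)] n(1) v(3)
      by (intro exI[of _ "n - elapsed \<beta>"]) simp
  qed
  have np: "\<not> occ w n (fib x0)" if "tame w" "prior w (base \<alpha>)" for w n
    using c that unfolding coded_by_def by blast
  obtain x where x: "vpath x" "\<And>n. base (x n) = base \<alpha>" "\<And>n. at_vertex (x n) n (fib x0)" "strands x = fib x0"
    using fibre_path[OF x0 valid_tame[OF v(1)] allI[OF past] allI[OF future] np] by blast
  have eq: "x n = \<gamma>" if "valid \<gamma>" "base \<gamma> = base \<alpha>" "at_vertex \<gamma> n (fib x0)" for \<gamma> n
    using that x(2)[of n] by (intro at_vertex_unique[OF vpathD(1)[OF x(1)] that(1) _ x(3) that(3)]) simp
  have "\<exists>n\<le>N. x n = \<alpha>" "\<exists>n\<ge>N. x n = \<beta>" for N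
    using c eq[OF v(1) refl] eq[OF v(2,3)] unfolding coded_by_def by metis+
  then have "x \<in> regular_part coding_vertices coding_edges"
    using x(1) unfolding regular_part_iff coding_shift by blast
  then show "\<exists>x\<in>regular_part coding_vertices coding_edges. strands x = fib x0" using x(4) by blast
qed

end

subsection \<open>Measurability and recurrence\<close>

lemma emeasure_vimage_invariant:
  assumes \<mu>: "ergodic_invariant_prob Y T \<mu>" and T: "T \<in> measurable Y Y" and C: "C \<in> sets Y"
  shows "emeasure \<mu> (T -` C \<inter> space Y) = emeasure \<mu> C"
proof -
  have s: "sets \<mu> = sets Y" and d: "distr \<mu> Y T = \<mu>"
    using \<mu> by (simp_all add: ergodic_invariant_prob_def)
  have "T \<in> measurable \<mu> Y" using T measurable_cong_sets[OF s refl] by blast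
  from emeasure_distr[OF this C] show ?thesis
    unfolding d sets_eq_imp_space_eq[OF s] by simp
qed

text \<open>Continuity from above gives the intersection the measure \<open>c\<close>, and
  ergodicity allows only 0 or 1.\<close>

lemma full_of_decreasing:
  fixes C :: "nat \<Rightarrow> 'y set"
  assumes \<mu>: "ergodic_invariant_prob Y T \<mu>"
    and C: "\<And>k. C k \<in> sets Y" "decseq C" "\<And>k. emeasure \<mu> (C k) = c" "c \<noteq> 0"
    and inv: "T -` (\<Inter>k. C k) \<inter> space Y = (\<Inter>k. C k)"
  shows "emeasure \<mu> (\<Inter>k. C k) = 1"
proof -
  have s: "sets \<mu> = sets Y" and p: "prob_space \<mu>" using \<mu> by (simp_all add: ergodic_invariant_prob_def)
  interpret prob_space \<mu> by (rule p)
  have "(INF k. emeasure \<mu> (C k)) = emeasure \<mu> (\<Inter>k. C k)"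
    using C(1,2) s by (intro INF_emeasure_decseq) auto
  then have "emeasure \<mu> (\<Inter>k. C k) = c" using C(3) by simp
  moreover have "(\<Inter>k. C k) \<in> sets Y" by (rule sets.countable_INT') (use C(1) in auto)
  ultimately show ?thesis using \<mu> inv C(4) unfolding ergodic_invariant_prob_def by blast
qed

text \<open>Preimages under \<open>T\<close> carry each tail union to the next one, so all the
  forward unions have the same positive measure, as have the backward ones; their intersections are
  invariant.\<close>

lemma recurrence:
  fixes B :: "int \<Rightarrow> 'y set"
  assumes \<mu>: "ergodic_invariant_prob Y T \<mu>" and T: "T \<in> measurable Y Y"
    and B: "\<And>n. B n \<in> sets Y" "\<And>n. T -` B n \<inter> space Y = B (n + 1)" "emeasure \<mu> (B 0) \<noteq> 0"
  shows "AE y in \<mu>. (\<forall>N. \<exists>n\<le>N. y \<in> B n) \<and> (\<forall>N. \<exists>n\<ge>N. y \<in> B n)"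
proof -
  have s: "sets \<mu> = sets Y" and p: "prob_space \<mu>" using \<mu> by (simp_all add: ergodic_invariant_prob_def)
  interpret prob_space \<mu> by (rule p)
  have T_UN: "T -` (\<Union>n\<in>I. B n) \<inter> space Y = (\<Union>n\<in>I. B (n + 1))" for I
    using B(2) by blast
  have UN: "(\<Union>n\<in>I. B n) \<in> sets Y" for I
    by (rule sets.countable_UN') (use B(1) in auto)
  define U where "U N = (\<Union>n\<in>{N..}. B n)" for N :: int
  define V where "V N = (\<Union>n\<in>{..N}. B n)" for N :: int
  have shift: "(\<Union>n\<in>{N..}. B (n + 1)) = U (N + 1)" "(\<Union>n\<in>{..N}. B (n + 1)) = V (N + 1)" for N
  proof -
    have "(\<lambda>n. n + 1) ` {N..} = {N + 1..}" "(\<lambda>n. n + 1) ` {..N} = {..N + 1}"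
      by (auto simp: image_iff intro!: bexI[of _ "_ - 1"])
    then show "(\<Union>n\<in>{N..}. B (n + 1)) = U (N + 1)" "(\<Union>n\<in>{..N}. B (n + 1)) = V (N + 1)"
      unfolding U_def V_def by (metis image_image)+
  qed
  have TU: "T -` U N \<inter> space Y = U (N + 1)" for N using T_UN[of "{N..}"] shift by (simp add: U_def)
  have TV: "T -` V N \<inter> space Y = V (N + 1)" for N using T_UN[of "{..N}"] shift by (simp add: V_def)
  have sU: "U N \<in> sets Y" "V N \<in> sets Y" for N unfolding U_def V_def by (rule UN)+
  have eU: "emeasure \<mu> (U N) = emeasure \<mu> (U 0)" for N
    by (rule int_constant[of "\<lambda>N. emeasure \<mu> (U N)"])
      (use emeasure_vimage_invariant[OF \<mu> T sU(1)] TU in simp)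
  have eV: "emeasure \<mu> (V N) = emeasure \<mu> (V 0)" for N
    by (rule int_constant[of "\<lambda>N. emeasure \<mu> (V N)"])
      (use emeasure_vimage_invariant[OF \<mu> T sU(2)] TV in simp)
  have pos: "emeasure \<mu> (U 0) \<noteq> 0" "emeasure \<mu> (V 0) \<noteq> 0"
  proof -
    have "B 0 \<subseteq> U 0" "B 0 \<subseteq> V 0" unfolding U_def V_def by auto
    then show "emeasure \<mu> (U 0) \<noteq> 0" "emeasure \<mu> (V 0) \<noteq> 0"
      using B(3) emeasure_mono[of "B 0" "U 0" \<mu>] emeasure_mono[of "B 0" "V 0" \<mu>] sU s by auto
  qed
  have anti: "U N' \<subseteq> U N" if "N \<le> N'" for N N' using that unfolding U_def by (intro UN_mono) auto
  have mono: "V N \<subseteq> V N'" if "N \<le> N'" for N N' using that unfolding V_def by (intro UN_mono) auto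
  have "T -` (\<Inter>k. U (int k)) \<inter> space Y = (\<Inter>k. U (int k))"
  proof -
    have "T -` (\<Inter>k. U (int k)) \<inter> space Y = (\<Inter>k. T -` U (int k) \<inter> space Y)" by blast
    also have "\<dots> = (\<Inter>k. U (int k + 1))" by (simp only: TU)
    also have "\<dots> = (\<Inter>k. U (int k))"
    proof (intro equalityI INT_greatest)
      fix k
      have "(\<Inter>k. U (int k + 1)) \<subseteq> U (int k + 1)" by (rule INF_lower) simp
      then show "(\<Inter>k. U (int k + 1)) \<subseteq> U (int k)" using anti[of "int k" "int k + 1"] by simp
      have "(\<Inter>k. U (int k)) \<subseteq> U (int (Suc k))" by (rule INF_lower) simp
      then show "(\<Inter>k. U (int k)) \<subseteq> U (int k + 1)" by (simp add: add.commute)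
    qed
    finally show ?thesis .
  qed
  then have 1: "emeasure \<mu> (\<Inter>k. U (int k)) = 1"
    by (intro full_of_decreasing[OF \<mu> sU(1) _ eU pos(1)]) (auto simp: decseq_def intro!: anti)
  have "T -` (\<Inter>k. V (- int k)) \<inter> space Y = (\<Inter>k. V (- int k))"
  proof -
    have "T -` (\<Inter>k. V (- int k)) \<inter> space Y = (\<Inter>k. T -` V (- int k) \<inter> space Y)" by blast
    also have "\<dots> = (\<Inter>k. V (- int k + 1))" by (simp only: TV)
    also have "\<dots> = (\<Inter>k. V (- int k))"
    proof (intro equalityI INT_greatest)
      fix k
      have "(\<Inter>k. V (- int k + 1)) \<subseteq> V (- int (Suc k) + 1)" by (rule INF_lower) simp
      then show "(\<Inter>k. V (- int k + 1)) \<subseteq> V (- int k)" by simp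
      have "(\<Inter>k. V (- int k)) \<subseteq> V (- int k)" by (rule INF_lower) simp
      then show "(\<Inter>k. V (- int k)) \<subseteq> V (- int k + 1)" using mono[of "- int k" "- int k + 1"] by simp
    qed
    finally show ?thesis .
  qed
  then have 2: "emeasure \<mu> (\<Inter>k. V (- int k)) = 1"
    by (intro full_of_decreasing[OF \<mu> sU(2) _ eV pos(2)]) (auto simp: decseq_def intro!: mono)
  have m: "(\<Inter>k. U (int k)) \<in> sets \<mu>" "(\<Inter>k. V (- int k)) \<in> sets \<mu>"
    unfolding s by (rule sets.countable_INT'; use sU in auto)+
  have "prob (\<Inter>k. U (int k)) = 1" "prob (\<Inter>k. V (- int k)) = 1"
    using 1 2 by (simp_all add: emeasure_eq_measure)
  then have "AE y in \<mu>. y \<in> (\<Inter>k. U (int k))" "AE y in \<mu>. y \<in> (\<Inter>k. V (- int k))"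
    by (simp_all only: AE_in_set_eq_1[OF m(1)] AE_in_set_eq_1[OF m(2)])
  then show ?thesis
  proof eventually_elim
    case (elim y)
    show ?case
    proof (intro conjI allI)
      fix N :: int
      have "y \<in> V (- int (nat (- N)))" using elim(2) by blast
      then obtain n where "n \<le> - int (nat (- N))" "y \<in> B n" unfolding V_def by blast
      then show "\<exists>n\<le>N. y \<in> B n" by (intro exI[of _ n]) (auto split: if_splits)
      have "y \<in> U (int (nat N))" using elim(1) by blast
      then obtain n where "n \<ge> int (nat N)" "y \<in> B n" unfolding U_def by blast
      then show "\<exists>n\<ge>N. y \<in> B n" by (intro exI[of _ n]) (auto split: if_splits)
    qed
  qed
qed

context bowen_graph
begin

section \<open>Fibre conditions are Borel on the regular part\<close>

lemma symbol_measurable: "{x \<in> XR. x n = a} \<in> sets (symbolic_borel XR)"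
proof -
  interpret Metric_space XR sdist by (rule Metric_space_sdist)
  have "openin mtopology {x \<in> XR. x n = a}"
    unfolding openin_mtopology
  proof (intro conjI allI impI)
    fix x assume x: "x \<in> {x \<in> XR. x n = a}"
    have "mball x (exp (- real (nat \<bar>n\<bar> + 1))) \<subseteq> {x \<in> XR. x n = a}"
    proof
      fix y assume "y \<in> mball x (exp (- real (nat \<bar>n\<bar> + 1)))"
      then have y: "y \<in> XR" "sdist x y \<le> exp (- real (nat \<bar>n\<bar> + 1))" by auto
      have "x n = y n" by (rule sdist_agree[OF y(2)]) simp
      then show "y \<in> {x \<in> XR. x n = a}" using x y by simp
    qed
    then show "\<exists>r>0. mball x r \<subseteq> {x \<in> XR. x n = a}" by (intro exI[of _ "exp (- real (nat \<bar>n\<bar> + 1))"] conjI) simp_all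
  qed auto
  then show ?thesis unfolding sets_symbolic_borel by auto
qed

lemmas collect_Ex = sets.sets_Collect_countable_Ex'[where M = "symbolic_borel XR", unfolded space_symbolic_borel]
lemmas collect_All = sets.sets_Collect_countable_All'[where M = "symbolic_borel XR", unfolded space_symbolic_borel]
lemmas collect_conj = sets.sets_Collect_conj[where M = "symbolic_borel XR", unfolded space_symbolic_borel]
lemmas collect_neg = sets.sets_Collect_neg[where M = "symbolic_borel XR", unfolded space_symbolic_borel]

text \<open>The predicate may be arbitrary, because a finite window over a countable alphabet takes
  countably many values.\<close>

lemma window_measurable: "{x \<in> XR. P (restrict x {a..b})} \<in> sets (symbolic_borel XR)"
proof -
  let ?S = "{u \<in> {a..b} \<rightarrow>\<^sub>E A. P u}"
  have "{x \<in> XR. P (restrict x {a..b})} = {x \<in> XR. \<exists>u\<in>?S. \<forall>i\<in>{a..b}. x i = u i}"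
  proof (intro Collect_cong conj_cong refl)
    fix x assume "x \<in> XR"
    then have xA: "restrict x {a..b} \<in> {a..b} \<rightarrow>\<^sub>E A" using XD(1)[OF XR_X] by auto
    show "P (restrict x {a..b}) \<longleftrightarrow> (\<exists>u\<in>?S. \<forall>i\<in>{a..b}. x i = u i)"
    proof
      assume "P (restrict x {a..b})"
      then show "\<exists>u\<in>?S. \<forall>i\<in>{a..b}. x i = u i"
        using xA by (intro bexI[of _ "restrict x {a..b}"] ballI CollectI conjI) (simp_all only: restrict_apply if_True)
    next
      assume "\<exists>u\<in>?S. \<forall>i\<in>{a..b}. x i = u i"
      then obtain u where u: "u \<in> ?S" "\<forall>i\<in>{a..b}. x i = u i" by (rule bexE)
      then have "restrict x {a..b} = u"
        by (intro extensionalityI[of _ "{a..b}"]) (auto simp: PiE_def)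
      then show "P (restrict x {a..b})" using u(1) by simp
    qed
  qed
  also have "countable ({a..b} \<rightarrow>\<^sub>E A)" by (intro countable_PiE A_countable) simp
  then have "countable ?S" by (rule countable_subset[rotated]) auto
  then have "{x \<in> XR. \<exists>u\<in>?S. \<forall>i\<in>{a..b}. x i = u i} \<in> sets (symbolic_borel XR)"
    by (intro collect_Ex collect_All symbol_measurable countableI_type)
  finally show ?thesis .
qed

text \<open>Compactness replaces the existence of a fibre point by countably many conditions on
  finite windows of \<open>x\<close>. This makes the condition Borel, where a projection would only
  give an analytic set.\<close>

lemma fib_word_iff:
  assumes V: "V \<in> extensional {a..b}"
  shows "(\<exists>z\<in>fib x. restrict z {a..b} = V) \<longleftrightarrow>
    (\<forall>N :: nat. \<exists>v. path_on E (- int N) (int N) v \<and> rel_on R (- int N) (int N) v x \<and>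
       (\<forall>i\<in>{a..b} \<inter> {- int N..int N}. v i = V i))"
proof
  assume "\<exists>z\<in>fib x. restrict z {a..b} = V"
  then obtain z where z: "z \<in> fib x" "restrict z {a..b} = V" by blast
  have "path_on E (- int N) (int N) z \<and> rel_on R (- int N) (int N) z x \<and>
      (\<forall>i\<in>{a..b} \<inter> {- int N..int N}. z i = V i)" for N
    using z by (auto simp: fib_def rel_on_def path_on_X)
  then show "\<forall>N :: nat. \<exists>v. path_on E (- int N) (int N) v \<and> rel_on R (- int N) (int N) v x \<and>
       (\<forall>i\<in>{a..b} \<inter> {- int N..int N}. v i = V i)" by blast
next
  assume "\<forall>N :: nat. \<exists>v. path_on E (- int N) (int N) v \<and> rel_on R (- int N) (int N) v x \<and>
       (\<forall>i\<in>{a..b} \<inter> {- int N..int N}. v i = V i)"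
  from choice[OF this] obtain v where v: "\<forall>N :: nat. path_on E (- int N) (int N) (v N) \<and>
      rel_on R (- int N) (int N) (v N) x \<and> (\<forall>i\<in>{a..b} \<inter> {- int N..int N}. v N i = V i)" by (rule exE)
  obtain z where z: "z \<in> fib x" "\<forall>N. \<exists>M\<ge>N. \<forall>i. \<bar>i\<bar> \<le> int N \<longrightarrow> z i = v M i"
    using fib_compactness[of v x] v by blast
  have "z i = V i" if i: "i \<in> {a..b}" for i
  proof -
    obtain M where M: "M \<ge> nat \<bar>i\<bar>" "\<forall>j. \<bar>j\<bar> \<le> int (nat \<bar>i\<bar>) \<longrightarrow> z j = v M j" using z(2) by blast
    have "i \<in> {- int M..int M}" using M(1) by auto
    then have "v M i = V i" using v i by blast
    moreover have "z i = v M i" using M(2) by simp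
    ultimately show ?thesis by simp
  qed
  then have "restrict z {a..b} = V" using V by (intro extensionalityI[of _ "{a..b}"]) auto
  with z(1) show "\<exists>z\<in>fib x. restrict z {a..b} = V" by blast
qed

lemma fib_word_measurable:
  "{x \<in> XR. \<exists>z\<in>fib x. restrict z {a..b} = V} \<in> sets (symbolic_borel XR)"
proof (cases "V \<in> extensional {a..b}")
  case True
  have "{x \<in> XR. \<exists>v. path_on E (- int N) (int N) v \<and> rel_on R (- int N) (int N) v x \<and>
       (\<forall>i\<in>{a..b} \<inter> {- int N..int N}. v i = V i)} \<in> sets (symbolic_borel XR)" for N
  proof -
    have "rel_on R (- int N) (int N) v x \<longleftrightarrow> rel_on R (- int N) (int N) v (restrict x {- int N..int N})" for v x
      by (simp add: rel_on_def)
    then show ?thesis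
      using window_measurable[of "\<lambda>y. \<exists>v. path_on E (- int N) (int N) v \<and> rel_on R (- int N) (int N) v y \<and>
        (\<forall>i\<in>{a..b} \<inter> {- int N..int N}. v i = V i)" "- int N" "int N"] by simp
  qed
  then have "{x \<in> XR. \<forall>N\<in>UNIV :: nat set. \<exists>v. path_on E (- int N) (int N) v \<and> rel_on R (- int N) (int N) v x \<and>
       (\<forall>i\<in>{a..b} \<inter> {- int N..int N}. v i = V i)} \<in> sets (symbolic_borel XR)"
    by (intro collect_All) simp_all
  then show ?thesis unfolding fib_word_iff[OF True] by simp
next
  case False
  then have "{x \<in> XR. \<exists>z\<in>fib x. restrict z {a..b} = V} = {}"
    using restrict_extensional by blast
  then show ?thesis by (simp only: sets.empty_sets)
qed

text \<open>On a finite window a finite fibre shows one of countably many finite sets of words, and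
  such a set is recognised word by word.\<close>

lemma fib_window_measurable:
  "{x \<in> XR. Q ((\<lambda>z. restrict z {a..b}) ` fib x)} \<in> sets (symbolic_borel XR)"
proof -
  let ?W = "{a..b} \<rightarrow>\<^sub>E A"
  let ?S = "{V. finite V \<and> V \<subseteq> ?W} \<inter> {V. Q V}"
  let ?f = "\<lambda>x. (\<lambda>z. restrict z {a..b}) ` fib x"
  have W: "countable ?W" by (intro countable_PiE A_countable) simp
  have fW: "?f x \<subseteq> ?W" for x by (auto simp: fib_def XD(1))
  have "{x \<in> XR. Q (?f x)} = {x \<in> XR. \<exists>V\<in>?S. \<forall>u\<in>?W. (u \<in> V) \<longleftrightarrow> (\<exists>z\<in>fib x. restrict z {a..b} = u)}"
  proof (intro Collect_cong conj_cong refl)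
    fix x assume x: "x \<in> XR"
    have word: "u \<in> ?f x \<longleftrightarrow> (\<exists>z\<in>fib x. restrict z {a..b} = u)" for u
      unfolding image_iff by (simp only: eq_commute[of u])
    show "Q (?f x) \<longleftrightarrow> (\<exists>V\<in>?S. \<forall>u\<in>?W. (u \<in> V) \<longleftrightarrow> (\<exists>z\<in>fib x. restrict z {a..b} = u))"
      unfolding word[symmetric]
    proof
      assume "Q (?f x)"
      moreover have "finite (?f x)" using finite_fib[OF x] by simp
      ultimately have "?f x \<in> ?S" using fW[of x] by (intro IntI CollectI conjI)
      then show "\<exists>V\<in>?S. \<forall>u\<in>?W. (u \<in> V) \<longleftrightarrow> (u \<in> ?f x)" by (intro bexI[of _ "?f x"] ballI refl)
    next
      assume "\<exists>V\<in>?S. \<forall>u\<in>?W. (u \<in> V) \<longleftrightarrow> (u \<in> ?f x)"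
      then obtain V where V: "V \<in> ?S" "\<forall>u\<in>?W. (u \<in> V) \<longleftrightarrow> (u \<in> ?f x)" by (rule bexE)
      have "V \<subseteq> ?W" "Q V" using V(1) by simp_all
      moreover from this have "V = ?f x" using V(2) fW[of x] by (intro set_eqI) (meson subsetD)
      ultimately show "Q (?f x)" by simp
    qed
  qed
  moreover have "{x \<in> XR. (u \<in> V) \<longleftrightarrow> (\<exists>z\<in>fib x. restrict z {a..b} = u)} \<in> sets (symbolic_borel XR)" for u V
    using fib_word_measurable[of a b u] collect_neg[OF fib_word_measurable[of a b u]] by (cases "u \<in> V") simp_all
  moreover have "countable ?S"
    by (rule countable_subset[OF Int_lower1]) (intro countable_Collect_finite_subset W)
  ultimately show ?thesis using W by (simp only:) (intro collect_Ex collect_All)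
qed

text \<open>No window sees more strands than there are, and a large one separates them all; the
  cardinality thus becomes a condition on windows.\<close>

lemma card_fib_iff:
  assumes x: "x \<in> XR"
  shows "card (fib x) = k \<longleftrightarrow>
    (\<forall>N :: nat. card ((\<lambda>z. restrict z {- int N..int N}) ` fib x) \<le> k) \<and>
    (\<exists>N :: nat. card ((\<lambda>z. restrict z {- int N..int N}) ` fib x) = k)"
proof -
  let ?c = "\<lambda>N :: nat. card ((\<lambda>z. restrict z {- int N..int N}) ` fib x)"
  have le: "?c N \<le> card (fib x)" for N by (rule card_image_le[OF finite_fib[OF x]])
  obtain r :: nat where r: "\<forall>u\<in>fib x. \<forall>v\<in>fib x. (\<forall>i\<in>{- int r..int r}. u i = v i) \<longrightarrow> u = v"
    using fib_separation[OF x] by (rule exE)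
  have "inj_on (\<lambda>z. restrict z {- int r..int r}) (fib x)"
    using r unfolding inj_on_def restrict_eq_iff by blast
  then have "?c r = card (fib x)" by (rule card_image)
  with le show ?thesis by (metis le_antisym)
qed

lemma card_fib_measurable: "{x \<in> XR. card (fib x) = k} \<in> sets (symbolic_borel XR)"
proof -
  let ?c = "\<lambda>N x. card ((\<lambda>z. restrict z {- int N..int N}) ` fib x)"
  have eq: "{x \<in> XR. card (fib x) = k} =
      {x \<in> XR. (\<forall>N\<in>UNIV. ?c N x \<le> k) \<and> (\<exists>N\<in>UNIV. ?c N x = k)}"
    using card_fib_iff by auto
  show ?thesis unfolding eq
    by (intro collect_conj collect_All collect_Ex countableI_type
        fib_window_measurable[where Q = "\<lambda>V. card V \<le> k"] fib_window_measurable[where Q = "\<lambda>V. card V = k"])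
qed

lemma shifted_window_measurable:
  "{x \<in> XR. card (fib x) = k \<and> (\<lambda>z. restrict (sh n z) {a..b}) ` fib x = V} \<in> sets (symbolic_borel XR)"
proof -
  have "(\<lambda>z. restrict (sh n z) {a..b}) ` F = sh n ` (\<lambda>z. restrict z {a + n..b + n}) ` F" for F :: "(int \<Rightarrow> 'a) set"
    unfolding image_image sh_restrict by simp
  then show ?thesis
    using collect_conj[OF fib_window_measurable[of "\<lambda>W. sh n ` W = V" "a + n" "b + n"] card_fib_measurable[of k]]
    by simp
qed

lemma occ_measurable: "{x \<in> XR. occ w n (fib x)} \<in> sets (symbolic_borel XR)"
  unfolding occ_def by (rule shifted_window_measurable)

lemma at_vertex_measurable: "{x \<in> XR. at_vertex \<alpha> n (fib x)} \<in> sets (symbolic_borel XR)"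
  unfolding at_vertex_def placement_def by (rule shifted_window_measurable)

lemma coded_measurable:
  "{x \<in> XR. \<exists>\<alpha> \<beta>. valid \<alpha> \<and> valid \<beta> \<and> base \<beta> = base \<alpha> \<and> coded_by \<alpha> \<beta> (fib x)} \<in> sets (symbolic_borel XR)"
proof -
  have eq: "{x \<in> XR. \<exists>\<alpha> \<beta>. valid \<alpha> \<and> valid \<beta> \<and> base \<beta> = base \<alpha> \<and> coded_by \<alpha> \<beta> (fib x)} =
    {x \<in> XR. \<exists>\<alpha>\<in>Collect valid. \<exists>\<beta>\<in>Collect valid \<inter> {\<beta>. base \<beta> = base \<alpha>}.
      (\<forall>N\<in>UNIV. \<exists>n\<in>{..N}. at_vertex \<alpha> n (fib x)) \<and> (\<forall>N\<in>UNIV. \<exists>n\<in>{N..}. at_vertex \<beta> n (fib x)) \<and>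
      (\<forall>w\<in>Collect tame \<inter> {w. prior w (base \<alpha>)}. \<forall>n\<in>UNIV. \<not> occ w n (fib x))}"
    unfolding coded_by_def by (intro Collect_cong) blast
  show ?thesis unfolding eq
    by (intro collect_conj collect_All collect_Ex collect_neg occ_measurable at_vertex_measurable countableI_type
        countable_valid countable_subset[OF Int_lower1 countable_valid] countable_subset[OF Int_lower1 countable_tame])
qed

end

lemma AE_of_emeasure_1:
  assumes "prob_space \<mu>" "emeasure \<mu> S = 1"
  shows "AE y in \<mu>. y \<in> S"
proof -
  interpret prob_space \<mu> by (rule assms(1))
  have "S \<in> sets \<mu>" using assms(2) by (intro emeasure_neq_0_sets) simp
  then show ?thesis using assms(2) by (simp add: AE_in_set_eq_1 emeasure_eq_measure)
qed

lemma emeasure_1_of_AE: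
  assumes "prob_space \<mu>" "S \<in> sets \<mu>" "AE y in \<mu>. y \<in> S"
  shows "emeasure \<mu> S = 1"
proof -
  interpret prob_space \<mu> by (rule assms(1))
  show ?thesis using assms(2,3) by (simp add: AE_in_set_eq_1 emeasure_eq_measure)
qed

section \<open>Fibre conditions as events in the factor\<close>

locale bowen_factor = bowen_graph A E R
  for A :: "'a set" and E R :: "('a \<times> 'a) set" +
  fixes Y :: "'y measure" and T :: "'y \<Rightarrow> 'y" and \<pi> :: "(int \<Rightarrow> 'a) \<Rightarrow> 'y"
  assumes automorphism: "borel_automorphism Y T"
    and semiconj: "semiconjugacy left_shift (regular_part A E) T (space Y) \<pi>"
    and \<pi>_measurable: "\<pi> \<in> measurable (symbolic_borel (regular_part A E)) Y"
    and \<pi>_eq_iff: "\<And>x y. x \<in> regular_part A E \<Longrightarrow> y \<in> regular_part A E \<Longrightarrow>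
      \<pi> x = \<pi> y \<longleftrightarrow> (\<forall>n. (x n, y n) \<in> R)"
begin

lemma T_measurable: "T \<in> measurable Y Y"
  and T_inj: "inj_on T (space Y)"
  and Y_standard: "standard_borel Y"
  using automorphism by (simp_all add: borel_automorphism_def bij_betw_def)

lemma \<pi>_space: "x \<in> XR \<Longrightarrow> \<pi> x \<in> space Y"
  using semiconj by (auto simp: semiconjugacy_def)

lemma \<pi>_sh: "x \<in> XR \<Longrightarrow> \<pi> (sh 1 x) = T (\<pi> x)"
  using semiconj by (simp add: semiconjugacy_def left_shift_eq_sh)

lemma \<pi>_eq_iff_fib: "x \<in> XR \<Longrightarrow> z \<in> XR \<Longrightarrow> \<pi> z = \<pi> x \<longleftrightarrow> z \<in> fib x"
  by (simp add: \<pi>_eq_iff fib_eq)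

text \<open>The predicate sees the whole fibre, so the set upstairs is a union of fibres: its image
  can be shown Borel, and membership can be tested at any representative.\<close>

definition fibre_event :: "((int \<Rightarrow> 'a) set \<Rightarrow> bool) \<Rightarrow> 'y set" where
  "fibre_event P = \<pi> ` {x \<in> XR. P (fib x)}"

lemma fibre_event_iff: "x \<in> XR \<Longrightarrow> \<pi> x \<in> fibre_event P \<longleftrightarrow> P (fib x)"
proof -
  assume x: "x \<in> XR"
  show "\<pi> x \<in> fibre_event P \<longleftrightarrow> P (fib x)"
  proof
    assume "\<pi> x \<in> fibre_event P"
    then obtain z where z: "z \<in> XR" "P (fib z)" "\<pi> x = \<pi> z" by (auto simp: fibre_event_def)
    then have "x \<in> fib z" using \<pi>_eq_iff_fib[OF z(1) x] by simp
    then show "P (fib x)" using fib_cong[OF z(1)] z(2) by simp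
  qed (use x in \<open>auto simp: fibre_event_def\<close>)
qed

text \<open>Injectivity of \<open>T\<close> is what keeps preimages inside the image of the regular
  part: if \<open>T y = \<pi> x\<close>, then \<open>y\<close> is the image of
  \<open>sh (- 1) x\<close>.\<close>

lemma fibre_event_shift: "T -` fibre_event P \<inter> space Y = fibre_event (\<lambda>F. P (sh 1 ` F))"
proof (intro equalityI subsetI)
  fix y assume y: "y \<in> T -` fibre_event P \<inter> space Y"
  then obtain x where x: "x \<in> XR" "P (fib x)" "T y = \<pi> x" by (auto simp: fibre_event_def)
  have x': "sh (- 1) x \<in> XR" using x(1) by (simp add: XR_sh)
  have "T (\<pi> (sh (- 1) x)) = T y" using \<pi>_sh[OF x'] x(3) by simp
  then have "y = \<pi> (sh (- 1) x)" using T_inj \<pi>_space[OF x'] y by (simp add: inj_on_def)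
  moreover have "P (sh 1 ` fib (sh (- 1) x))" using x(2) unfolding fib_sh[symmetric] by simp
  ultimately show "y \<in> fibre_event (\<lambda>F. P (sh 1 ` F))" using fibre_event_iff[OF x'] by simp
next
  fix y assume "y \<in> fibre_event (\<lambda>F. P (sh 1 ` F))"
  then obtain x where x: "x \<in> XR" "P (sh 1 ` fib x)" "y = \<pi> x" by (auto simp: fibre_event_def)
  have x': "sh 1 x \<in> XR" using x(1) by (simp add: XR_sh)
  have "\<pi> (sh 1 x) \<in> fibre_event P" using fibre_event_iff[OF x'] x(2) by (simp add: fib_sh)
  then show "y \<in> T -` fibre_event P \<inter> space Y" using x \<pi>_sh[OF x(1)] \<pi>_space[OF x(1)] by simp
qed

lemma fibre_event_measurable:
  assumes "\<pi> ` XR \<in> sets Y" "{x \<in> XR. P (fib x)} \<in> sets (symbolic_borel XR)"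
  shows "fibre_event P \<in> sets Y"
  unfolding fibre_event_def
proof (rule saturated_image_measurable[OF Y_standard A_countable _ enc_regular_part_borel[OF graph] \<pi>_measurable assms])
  show "XR \<subseteq> UNIV \<rightarrow> A" using XD(1)[OF XR_X] by auto
  fix x x' assume x: "x \<in> {x \<in> XR. P (fib x)}" "x' \<in> XR" "\<pi> x' = \<pi> x"
  then have "x' \<in> fib x" using \<pi>_eq_iff_fib by blast
  then show "x' \<in> {x \<in> XR. P (fib x)}" using x fib_cong[of x x'] by simp
qed

text \<open>Recurrence of the first marker only produces a path over almost every fibre. Regularity
  takes a second use of recurrence, for a vertex seen at time 0 with positive probability.\<close>

lemma coded_full_measure:
  assumes \<mu>: "ergodic_invariant_prob Y T \<mu>" and full: "emeasure \<mu> (\<pi> ` XR) = 1"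
  shows "emeasure \<mu> (fibre_event (\<lambda>F. \<exists>\<alpha> \<beta>. valid \<alpha> \<and> valid \<beta> \<and> base \<beta> = base \<alpha> \<and> coded_by \<alpha> \<beta> F)) = 1"
proof -
  have s: "sets \<mu> = sets Y" and p: "prob_space \<mu>" using \<mu> by (simp_all add: ergodic_invariant_prob_def)
  interpret prob_space \<mu> by (rule p)
  \<comment> \<open>A set outside the sigma-algebra would have \<open>emeasure\<close> 0, so measure
    1 already makes the image measurable.\<close>
  have im: "\<pi> ` XR \<in> sets Y" using full s emeasure_neq_0_sets[of \<mu> "\<pi> ` XR"] by simp
  have occ_Y: "fibre_event (occ w n) \<in> sets Y" for w n
    by (rule fibre_event_measurable[OF im occ_measurable])
  have at_Y: "fibre_event (at_vertex \<alpha> n) \<in> sets Y" for \<alpha> n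
    by (rule fibre_event_measurable[OF im at_vertex_measurable])
  have AE_fibre: "AE y in \<mu>. y \<in> \<pi> ` XR" by (rule AE_of_emeasure_1[OF p full])
  have null: "AE y in \<mu>. y \<notin> S" if "S \<in> sets Y" "emeasure \<mu> S = 0" for S
    using that s by (intro AE_not_in null_setsI) simp_all
  have not_False: "\<not> (AE y in \<mu>. False)"
  proof
    assume "AE y in \<mu>. False"
    then have "emeasure \<mu> (space \<mu>) = 0" by (simp add: AE_False)
    then show False using emeasure_space_1 by simp
  qed
  have recur: "AE y in \<mu>. (\<forall>N. \<exists>n\<le>N. y \<in> fibre_event (P n)) \<and> (\<forall>N. \<exists>n\<ge>N. y \<in> fibre_event (P n))"
    if "\<And>n. fibre_event (P n) \<in> sets Y" "\<And>n F. P n (sh 1 ` F) \<longleftrightarrow> P (n + 1) F" "emeasure \<mu> (fibre_event (P 0)) \<noteq> 0"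
    for P :: "int \<Rightarrow> (int \<Rightarrow> 'a) set \<Rightarrow> bool"
    by (rule recurrence[where B = "\<lambda>n. fibre_event (P n)", OF \<mu> T_measurable that(1) _ that(3)])
      (simp add: fibre_event_shift that(2))
  have const: "emeasure \<mu> (fibre_event (occ w n)) = emeasure \<mu> (fibre_event (occ w 0))" for w n
  proof (rule int_constant[of "\<lambda>n. emeasure \<mu> (fibre_event (occ w n))"])
    fix n
    have "T -` fibre_event (occ w n) \<inter> space Y = fibre_event (occ w (n + 1))" by (simp add: fibre_event_shift occ_sh)
    then show "emeasure \<mu> (fibre_event (occ w (n + 1))) = emeasure \<mu> (fibre_event (occ w n))"
      using emeasure_vimage_invariant[OF \<mu> T_measurable occ_Y[of w n]] by simp
  qed
  have "\<exists>w. tame w \<and> emeasure \<mu> (fibre_event (occ w 0)) \<noteq> 0"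
  proof (rule ccontr)
    assume "\<not> ?thesis"
    then have "\<forall>w\<in>Collect tame. AE y in \<mu>. y \<notin> fibre_event (occ w 0)" using null[OF occ_Y] by blast
    then have "AE y in \<mu>. \<forall>w\<in>Collect tame. y \<notin> fibre_event (occ w 0)"
      by (rule AE_ball_countable[OF countable_tame, THEN iffD2])
    with AE_fibre have "AE y in \<mu>. False"
    proof eventually_elim
      case (elim y)
      then obtain x where x: "x \<in> XR" "y = \<pi> x" by blast
      then show ?case using exists_marker[OF x(1)] fibre_event_iff[OF x(1)] elim(2) by blast
    qed
    with not_False show False by blast
  qed
  then obtain w0 where "tame w0" "emeasure \<mu> (fibre_event (occ w0 0)) \<noteq> 0" by blast
  then obtain w where w: "tame w" "emeasure \<mu> (fibre_event (occ w 0)) \<noteq> 0"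
      "\<And>w'. tame w' \<Longrightarrow> prior w' w \<Longrightarrow> emeasure \<mu> (fibre_event (occ w' 0)) = 0"
    using exists_prior_minimal[of w0 "\<lambda>w. emeasure \<mu> (fibre_event (occ w 0)) \<noteq> 0"] by blast
  have AE_prior: "AE y in \<mu>. \<forall>w'\<in>Collect tame \<inter> {w'. prior w' w}. \<forall>n\<in>UNIV. y \<notin> fibre_event (occ w' n)"
  proof (rule AE_ball_countable[THEN iffD2, OF countable_subset[OF Int_lower1 countable_tame]], rule ballI)
    fix w' assume w': "w' \<in> Collect tame \<inter> {w'. prior w' w}"
    show "AE y in \<mu>. \<forall>n\<in>UNIV. y \<notin> fibre_event (occ w' n)"
      by (rule AE_ball_countable[THEN iffD2, OF countableI_type])
        (use w' w(3)[of w'] const[of w'] null[OF occ_Y] in simp)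
  qed
  have AE_w: "AE y in \<mu>. (\<forall>N. \<exists>n\<le>N. y \<in> fibre_event (occ w n)) \<and> (\<forall>N. \<exists>n\<ge>N. y \<in> fibre_event (occ w n))"
    by (rule recur[of "occ w", OF occ_Y _ w(2)]) (rule occ_sh)
  \<comment> \<open>Otherwise, there being countably many vertices, almost no fibre would show a
    vertex over \<open>w\<close> at time 0, although \<open>fibre_path\<close> provides one.\<close>
  have "\<exists>\<alpha>. valid \<alpha> \<and> base \<alpha> = w \<and> emeasure \<mu> (fibre_event (at_vertex \<alpha> 0)) \<noteq> 0"
  proof (rule ccontr)
    assume "\<not> ?thesis"
    then have "\<forall>\<alpha>\<in>Collect valid \<inter> {\<alpha>. base \<alpha> = w}. AE y in \<mu>. y \<notin> fibre_event (at_vertex \<alpha> 0)"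
      using null[OF at_Y] by blast
    then have "AE y in \<mu>. \<forall>\<alpha>\<in>Collect valid \<inter> {\<alpha>. base \<alpha> = w}. y \<notin> fibre_event (at_vertex \<alpha> 0)"
      by (rule AE_ball_countable[THEN iffD2, OF countable_subset[OF Int_lower1 countable_valid]])
    with AE_fibre AE_prior AE_w have "AE y in \<mu>. False"
    proof eventually_elim
      case (elim y)
      then obtain x where x: "x \<in> XR" "y = \<pi> x" by blast
      have np: "\<not> occ w' n (fib x)" if "tame w'" "prior w' w" for w' n
        using elim(2) that fibre_event_iff[OF x(1)] x(2) by blast
      have "\<forall>N. \<exists>n\<le>N. occ w n (fib x)" "\<forall>N. \<exists>n\<ge>N. occ w n (fib x)"
        using elim(3) unfolding x(2) fibre_event_iff[OF x(1)] by simp_all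
      from fibre_path[OF x(1) w(1) this np] obtain c where
        c: "vpath c" "\<And>n. base (c n) = w" "\<And>n. at_vertex (c n) n (fib x)" by blast
      have "c 0 \<in> Collect valid \<inter> {\<alpha>. base \<alpha> = w}" using vpathD(1)[OF c(1)] c(2) by simp
      then have "y \<notin> fibre_event (at_vertex (c 0) 0)" using elim(4) by blast
      then show False using c(3)[of 0] fibre_event_iff[OF x(1)] x(2) by simp
    qed
    with not_False show False by blast
  qed
  then obtain \<alpha> where \<alpha>: "valid \<alpha>" "base \<alpha> = w" "emeasure \<mu> (fibre_event (at_vertex \<alpha> 0)) \<noteq> 0" by blast
  have AE_\<alpha>: "AE y in \<mu>. (\<forall>N. \<exists>n\<le>N. y \<in> fibre_event (at_vertex \<alpha> n)) \<and> (\<forall>N. \<exists>n\<ge>N. y \<in> fibre_event (at_vertex \<alpha> n))"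
    by (rule recur[of "at_vertex \<alpha>", OF at_Y _ \<alpha>(3)]) (rule at_vertex_sh)
  let ?G = "fibre_event (\<lambda>F. \<exists>\<alpha> \<beta>. valid \<alpha> \<and> valid \<beta> \<and> base \<beta> = base \<alpha> \<and> coded_by \<alpha> \<beta> F)"
  have "AE y in \<mu>. y \<in> ?G"
    using AE_fibre AE_prior AE_\<alpha>
  proof eventually_elim
    case (elim y)
    then obtain x where x: "x \<in> XR" "y = \<pi> x" by blast
    have np: "\<not> occ w' n (fib x)" if "tame w'" "prior w' w" for w' n
      using elim(2) that fibre_event_iff[OF x(1)] x(2) by blast
    have "\<forall>N. \<exists>n\<le>N. at_vertex \<alpha> n (fib x)" "\<forall>N. \<exists>n\<ge>N. at_vertex \<alpha> n (fib x)"
      using elim(3) unfolding x(2) fibre_event_iff[OF x(1)] by simp_all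
    \<comment> \<open>The same vertex recurs in both time directions, so it serves for the past and
      for the future.\<close>
    then have "coded_by \<alpha> \<alpha> (fib x)" unfolding coded_by_def \<alpha>(2) using np by blast
    then show ?case unfolding x(2) fibre_event_iff[OF x(1)] using \<alpha>(1) by blast
  qed
  moreover have "?G \<in> sets \<mu>" unfolding s by (rule fibre_event_measurable[OF im coded_measurable])
  ultimately show ?thesis by (intro emeasure_1_of_AE[OF p])
qed

lemma strand_in_XR: "vpath x \<Longrightarrow> strand x \<in> XR"
  using strand_XR strand(1) by blast

lemma fib_of_strand: "vpath x \<Longrightarrow> fib (strand x) = strands x"
  using fib_strand strand(1) by blast

text \<open>\<open>strand (sh 1 x)\<close> and \<open>sh 1 (strand x)\<close> may be different
  strands, but they lie in the same fibre, so \<pi> does not tell them apart.\<close>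

lemma strand_semiconj:
  assumes x: "vpath x"
  shows "\<pi> (strand (sh 1 x)) = T (\<pi> (strand x))"
proof -
  have x': "vpath (sh 1 x)" using vpath_sh[OF x, of 1] by (simp add: sh_def)
  have "strands (sh 1 x) = sh 1 ` strands x" using strands_sh[of x 1] by (simp add: sh_def)
  then have "sh 1 (strand x) \<in> fib (strand (sh 1 x))"
    using fib_of_strand[OF x'] strand(1)[OF x] by simp
  then have "\<pi> (sh 1 (strand x)) = \<pi> (strand (sh 1 x))"
    using \<pi>_eq_iff_fib[OF strand_in_XR[OF x']] strand_in_XR[OF x] XR_sh by blast
  then show ?thesis using \<pi>_sh[OF strand_in_XR[OF x]] by simp
qed

lemma strand_inj: "inj_on (\<pi> \<circ> strand) (Collect vpath)"
proof (rule inj_onI)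
  fix x y assume "x \<in> Collect vpath" "y \<in> Collect vpath" and eq: "(\<pi> \<circ> strand) x = (\<pi> \<circ> strand) y"
  then have x: "vpath x" and y: "vpath y" by simp_all
  have "strand x \<in> fib (strand y)"
    using \<pi>_eq_iff_fib[OF strand_in_XR[OF y] strand_in_XR[OF x]] eq by simp
  then have "fib (strand x) = fib (strand y)" by (rule fib_cong[OF strand_in_XR[OF y]])
  then show "x = y" using fib_of_strand x y by (intro vpath_unique) simp_all
qed

lemma strand_image:
  "(\<pi> \<circ> strand) ` regular_part coding_vertices coding_edges =
    fibre_event (\<lambda>F. \<exists>\<alpha> \<beta>. valid \<alpha> \<and> valid \<beta> \<and> base \<beta> = base \<alpha> \<and> coded_by \<alpha> \<beta> F)"
proof (intro equalityI subsetI)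
  fix y assume "y \<in> (\<pi> \<circ> strand) ` regular_part coding_vertices coding_edges"
  then obtain x where x: "x \<in> regular_part coding_vertices coding_edges" "y = \<pi> (strand x)" by auto
  then have vp: "vpath x" unfolding regular_part_iff coding_shift by simp
  have "\<exists>\<alpha> \<beta>. valid \<alpha> \<and> valid \<beta> \<and> base \<beta> = base \<alpha> \<and> coded_by \<alpha> \<beta> (fib (strand x))"
    using fib_coded_iff[OF strand_in_XR[OF vp]] x(1) fib_of_strand[OF vp] by blast
  then show "y \<in> fibre_event (\<lambda>F. \<exists>\<alpha> \<beta>. valid \<alpha> \<and> valid \<beta> \<and> base \<beta> = base \<alpha> \<and> coded_by \<alpha> \<beta> F)"
    unfolding x(2) fibre_event_iff[OF strand_in_XR[OF vp]] .
next
  fix y assume "y \<in> fibre_event (\<lambda>F. \<exists>\<alpha> \<beta>. valid \<alpha> \<and> valid \<beta> \<and> base \<beta> = base \<alpha> \<and> coded_by \<alpha> \<beta> F)"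
  then obtain z where z: "z \<in> XR" "y = \<pi> z"
    "\<exists>\<alpha> \<beta>. valid \<alpha> \<and> valid \<beta> \<and> base \<beta> = base \<alpha> \<and> coded_by \<alpha> \<beta> (fib z)" by (auto simp: fibre_event_def)
  then obtain x where x: "x \<in> regular_part coding_vertices coding_edges" "strands x = fib z"
    using fib_coded_iff[OF z(1)] by blast
  then have vp: "vpath x" unfolding regular_part_iff coding_shift by simp
  have "strand x \<in> fib z" using strand(1)[OF vp] x(2) by simp
  then have "\<pi> (strand x) = y" using \<pi>_eq_iff_fib[OF z(1) strand_in_XR[OF vp]] z(2) by simp
  then show "y \<in> (\<pi> \<circ> strand) ` regular_part coding_vertices coding_edges" using x(1) by force
qed

end

section \<open>Renaming the vertices as natural numbers\<close>

definition recode :: "('b \<Rightarrow> 'c) \<Rightarrow> (int \<Rightarrow> 'b) \<Rightarrow> int \<Rightarrow> 'c" where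
  "recode f x = (\<lambda>n. f (x n))"

lemma recode_markov_shift:
  assumes inj: "inj_on c V" and E: "E \<subseteq> V \<times> V" and d: "\<And>v. v \<in> V \<Longrightarrow> d (c v) = v"
  shows "bij_betw (recode d) (markov_shift (c ` V) (map_prod c c ` E)) (markov_shift V E)"
    and "bij_betw (recode d) (regular_part (c ` V) (map_prod c c ` E)) (regular_part V E)"
proof -
  have cd: "c (d n) = n" if "n \<in> c ` V" for n using that d by auto
  have dX: "recode d y \<in> markov_shift V E" if "y \<in> markov_shift (c ` V) (map_prod c c ` E)" for y
    unfolding markov_shift_def mem_Collect_eq recode_def
  proof (intro conjI allI)
    fix n
    have "(y n, y (n + 1)) \<in> map_prod c c ` E" using that by (simp add: markov_shift_def)
    then obtain a b where "(a, b) \<in> E" "y n = c a" "y (n + 1) = c b" by auto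
    moreover from this have "a \<in> V" "b \<in> V" using E by auto
    ultimately show "d (y n) \<in> V" "(d (y n), d (y (n + 1))) \<in> E" using d by simp_all
  qed
  have cX: "recode c x \<in> markov_shift (c ` V) (map_prod c c ` E)" if "x \<in> markov_shift V E" for x
    using that by (auto simp: markov_shift_def recode_def)
  have 1: "recode c (recode d y) = y" if "y \<in> markov_shift (c ` V) (map_prod c c ` E)" for y
    using that cd by (auto simp: markov_shift_def recode_def)
  have 2: "recode d (recode c x) = x" if "x \<in> markov_shift V E" for x
    using that d by (auto simp: markov_shift_def recode_def)
  show "bij_betw (recode d) (markov_shift (c ` V) (map_prod c c ` E)) (markov_shift V E)"
    by (rule bij_betwI[of _ _ _ "recode c"]) (use dX cX 1 2 in auto)
  have "recode d y \<in> regular_part V E" if y: "y \<in> regular_part (c ` V) (map_prod c c ` E)" for y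
  proof -
    obtain u v where "\<And>N. \<exists>n\<le>N. y n = u" "\<And>N. \<exists>n\<ge>N. y n = v" using y unfolding regular_part_iff by blast
    then have "\<forall>N. \<exists>n\<le>N. recode d y n = d u" "\<forall>N. \<exists>n\<ge>N. recode d y n = d v"
      unfolding recode_def by metis+
    then show ?thesis using dX y unfolding regular_part_iff by blast
  qed
  moreover have "recode c x \<in> regular_part (c ` V) (map_prod c c ` E)" if x: "x \<in> regular_part V E" for x
  proof -
    obtain u v where "\<And>N. \<exists>n\<le>N. x n = u" "\<And>N. \<exists>n\<ge>N. x n = v" using x unfolding regular_part_iff by blast
    then have "\<forall>N. \<exists>n\<le>N. recode c x n = c u" "\<forall>N. \<exists>n\<ge>N. recode c x n = c v"
      unfolding recode_def by metis+
    then show ?thesis using cX x unfolding regular_part_iff by blast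
  qed
  ultimately show "bij_betw (recode d) (regular_part (c ` V) (map_prod c c ` E)) (regular_part V E)"
    by (intro bij_betwI[of _ _ _ "recode c"]) (use 1 2 in \<open>auto simp: regular_part_def\<close>)
qed

theorem mainTheorem5:
  fixes A :: "'a set" and E R :: "('a \<times> 'a) set"
    and Y :: "'y measure" and T :: "'y \<Rightarrow> 'y" and \<pi> :: "(int \<Rightarrow> 'a) \<Rightarrow> 'y"
  assumes "alphabet_graph A E"
    and "borel_automorphism Y T"
    and "semiconjugacy left_shift (regular_part A E) T (space Y) \<pi>"
    and "\<pi> \<in> measurable (symbolic_borel (regular_part A E)) Y"
    and "\<forall>y\<in>space Y. finite {x \<in> regular_part A E. \<pi> x = y}"
    and "bowen_property A R (regular_part A E) \<pi>"
    and "locally_finite_on A R"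
  shows "\<exists>(A' :: nat set) (E' :: (nat \<times> nat) set) (\<phi> :: (int \<Rightarrow> nat) \<Rightarrow> (int \<Rightarrow> 'a)).
           alphabet_graph A' E' \<and>
           \<phi> \<in> markov_shift A' E' \<rightarrow> regular_part A E \<and>
           one_lipschitz_on (markov_shift A' E') \<phi> \<and>
           semiconjugacy left_shift (markov_shift A' E') T (space Y) (\<pi> \<circ> \<phi>) \<and>
           inj_on (\<pi> \<circ> \<phi>) (markov_shift A' E') \<and>
           (\<forall>\<mu>. ergodic_invariant_prob Y T \<mu> \<longrightarrow>
                emeasure \<mu> (\<pi> ` regular_part A E) = 1 \<longrightarrow>
                emeasure \<mu> ((\<pi> \<circ> \<phi>) ` regular_part A' E') = 1)"
proof -
  have bowen: "\<pi> x = \<pi> y \<longleftrightarrow> (\<forall>n. (x n, y n) \<in> R)" if "x \<in> regular_part A E" "y \<in> regular_part A E" for x y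
    using assms(6) that unfolding bowen_property_def by blast
  interpret bowen_factor A E R Y T \<pi>
  proof (intro_locales; unfold_locales)
    show "alphabet_graph A E" "locally_finite_on A R" "borel_automorphism Y T"
      "semiconjugacy left_shift (regular_part A E) T (space Y) \<pi>"
      "\<pi> \<in> measurable (symbolic_borel (regular_part A E)) Y" by (rule assms)+
    show "R \<subseteq> A \<times> A" "sym R" "\<And>a. a \<in> A \<Longrightarrow> (a, a) \<in> R"
      using assms(6) by (auto simp: bowen_property_def refl_on_def)
  next
    fix x y assume "x \<in> regular_part A E" "y \<in> regular_part A E"
    then show "\<pi> x = \<pi> y \<longleftrightarrow> (\<forall>n. (x n, y n) \<in> R)" by (rule bowen)
  next
    \<comment> \<open>Transitivity is inherited from equality of the images under \<pi>.\<close>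
    fix x y z assume r: "x \<in> regular_part A E" "y \<in> regular_part A E" "z \<in> regular_part A E"
      "\<forall>n. (x n, y n) \<in> R" "\<forall>n. (y n, z n) \<in> R"
    then have "\<pi> x = \<pi> z" using bowen[OF r(1,2)] bowen[OF r(2,3)] by simp
    then show "\<forall>n. (x n, z n) \<in> R" using bowen[OF r(1,3)] by simp
  next
    fix x assume x: "x \<in> regular_part A E"
    have "\<pi> x \<in> space Y" using assms(3) x by (auto simp: semiconjugacy_def)
    moreover have "{z \<in> regular_part A E. \<forall>n. (z n, x n) \<in> R} = {z \<in> regular_part A E. \<pi> z = \<pi> x}"
      using bowen[OF _ x] by blast
    ultimately show "finite {z \<in> regular_part A E. \<forall>n. (z n, x n) \<in> R}" using assms(5) by simp
  qed
  define c where "c = to_nat_on coding_vertices"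
  define d where "d = from_nat_into coding_vertices"
  define A' where "A' = c ` coding_vertices"
  define E' where "E' = map_prod c c ` coding_edges"
  define \<phi> where "\<phi> = strand \<circ> recode d"
  have V: "countable coding_vertices" "coding_edges \<subseteq> coding_vertices \<times> coding_vertices"
    using coding_graph by (auto simp: alphabet_graph_def)
  have d: "d (c v) = v" if "v \<in> coding_vertices" for v
    using V(1) that by (simp add: c_def d_def)
  have inj: "inj_on c coding_vertices" unfolding c_def by (rule inj_on_to_nat_on[OF V(1)])
  note bij = recode_markov_shift[OF inj V(2) d, folded A'_def E'_def]
  have vp: "vpath (recode d x)" if "x \<in> markov_shift A' E'" for x
    using bij_betw_apply[OF bij(1) that] by (simp add: coding_shift)
  have "alphabet_graph A' E'"
    using V by (auto simp: alphabet_graph_def A'_def E'_def)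
  moreover have "\<phi> \<in> markov_shift A' E' \<rightarrow> regular_part A E"
    using strand_in_XR[OF vp] by (simp add: \<phi>_def)
  moreover have "one_lipschitz_on (markov_shift A' E') \<phi>"
    unfolding one_lipschitz_on_def
  proof (intro ballI)
    fix x y assume xy: "x \<in> markov_shift A' E'" "y \<in> markov_shift A' E'"
    \<comment> \<open>A letterwise map cannot create an earlier disagreement, so the Lipschitz
      constant stays 1.\<close>
    have "sdist (recode d x) (recode d y) \<le> sdist x y"
      by (rule sdist_le_if_agree) (simp add: recode_def)
    then show "sdist (\<phi> x) (\<phi> y) \<le> sdist x y"
      using strand_lipschitz[OF vp[OF xy(1)] vp[OF xy(2)]] by (simp add: \<phi>_def)
  qed
  moreover have "semiconjugacy left_shift (markov_shift A' E') T (space Y) (\<pi> \<circ> \<phi>)"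
    unfolding semiconjugacy_def
  proof (intro conjI ballI funcsetI)
    fix x assume x: "x \<in> markov_shift A' E'"
    show "(\<pi> \<circ> \<phi>) x \<in> space Y" using \<pi>_space[OF strand_in_XR[OF vp[OF x]]] by (simp add: \<phi>_def)
    have "recode d (left_shift x) = sh 1 (recode d x)" by (simp add: recode_def left_shift_def sh_def)
    then show "(\<pi> \<circ> \<phi>) (left_shift x) = T ((\<pi> \<circ> \<phi>) x)"
      using strand_semiconj[OF vp[OF x]] by (simp add: \<phi>_def)
  qed
  moreover have "inj_on (\<pi> \<circ> \<phi>) (markov_shift A' E')"
    using comp_inj_on[of "recode d" "markov_shift A' E'" "\<pi> \<circ> strand"] bij(1) strand_inj
    unfolding bij_betw_def coding_shift by (simp add: \<phi>_def comp_assoc)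
  moreover have "(\<pi> \<circ> \<phi>) ` regular_part A' E' =
      fibre_event (\<lambda>F. \<exists>\<alpha> \<beta>. valid \<alpha> \<and> valid \<beta> \<and> base \<beta> = base \<alpha> \<and> coded_by \<alpha> \<beta> F)"
  proof -
    have "recode d ` regular_part A' E' = regular_part coding_vertices coding_edges"
      by (rule bij_betw_imp_surj_on[OF bij(2)])
    then show ?thesis unfolding strand_image[symmetric] \<phi>_def comp_assoc[symmetric] image_comp[symmetric] by simp
  qed
  ultimately show ?thesis using coded_full_measure
    by (intro exI[of _ A'] exI[of _ E'] exI[of _ \<phi>] conjI allI impI) simp_all
qed

end
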